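(* There exist numerical constants $\mu_1>0$ and $\mu_2\ge 1$ such that the following holds. Let $c>0$, let $(X,Y)$ be a random pair with values in $\mathbb{R}^d\times\mathbb{R}$ and distribution $P$, and let $s$ be an optimal predictor for the Huber loss $\phi_c$ such that for some $\eta>0$, $P\left[\,|Y-s(X)|\le \tfrac{c}{2}\,\big|\,X\right]\ge\eta$ almost surely. Let $D_n=(X_i,Y_i)_{1\le i\le n}\sim P^{\otimes n}$. Let $n_t$ be an integer with $\max(3,\tfrac n2)\le n_t<n$, let $n_v=n-n_t$, and let $\mathcal{T}=(T_1,\dots,T_V)$ be a collection of subsets of $\{1,\dots,n\}$, each of cardinality $n_t$, with $\mathcal{T}$ independent from $D_n$. Let $K$ be an integer with $3\le K\le e^{\sqrt{n_v}}$, and let $(\mathcal{A}_k)_{1\le k\le K}$ be a collection of linear regression estimators, $\mathcal{A}_k(D): x\mapsto \hat q_k(D)+\langle\hat\theta_k(D),x\rangle$, such that for every $m\ge 1$ and every dataset $D_m=(X_i,Y_i)_{1\le i\le m}\sim P^{\otimes m}$: (1) almost surely, for all $1\le k\le K$, $\|\hat\theta_k(D_m)\|_0\le k$; (2) for all $1\le k\le K$, $\hat q_k(D_m)\in\operatorname{argmin}_{q\in\hat Q(D_m,\hat\theta_k(D_m))}\left|q+\langle\hat\theta_k(D_m),\tfrac1m\sum_{i=1}^mX_i\rangle\right|$, where $\hat Q(D_m,\theta)=\operatorname{argmin}_{q\in\mathbb{R}}\tfrac1m\sum_{i=1}^m\phi_c(Y_i-\langle\theta,X_i\rangle-q)$.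 Assume there is a constant $\nu_0$ such that $$\kappa(K)\log\kappa(K)\le\nu_0\sqrt{\frac{n_v}{\log(n_t\vee K)}}.$$ Assume there are real numbers $L,\alpha$ (with $\alpha\ge-3$) such that, for $D_{n_t}=(X_i,Y_i)_{1\le i\le n_t}\sim P^{\otimes n_t}$ and $X\sim X_1$ independent from $D_{n_t}$, $$\mathbb{E}\Big[\max_{1\le k\le K}\max_{1\le i\le n_t}\big|\langle\hat\theta_k(D_{n_t}),X_i-\mathbb{E}X\rangle\big|\Big]\le Ln_t^\alpha,\qquad \mathbb{E}\Big[\max_{1\le k\le K}\mathbb{E}\big[\,|\langle\hat\theta_k(D_{n_t}),X-\mathbb{E}X\rangle|\,\big|\,D_{n_t}\big]\Big]\le Ln_t^\alpha.$$ Then for every $\theta\in\mathbb{R}$ such that $\sqrt{\alpha+3}\,\frac{\mu_2\nu_0}{\eta}\le\theta<1$, $$(1-\theta)\,\mathbb{E}\big[\ell(s,\hat f^{\mathrm{ag}}_{\mathcal{T}})\big]\le(1+\theta)\,\mathbb{E}\Big[\min_{1\le k\le K}\ell(s,\mathcal{A}_k(D_{n_t}))\Big]+54(\alpha+3)\frac{c^2\log(K\vee n_t)}{\theta\eta n_v}+\frac{7\mu_1Lc\log K}{\theta n_t\sqrt{n_v}},$$ where $\hat f^{\mathrm{ag}}_{\mathcal{T}}$ is the Agghoo estimator built from $(\mathcal{A}_k)_{1\le k\le K}$, $D_n$ and $\mathcal{T}$.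
   Context: Huber loss: $\phi_c(u)=\frac{u^2}{2}\mathbb{I}_{|u|\le c}+c(|u|-\frac c2)\mathbb{I}_{|u|>c}$. Optimal predictor: a measurable $s:\mathbb{R}^d\to\mathbb{R}$ with $s(x)\in\operatorname{argmin}_{u\in\mathbb{R}}\mathbb{E}[\phi_c(Y-u)\mid X=x]$ for almost all $x$. Excess risk of a predictor $t$: $\ell(s,t)=\mathcal{L}(t)-\mathcal{L}(s)$ with $\mathcal{L}(t)=\mathbb{E}[\phi_c(Y-t(X))]$. (No moment assumption is made on $Y$: if $Y$ is not integrable, one reads $\ell(s,t)=\mathbb{E}[\phi_c(Y-t(X))-\phi_c(Y-s(X))]$ and $s(x)\in\operatorname{argmin}_u\mathbb{E}[\phi_c(Y-u)-\phi_c(Y)\mid X=x]$.) For a predictor built from data, $(X,Y)\sim P$ in $\ell$ is a fresh pair independent of the data and $\ell(s,\cdot)$ is evaluated with the data fixed. $\|\theta\|_0$ is the number of non-zero components of $\theta$; $a\vee b=\max(a,b)$. Orlicz norm: $\|Z\|_{L^{\psi_1}}=\inf\{u>0:\mathbb{E}[\psi_1(|Z|/u)]\le1\}$ with $\psi_1(x)=e^x-1$ and $\inf\emptyset=+\infty$. With $\bar X=X-\mathbb{E}X$ ($X$ having finite second moments), for $m\in\mathbb{N}$, $$\kappa(m)=\Big(\sup_{\theta\in\mathbb{R}^d,\ \theta\ne0,\ \|\theta\|_0\le2m}\frac{\|\langle\bar X,\theta\rangle\|_{L^{\psi_1}}}{\|\langle\bar X,\theta\rangle\|_{L^2}}\Big)\vee\frac1{\log2},$$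 quotients $0/0$ being ignored. Hold-out and Agghoo: for $T\subset\{1,\dots,n\}$ let $D_n^T=(X_i,Y_i)_{i\in T}$ and $$\hat k_T(D_n)=\min\operatorname{argmin}_{1\le k\le K}\frac1{|T^c|}\sum_{i\notin T}\phi_c\big(Y_i-\hat q_k(D_n^T)-\langle\hat\theta_k(D_n^T),X_i\rangle\big).$$ The hold-out predictor is $\hat f^{\mathrm{ho}}_T:x\mapsto\hat q_{\hat k_T(D_n)}(D_n^T)+\langle\hat\theta_{\hat k_T(D_n)}(D_n^T),x\rangle$, and Agghoo is $\hat f^{\mathrm{ag}}_{\mathcal{T}}=\frac1V\sum_{i=1}^V\hat f^{\mathrm{ho}}_{T_i}$. *)

theory Defs
  imports "HOL-Probability.Probability"
begin

text \<open>
  The constants in the theorem must not depend on the dimension, so the dimension has to be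
  quantified inside the statement.  Hence vectors of dimension d are functions on the index set
  {1..d}, undefined outside of it, and a dataset of size m is a function on {1..m} whose i-th value
  is the pair formed by the i-th covariate vector and the i-th response.
\<close>

type_synonym vec = "nat \<Rightarrow> real"
type_synonym sample = "vec \<times> real"
type_synonym dataset = "nat \<Rightarrow> sample"
type_synonym predictor = "vec \<Rightarrow> real"

definition Rd :: "nat \<Rightarrow> vec measure" where
  "Rd d = (\<Pi>\<^sub>M j\<in>{1..d}. borel)"

definition dot :: "nat \<Rightarrow> vec \<Rightarrow> vec \<Rightarrow> real" where
  "dot d \<theta> x = (\<Sum>j\<in>{1..d}. \<theta> j * x j)"

definition l0 :: "nat \<Rightarrow> vec \<Rightarrow> nat" where
  "l0 d \<theta> = card {j \<in> {1..d}. \<theta> j \<noteq> 0}"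

definition linpred :: "nat \<Rightarrow> real \<Rightarrow> vec \<Rightarrow> predictor" where
  "linpred d q \<theta> = (\<lambda>x. q + dot d \<theta> x)"

definition huber :: "real \<Rightarrow> real \<Rightarrow> real" where
  "huber c u = (if \<bar>u\<bar> \<le> c then u\<^sup>2 / 2 else c * (\<bar>u\<bar> - c / 2))"


text \<open>
  Expectation of an extended real variable, as the integral of the positive part minus that of the
  negative part.  If both are infinite the value is \<infinity>, by the convention of the type
  \<^typ>\<open>ereal\<close>.  The Bochner integral would silently turn an infinite expectation into 0.
\<close>

definition ext_integral :: "'a measure \<Rightarrow> ('a \<Rightarrow> ereal) \<Rightarrow> ereal" where
  "ext_integral M f =
     enn2ereal (\<integral>\<^sup>+z. e2ennreal (f z) \<partial>M) - enn2ereal (\<integral>\<^sup>+z. e2ennreal (- f z) \<partial>M)"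


text \<open>
  In what follows P is the joint law of (X, Y).  The next predicate says that N is a regular
  conditional distribution of Y given X.  It exists and is unique up to a null set of the law of X,
  because Y is real valued; so it does not matter that the optimal predictor is defined with
  ``some'' N.
\<close>

definition cond_law :: "nat \<Rightarrow> sample measure \<Rightarrow> (vec \<Rightarrow> real measure) \<Rightarrow> bool" where
  "cond_law d P N \<longleftrightarrow>
     N \<in> Rd d \<rightarrow>\<^sub>M prob_algebra borel \<and>
     (\<forall>A\<in>sets (Rd d). \<forall>B\<in>sets borel.
        emeasure P (A \<times> B) = (\<integral>\<^sup>+x\<in>A. emeasure (N x) B \<partial>distr P (Rd d) fst))"

text \<open>
  The term \<^term>\<open>huber c y\<close> is subtracted because no moment of Y is assumed: the difference is
  bounded in y, hence integrable.
\<close>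

definition optimal_predictor :: "nat \<Rightarrow> real \<Rightarrow> sample measure \<Rightarrow> predictor \<Rightarrow> bool" where
  "optimal_predictor d c P s \<longleftrightarrow>
     s \<in> borel_measurable (Rd d) \<and>
     (\<exists>N. cond_law d P N \<and>
        (AE x in distr P (Rd d) fst.
           is_arg_min (\<lambda>u. \<integral>y. (huber c (y - u) - huber c y) \<partial>N x) (\<lambda>_. True) (s x)))"

definition excess_risk :: "real \<Rightarrow> sample measure \<Rightarrow> predictor \<Rightarrow> predictor \<Rightarrow> ereal" where
  "excess_risk c P s t =
     ext_integral P (\<lambda>(x, y). ereal (huber c (y - t x) - huber c (y - s x)))"

definition sigma_X :: "nat \<Rightarrow> sample measure \<Rightarrow> sample measure" where
  "sigma_X d P = vimage_algebra (space P) fst (Rd d)"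

definition mean_X :: "nat \<Rightarrow> sample measure \<Rightarrow> vec" where
  "mean_X d P = (\<lambda>j\<in>{1..d}. \<integral>z. fst z j \<partial>P)"


definition psi1_norm :: "'a measure \<Rightarrow> ('a \<Rightarrow> real) \<Rightarrow> ennreal" where
  "psi1_norm M Z = Inf {ennreal u |u. 0 < u \<and> (\<integral>\<^sup>+z. ennreal (exp (\<bar>Z z\<bar> / u) - 1) \<partial>M) \<le> 1}"

definition L2_norm :: "'a measure \<Rightarrow> ('a \<Rightarrow> real) \<Rightarrow> ennreal" where
  "L2_norm M Z = ennreal (sqrt (\<integral>z. (Z z)\<^sup>2 \<partial>M))"

definition kappa :: "nat \<Rightarrow> sample measure \<Rightarrow> nat \<Rightarrow> ennreal" where
  "kappa d P m =
     (let Z = (\<lambda>\<theta> z. dot d \<theta> (fst z - mean_X d P)) in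
      max (SUP \<theta> \<in> {\<theta> \<in> space (Rd d). (\<exists>j\<in>{1..d}. \<theta> j \<noteq> 0) \<and> l0 d \<theta> \<le> 2 * m \<and>
                        \<not> (psi1_norm P (Z \<theta>) = 0 \<and> L2_norm P (Z \<theta>) = 0)}.
             psi1_norm P (Z \<theta>) / L2_norm P (Z \<theta>))
          (ennreal (1 / ln 2)))"


definition emp_risk :: "nat \<Rightarrow> real \<Rightarrow> nat \<Rightarrow> dataset \<Rightarrow> vec \<Rightarrow> real \<Rightarrow> real" where
  "emp_risk d c m D \<theta> q =
     (1 / real m) * (\<Sum>i\<in>{1..m}. huber c (snd (D i) - dot d \<theta> (fst (D i)) - q))"

definition emp_mean_X :: "nat \<Rightarrow> dataset \<Rightarrow> vec" where
  "emp_mean_X m D = (\<lambda>j. (1 / real m) * (\<Sum>i\<in>{1..m}. fst (D i) j))"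

text \<open>
  Estimators take the sample size as an explicit argument, since a function on {1..m} that is
  undefined elsewhere is also one on {1..m+1}.  Thus \<^term>\<open>qh k m D\<close> and \<^term>\<open>th k m D\<close> are the
  intercept and the coefficients computed by the k-th estimator from the dataset D of size m.
\<close>

type_synonym intercepts = "nat \<Rightarrow> nat \<Rightarrow> dataset \<Rightarrow> real"
type_synonym coefficients = "nat \<Rightarrow> nat \<Rightarrow> dataset \<Rightarrow> vec"

text \<open>The observations with index in T, renumbered from 1 to card T in increasing order.\<close>

definition subsample :: "dataset \<Rightarrow> nat set \<Rightarrow> dataset" where
  "subsample D T = (\<lambda>j\<in>{1..card T}. D (sorted_list_of_set T ! (j - 1)))"

definition trained :: "nat \<Rightarrow> intercepts \<Rightarrow> coefficients \<Rightarrow> dataset \<Rightarrow> nat set \<Rightarrow> nat \<Rightarrow> predictor" where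
  "trained d qh th D T k =
     linpred d (qh k (card T) (subsample D T)) (th k (card T) (subsample D T))"

definition holdout_risk ::
  "nat \<Rightarrow> real \<Rightarrow> intercepts \<Rightarrow> coefficients \<Rightarrow> nat \<Rightarrow> dataset \<Rightarrow> nat set \<Rightarrow> nat \<Rightarrow> real" where
  "holdout_risk d c qh th n D T k =
     (1 / real (card ({1..n} - T))) *
       (\<Sum>i\<in>{1..n} - T. huber c (snd (D i) - trained d qh th D T k (fst (D i))))"

definition holdout_index ::
  "nat \<Rightarrow> real \<Rightarrow> intercepts \<Rightarrow> coefficients \<Rightarrow> nat \<Rightarrow> nat \<Rightarrow> dataset \<Rightarrow> nat set \<Rightarrow> nat" where
  "holdout_index d c qh th K n D T =
     Min {k. is_arg_min (holdout_risk d c qh th n D T) (\<lambda>k. k \<in> {1..K}) k}"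

definition holdout ::
  "nat \<Rightarrow> real \<Rightarrow> intercepts \<Rightarrow> coefficients \<Rightarrow> nat \<Rightarrow> nat \<Rightarrow> dataset \<Rightarrow> nat set \<Rightarrow> predictor" where
  "holdout d c qh th K n D T = trained d qh th D T (holdout_index d c qh th K n D T)"

definition agghoo ::
  "nat \<Rightarrow> real \<Rightarrow> intercepts \<Rightarrow> coefficients \<Rightarrow> nat \<Rightarrow> nat \<Rightarrow> dataset \<Rightarrow> nat \<Rightarrow> (nat \<Rightarrow> nat set) \<Rightarrow>
     predictor" where
  "agghoo d c qh th K n D V \<T> =
     (\<lambda>x. (1 / real V) * (\<Sum>i\<in>{1..V}. holdout d c qh th K n D (\<T> i) x))"

text \<open>The finite set of possible values of the collection of training sets.\<close>

definition collections :: "nat \<Rightarrow> nat \<Rightarrow> nat \<Rightarrow> (nat \<Rightarrow> nat set) set" where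
  "collections n nt V = {1..V} \<rightarrow>\<^sub>E {T. T \<subseteq> {1..n} \<and> card T = nt}"

end

(*
  By convexity of the Huber loss it suffices to treat one hold-out, conditionally on the training
  data. Fix the predictors t_1, ..., t_K and the oracle t_0. If s is not integrable, all excess risks
  are infinite. Otherwise:

  The margin assumption and the first-order condition for s give
  l(s,t_k) + l(s,t_0) >= (eta/2) E huber_c(g) with g = t_k - t_0, which is an intercept plus a centered
  sparse linear form. With rho^2 = E g^2, the Orlicz assumption yields E[g^2 exp(r|g|)] <= 13 rho^2 for
  r <= 1/(100 rho kappa ln kappa). This serves twice: it makes E huber_c(g) at least of order
  min(rho^2, c rho/(kappa ln kappa)), and it is a Chernoff bound for the difference of the losses.
  Hence with conditional probability 1 - K exp(-x), x = (alpha+3) ln(max(nt, K)), the deviation is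
  absorbed by theta (l(s,t_k) + l(s,t_0)) + 54 c^2 x/(theta eta nv).

  On the exceptional event one uses l(s,t_k) - l(s,t_0) <= c E|g|. The choice of the intercepts makes
  E|g| <= 6 max_(k,i) |<theta_k, X_i - EX>| + 2 max_k E|<theta_k, X - EX>|, of order L nt^alpha.
  If alpha < -3/2, this crude bound is already small enough, and no concentration is needed.
*)

theory Submission
  imports Defs
begin

section \<open>The Huber loss\<close>

text \<open>The Huber loss is curved only near 0, while the difference of two losses fluctuates like
  c times the L2 distance \<rho> of the predictors. For small \<rho> the margin makes the excess
  risks at least of order \<eta> \<rho>^2, and a deviation c \<rho> sqrt (x / nv) is absorbed at the
  price of a remainder c^2 x / (\<theta> \<eta> nv). For large \<rho> the excess risks are bounded
  below only linearly in \<rho>, just like the deviation, so both scale together: absorption then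
  requires kappa ln kappa sqrt (x / nv) to be small against \<theta> \<eta>. With the chosen x this
  is exactly the lower bound imposed on \<theta>, and 20000 is its numerical cost.

  The second obstacle is that Y has no moments. Risks therefore occur only as integrals of loss
  differences, and the first-order condition for s is stated as an equality of two nonnegative
  integrals, which may be infinite. The expected risk of the aggregate is handled by domination:
  only the hold-out risks are shown to be measurable in the data.\<close>

definition clip :: "real \<Rightarrow> real \<Rightarrow> real" where
  "clip c u = max (- c) (min c u)"

lemma clip_mono: "u \<le> v \<Longrightarrow> clip c u \<le> clip c v"
  unfolding clip_def by auto

lemma abs_clip_le: "0 < c \<Longrightarrow> \<bar>clip c u\<bar> \<le> c"
  unfolding clip_def by auto

lemma clip_eq: "\<bar>u\<bar> \<le> c \<Longrightarrow> clip c u = u"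
  unfolding clip_def by auto

lemma huber_nonneg: "0 < c \<Longrightarrow> 0 \<le> huber c u"
  unfolding huber_def by auto

lemma huber_alt: "0 < c \<Longrightarrow> huber c u = clip c u * u - (clip c u)\<^sup>2 / 2"
  unfolding huber_def clip_def by (auto simp: max_def min_def power2_eq_square field_simps abs_if)

text \<open>The Huber loss is the supremum of the affine functions below, attained at p = clip c u; most
  of its properties are read off this duality.\<close>

lemma huber_ge_affine:
  assumes "0 < c" "\<bar>p\<bar> \<le> c"
  shows "p * u - p\<^sup>2 / 2 \<le> huber c u"
proof -
  \<comment> \<open>This product is twice the gap between the affine functions with slopes
    \<open>clip c u\<close> and \<open>p\<close>.\<close>
  have "(clip c u - p) * (2 * u - clip c u - p) \<ge> 0"
  proof (cases "\<bar>u\<bar> \<le> c")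
    case True
    then show ?thesis by (simp add: clip_eq)
  next
    case False
    then have "clip c u = c \<and> u > c \<or> clip c u = - c \<and> u < - c"
      using assms unfolding clip_def by auto
    then show ?thesis
      using assms by (auto intro: mult_nonneg_nonneg mult_nonpos_nonpos)
  qed
  then show ?thesis using assms(1) by (simp add: huber_alt power2_eq_square algebra_simps)
qed

text \<open>Since \<open>clip c\<close> is the derivative of \<open>huber c\<close>, this is the
  first-order Taylor remainder (Bregman divergence) of the loss when the prediction moves by
  \<open>h\<close>. Convexity makes it nonnegative; the two lemmas after that bound the curvature
  from above and from below.\<close>

definition huber_rem :: "real \<Rightarrow> real \<Rightarrow> real \<Rightarrow> real" where
  "huber_rem c u h = huber c (u - h) - huber c u + h * clip c u"

lemma huber_rem_nonneg: "0 < c \<Longrightarrow> 0 \<le> huber_rem c u h"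
  using huber_ge_affine[of c "clip c u" "u - h"] abs_clip_le[of c u] huber_alt[of c u]
  by (simp add: huber_rem_def algebra_simps)

text \<open>The derivative is 1-Lipschitz. Algebraically, h^2/2 minus the remainder equals (p - q +
  h)^2 / 2 + (q - p) * (u - q), and the last product is nonnegative because q is the projection of u
  on [-c, c].\<close>

lemma huber_rem_le:
  assumes "0 < c" shows "huber_rem c u h \<le> h\<^sup>2 / 2"
proof -
  define p where "p = clip c (u - h)"
  define q where "q = clip c u"
  have "0 \<le> (q - p) * (u - q)"
  proof (cases "\<bar>u\<bar> \<le> c")
    case True
    then show ?thesis by (simp add: q_def clip_eq)
  next
    case False
    then have "q = c \<and> u > c \<or> q = - c \<and> u < - c"
      using assms unfolding q_def clip_def by auto
    moreover have "\<bar>p\<bar> \<le> c" using abs_clip_le assms p_def by simp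
    ultimately show ?thesis 
      by (auto intro: mult_nonneg_nonneg mult_nonpos_nonpos)
  qed
  moreover have "0 \<le> (p - q + h)\<^sup>2" by simp
  ultimately show ?thesis
    using assms unfolding huber_rem_def huber_alt[OF assms] p_def[symmetric] q_def[symmetric]
    by (simp add: power2_eq_square algebra_simps)
qed

text \<open>A residual of size at most c/2 leaves room c/2 in the dual interval [-c, c]: the slope u
  - q is admissible for every q with |q| \<le> c/2, and the best q yields
  \<open>huber (c / 2) h\<close>. This is the curvature that the margin assumption makes
  available.\<close>

lemma huber_rem_ge:
  assumes "0 < c" "\<bar>u\<bar> \<le> c / 2"
  shows "huber (c / 2) h \<le> huber_rem c u h"
proof -
  define q where "q = clip (c / 2) h"
  have q: "\<bar>q\<bar> \<le> c / 2" using abs_clip_le[of "c / 2" h] assms q_def by simp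
  have "huber_rem c u h = huber c (u - h) - u\<^sup>2 / 2 + h * u"
    using assms by (simp add: huber_rem_def huber_def clip_eq)
  moreover have "(u - q) * (u - h) - (u - q)\<^sup>2 / 2 \<le> huber c (u - h)"
    using q assms by (intro huber_ge_affine) auto
  moreover have "huber (c / 2) h = q * h - q\<^sup>2 / 2"
    using assms by (simp add: huber_alt q_def)
  moreover have "(u - q) * (u - h) - (u - q)\<^sup>2 / 2 = u\<^sup>2 / 2 - h * u + q * h - q\<^sup>2 / 2"
    by (simp add: power2_eq_square field_simps)
  ultimately show ?thesis by linarith
qed

lemma huber_lipschitz:
  assumes "0 < c" shows "\<bar>huber c u - huber c v\<bar> \<le> c * \<bar>u - v\<bar>"
proof -
  have *: "huber c u - huber c v \<le> c * \<bar>u - v\<bar>" for u v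
  proof -
    have "huber c u - huber c v \<le> (u - v) * clip c u"
      using huber_rem_nonneg[OF assms, of u "u - v"] by (simp add: huber_rem_def)
    also have "\<dots> \<le> \<bar>u - v\<bar> * \<bar>clip c u\<bar>" by (simp add: abs_mult[symmetric])
    also have "\<dots> \<le> \<bar>u - v\<bar> * c" using abs_clip_le[OF assms] by (intro mult_left_mono) auto
    finally show ?thesis by (simp add: mult.commute)
  qed
  show ?thesis using *[of u v] *[of v u] by (simp add: abs_minus_commute)
qed

lemma huber_mean_le:
  assumes "0 < c" "finite I" "I \<noteq> {}"
  shows "huber c ((1 / card I) * (\<Sum>i\<in>I. u i)) \<le> (1 / card I) * (\<Sum>i\<in>I. huber c (u i))"
proof -
  define m where "m = (1 / card I) * (\<Sum>i\<in>I. u i)"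
  have card: "real (card I) > 0" using assms by (simp add: card_gt_0_iff)
  have "0 \<le> (\<Sum>i\<in>I. huber_rem c m (m - u i))"
    using assms by (intro sum_nonneg huber_rem_nonneg)
  also have "\<dots> = (\<Sum>i\<in>I. huber c (u i)) - card I * huber c m + (card I * m - (\<Sum>i\<in>I. u i)) * clip c m"
    by (simp add: huber_rem_def sum.distrib sum_subtractf sum_distrib_right left_diff_distrib)
  also have "card I * m - (\<Sum>i\<in>I. u i) = 0" using card by (simp add: m_def)
  finally have "huber c m \<le> (1 / card I) * (\<Sum>i\<in>I. huber c (u i))"
    using card by (simp add: field_simps)
  then show ?thesis by (simp add: m_def)
qed

text \<open>Serves as a triangle inequality. Half of the optimal slope for u - v is admissible for
  \<open>huber (c / 2)\<close> at u, and its opposite at v; so passing through a third predictor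
  restores the level c lost in \<open>huber_rem_ge\<close>.\<close>

lemma huber_diff_le:
  assumes "0 < c"
  shows "huber c (u - v) / 2 \<le> huber (c / 2) u + huber (c / 2) v"
proof -
  define p where "p = clip c (u - v) / 2"
  have p: "\<bar>p\<bar> \<le> c / 2" using abs_clip_le[OF assms, of "u - v"] by (simp add: p_def)
  have "p * u - p\<^sup>2 / 2 \<le> huber (c / 2) u" "(- p) * v - (- p)\<^sup>2 / 2 \<le> huber (c / 2) v"
    using p assms by (intro huber_ge_affine; simp)+
  moreover have "huber c (u - v) = 2 * p * (u - v) - 2 * p\<^sup>2"
    using assms by (simp add: huber_alt p_def power2_eq_square field_simps)
  ultimately show ?thesis by (simp add: power2_eq_square algebra_simps)
qed

text \<open>The slope \<open>c / A * u\<close> is admissible because |u| \<le> A. It puts a parabola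
  below the loss on an interval that may be much wider than the quadratic zone, with curvature
  reduced by c/A.\<close>

lemma huber_ge_square:
  assumes "0 < c" "c \<le> A" "\<bar>u\<bar> \<le> A"
  shows "c * u\<^sup>2 / (2 * A) \<le> huber c u"
proof -
  have "c / A * u * u - (c / A * u)\<^sup>2 / 2 \<le> huber c u"
  proof (rule huber_ge_affine[OF assms(1)])
    show "\<bar>c / A * u\<bar> \<le> c" using assms by (simp add: abs_mult field_simps)
  qed
  moreover have "c / A * (c / A) \<le> c / A * 1"
    using assms by (intro mult_left_mono) auto
  then have "(c / A * (c / A)) * u\<^sup>2 \<le> c / A * u\<^sup>2" by (intro mult_right_mono) auto
  then have "c / A * u * u - (c / A * u)\<^sup>2 / 2 \<ge> c * u\<^sup>2 / (2 * A)"
    by (simp add: power2_eq_square field_simps)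
  ultimately show ?thesis by linarith
qed

lemma huber_ge_linear:
  assumes "0 < c" shows "c * \<bar>u\<bar> - c\<^sup>2 / 2 \<le> huber c u"
proof (cases "u < 0")
  case True
  then show ?thesis using huber_ge_affine[of c "- c" u] assms by simp
next
  case False
  then show ?thesis using huber_ge_affine[of c c u] assms by simp
qed

lemma huber_measurable [measurable]: "huber c \<in> borel_measurable borel"
  unfolding huber_def by measurable

lemma clip_measurable [measurable]: "clip c \<in> borel_measurable borel"
  unfolding clip_def by measurable

section \<open>Stability of the intercepts\<close>

lemma is_arg_min_huber_sum_iff:
  fixes w :: "'i \<Rightarrow> real"
  assumes "0 < c" "finite I" "I \<noteq> {}"
  shows "is_arg_min (\<lambda>r. \<Sum>i\<in>I. huber c (w i - r)) (\<lambda>_. True) r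
     \<longleftrightarrow> (\<Sum>i\<in>I. clip c (w i - r)) = 0"
proof -
  define F where "F = (\<lambda>r. \<Sum>i\<in>I. huber c (w i - r))"
  define G where "G = (\<Sum>i\<in>I. clip c (w i - r))"
  define m where "m = real (card I)"
  have m: "m > 0" using assms by (simp add: m_def card_gt_0_iff)
  have F: "F (r + h) = F r - h * G + (\<Sum>i\<in>I. huber_rem c (w i - r) h)" for h
    by (simp add: F_def G_def huber_rem_def sum.distrib sum_subtractf sum_distrib_left algebra_simps)
  have lower: "0 \<le> (\<Sum>i\<in>I. huber_rem c (w i - r) h)" for h
    using assms by (intro sum_nonneg huber_rem_nonneg)
  have upper: "(\<Sum>i\<in>I. huber_rem c (w i - r) h) \<le> m * (h\<^sup>2 / 2)" for h
    unfolding m_def using assms by (intro sum_bounded_above huber_rem_le)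
  have "is_arg_min F (\<lambda>_. True) r \<longleftrightarrow> G = 0"
  proof
    assume "G = 0"
    then show "is_arg_min F (\<lambda>_. True) r"
      unfolding is_arg_min_linorder
    proof (intro conjI TrueI allI impI)
      fix y
      show "F r \<le> F y" using F[of "y - r"] lower[of "y - r"] \<open>G = 0\<close> by simp
    qed
  next
    assume "is_arg_min F (\<lambda>_. True) r"
    \<comment> \<open>A gradient step of length 1/m, the inverse of the curvature bound, would
      decrease F by G^2 / (2m) unless G = 0.\<close>
    then have "F r \<le> F (r + G / m)" by (simp add: is_arg_min_linorder)
    then have "G / m * G \<le> m * ((G / m)\<^sup>2 / 2)"
      using F[of "G / m"] upper[of "G / m"] by linarith
    also have "\<dots> = G\<^sup>2 / m / 2" using m by (simp add: power2_eq_square)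
    finally have "G\<^sup>2 / m \<le> 0" by (simp add: power2_eq_square)
    then show "G = 0" using m by (auto simp: divide_le_0_iff)
  qed
  then show ?thesis by (simp add: F_def G_def)
qed

text \<open>The minimisers are the zeros of a nonincreasing function and may fill an interval, so an
  arbitrary choice among them is unstable; the choice closest to 0 is stable. If b exceeded a + e,
  monotonicity would make all of [a + e, b] minimisers for w and all of [a, b - e] minimisers for v.
  If b > 0 the first segment contains a point closer to 0 than b; otherwise the second contains one
  closer to 0 than a.\<close>

lemma least_arg_min_huber_le:
  fixes v w :: "'i \<Rightarrow> real"
  assumes c: "0 < c" and I: "finite I" "I \<noteq> {}"
    and v: "is_arg_min abs (is_arg_min (\<lambda>r. \<Sum>i\<in>I. huber c (v i - r)) (\<lambda>_. True)) a"
    and w: "is_arg_min abs (is_arg_min (\<lambda>r. \<Sum>i\<in>I. huber c (w i - r)) (\<lambda>_. True)) b"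
    and e: "\<And>i. i \<in> I \<Longrightarrow> \<bar>v i - w i\<bar> \<le> e"
  shows "b \<le> a + e"
proof (rule ccontr)
  assume "\<not> b \<le> a + e"
  then have ab: "a + e < b" by simp
  define G where "G = (\<lambda>u r. \<Sum>i\<in>I. clip c (u i - r))"
  note iff = is_arg_min_huber_sum_iff[OF c I]
  have ga: "G v a = 0" and gb: "G w b = 0"
    and la: "\<And>r. G v r = 0 \<Longrightarrow> \<bar>a\<bar> \<le> \<bar>r\<bar>" and lb: "\<And>r. G w r = 0 \<Longrightarrow> \<bar>b\<bar> \<le> \<bar>r\<bar>"
    using v w by (auto simp: is_arg_min_linorder[of abs] iff G_def)
  have e0: "0 \<le> e"
  proof -
    obtain i where "i \<in> I" using I by auto
    from e[OF this] show ?thesis by linarith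
  qed
  have mono: "r \<le> r' \<Longrightarrow> G u r' \<le> G u r" for u r r'
    unfolding G_def by (intro sum_mono clip_mono) auto
  have cmp: "G w (r + e) \<le> G v r" for r
    unfolding G_def
  proof (intro sum_mono clip_mono)
    fix i assume "i \<in> I"
    from e[OF this] show "w i - (r + e) \<le> v i - r" by linarith
  qed
  show False
  proof (cases "0 < b")
    case True
    define r where "r = max (a + e) 0"
    have "G w r \<le> G w (a + e)" by (intro mono) (simp add: r_def)
    moreover have "G w b \<le> G w r" using ab True by (intro mono) (simp add: r_def)
    ultimately have "G w r = 0" using cmp[of a] ga gb by linarith
    then show False using lb[of r] ab True by (auto simp: r_def)
  next
    case False
    define r where "r = min (b - e) 0"
    have "G v (b - e) \<le> G v r" by (intro mono) (simp add: r_def)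
    moreover have "G v r \<le> G v a" using ab False e0 by (intro mono) (simp add: r_def)
    ultimately have "G v r = 0" using cmp[of "b - e"] ga gb by simp
    then show False using la[of r] ab False e0 by (auto simp: r_def)
  qed
qed

section \<open>Sub-exponential variables\<close>

lemma exp_le_quadratic:
  fixes u :: real
  shows "exp u \<le> 1 + u + u\<^sup>2 / 2 * exp \<bar>u\<bar>"
proof -
  obtain t where t: "\<bar>t\<bar> \<le> \<bar>u\<bar>" "exp u = (\<Sum>m<2. u ^ m / fact m) + exp t / fact 2 * u ^ 2"
    using Maclaurin_exp_le[of u 2] by blast
  have "exp t * u\<^sup>2 \<le> exp \<bar>u\<bar> * u\<^sup>2" using t(1) by (intro mult_right_mono) auto
  then show ?thesis using t(2) by (simp add: eval_nat_numeral algebra_simps)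
qed

text \<open>Up to y = 40 l the weight is at most exp (4/5) \<le> 5/2. Beyond that, y^2 and the
  weight cost one factor exp (y/4) each, so exp (-y/2) \<le> exp (-20 l) is left over from exp
  y.\<close>

lemma square_exp_le:
  fixes y w l :: real
  assumes "0 \<le> y" "0 \<le> w" "w \<le> 1 / 4" "0 < l" "40 * l * w \<le> 4 / 5"
  shows "y\<^sup>2 * exp (w * y) \<le> 5 / 2 * y\<^sup>2 + 32 * exp (- 20 * l) * exp y"
proof (cases "y \<le> 40 * l")
  case True
  have "w * y \<le> w * (40 * l)" using True assms by (intro mult_left_mono) auto
  then have "w * y \<le> 4 / 5" using assms by (simp add: ac_simps)
  then have "exp (w * y) \<le> exp (4 / 5)" by simp
  also have "\<dots> \<le> 5 / 2" using exp_bound[of "4 / 5"] by (simp add: power2_eq_square)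
  finally have "y\<^sup>2 * exp (w * y) \<le> y\<^sup>2 * (5 / 2)" by (intro mult_left_mono) auto
  moreover have "0 \<le> 32 * exp (- 20 * l) * exp y" by simp
  ultimately show ?thesis by linarith
next
  case False
  have "(y / 4)\<^sup>2 / 2 \<le> exp (y / 4)"
    using exp_lower_Taylor_quadratic[of "y / 4"] assms by simp
  then have "y\<^sup>2 \<le> 32 * exp (y / 4)" by (simp add: power2_eq_square)
  moreover have "exp (w * y) \<le> exp (y / 4)" using assms mult_right_mono[of w "1/4" y] by simp
  ultimately have "y\<^sup>2 * exp (w * y) \<le> 32 * exp (y / 4) * exp (y / 4)" by (intro mult_mono) auto
  also have "\<dots> = 32 * exp (- y / 2) * exp y" by (simp add: exp_add[symmetric] field_simps)
  also have "\<dots> \<le> 32 * exp (- 20 * l) * exp y" using False by simp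
  finally show ?thesis using zero_le_power2[of y] by linarith
qed

text \<open>36/25 is a rational lower bound for 1 / ln 2, the floor built into \<open>kappa\<close>.
  Its square exceeds 2, so ln k is at least half of ln 2.\<close>

lemma ln_ge_third:
  fixes k :: real
  assumes "36 / 25 \<le> k" shows "1 / 3 \<le> ln k"
proof -
  have "(36 / 25)\<^sup>2 \<le> k\<^sup>2" using assms by (intro power_mono) auto
  then have "2 \<le> k\<^sup>2" by (simp add: power2_eq_square)
  then have "ln 2 \<le> ln (k\<^sup>2)" by (subst ln_le_cancel_iff) auto
  also have "\<dots> = 2 * ln k" using assms by (simp add: ln_realpow)
  finally show ?thesis using ln2_ge_two_thirds by linarith
qed

text \<open>Splitting at |z| = 80 sigma k ln k makes the tail negligible: this is where the factor ln kappa
  of the theorem comes from.\<close>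

lemma subexp_weighted_second_moment_pointwise:
  fixes a z \<sigma> k t \<rho> :: real
  assumes k: "36 / 25 \<le> k" and \<sigma>: "0 < \<sigma>" and t: "0 \<le> t" "100 * (k * ln k) * \<rho> * t \<le> 1"
    and \<rho>: "\<bar>a\<bar> \<le> \<rho>" "\<sigma> \<le> \<rho>"
  shows "(a + z)\<^sup>2 * exp (t * \<bar>a + z\<bar>) \<le> (4 * a\<^sup>2 + \<sigma>\<^sup>2) * exp (\<bar>z\<bar> / (2 * k * \<sigma>)) + 10 * z\<^sup>2"
proof -
  define l where "l = ln k"
  have l: "1 / 3 \<le> l" using ln_ge_third[OF k] l_def by simp
  define y where "y = \<bar>z\<bar> / (2 * k * \<sigma>)"
  \<comment> \<open>With y and w the weight exp (t |z|) becomes exp (w y), and exp y is the variable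
    whose expectation the Orlicz assumption bounds by 2.\<close>
  define w where "w = 2 * k * \<sigma> * t"
  have y: "0 \<le> y" and w: "0 \<le> w" using k \<sigma> t by (auto simp: y_def w_def)
  have wy: "w * y = t * \<bar>z\<bar>" using k \<sigma> by (simp add: w_def y_def)
  have z2: "z\<^sup>2 = 4 * k\<^sup>2 * \<sigma>\<^sup>2 * y\<^sup>2"
    using k \<sigma> by (simp add: y_def power_divide power_mult_distrib)
  have "k * l * \<sigma> * t \<le> k * l * \<rho> * t"
    using k l t \<rho> by (intro mult_right_mono mult_left_mono) auto
  then have wl: "50 * l * w \<le> 1" using t(2) by (simp add: w_def l_def ac_simps)
  have "1 / 3 * w \<le> l * w" using l w by (intro mult_right_mono) auto
  then have w4: "w \<le> 1 / 4" using wl by linarith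
  have *: "y\<^sup>2 * exp (w * y) \<le> 5 / 2 * y\<^sup>2 + 32 * exp (- 20 * l) * exp y"
    using square_exp_le[of y w l] y w w4 l wl by simp
  have "z\<^sup>2 * exp (t * \<bar>z\<bar>) = 4 * k\<^sup>2 * \<sigma>\<^sup>2 * (y\<^sup>2 * exp (w * y))" by (simp add: z2 wy)
  also have "\<dots> \<le> 4 * k\<^sup>2 * \<sigma>\<^sup>2 * (5 / 2 * y\<^sup>2 + 32 * exp (- 20 * l) * exp y)"
    using * by (intro mult_left_mono) auto
  also have "\<dots> = 5 / 2 * z\<^sup>2 + 128 * (k\<^sup>2 * exp (- 20 * l)) * (\<sigma>\<^sup>2 * exp y)"
    by (simp add: z2 algebra_simps)
  \<comment> \<open>Here k^2 = exp (2 l), and 18 l \<ge> 9 ln 2 because k^2 \<ge> 2; so the factor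
    is at most 128 / 2^9. A truncation level proportional to ln k is what defeats the power
    k^2.\<close>
  also have "128 * (k\<^sup>2 * exp (- 20 * l)) * (\<sigma>\<^sup>2 * exp y) \<le> 1 / 4 * (\<sigma>\<^sup>2 * exp y)"
  proof (rule mult_right_mono)
    have "exp (2 * l) = k\<^sup>2" using k by (simp add: l_def exp_double)
    then have "k\<^sup>2 * exp (- 20 * l) = exp (2 * l) * exp (- 20 * l)" by simp
    also have "\<dots> = exp (- 18 * l)" by (simp add: exp_add[symmetric])
    also have "\<dots> \<le> exp (- 9 * ln 2)"
    proof -
      have "(36 / 25)\<^sup>2 \<le> k\<^sup>2" using k by (intro power_mono) auto
      then have "2 \<le> k\<^sup>2" by (simp add: power2_eq_square)
      then have "ln 2 \<le> ln (k\<^sup>2)" by (subst ln_le_cancel_iff) auto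
      also have "\<dots> = 2 * l" using k by (simp add: ln_realpow l_def)
      finally show ?thesis by simp
    qed
    also have "\<dots> = inverse (exp (real 9 * ln 2))" by (simp add: exp_minus)
    also have "\<dots> = 1 / 512" by (subst exp_of_nat_mult) simp
    finally show "128 * (k\<^sup>2 * exp (- 20 * l)) \<le> 1 / 4" by simp
  qed simp
  finally have A: "z\<^sup>2 * exp (t * \<bar>z\<bar>) \<le> 5 / 2 * z\<^sup>2 + 1 / 4 * (\<sigma>\<^sup>2 * exp y)" by simp
  have "w * y \<le> 1 * y" using w4 y by (intro mult_right_mono) auto
  then have B: "exp (t * \<bar>z\<bar>) \<le> exp y" by (simp add: wy)
  have "t * \<bar>a\<bar> \<le> 1 / 2"
  proof -
    have "36 / 25 * (1 / 3) \<le> k * l" using k l by (intro mult_mono) auto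
    then have "36 / 25 * (1 / 3) * (\<bar>a\<bar> * t) \<le> k * l * (\<rho> * t)"
      using t \<rho> k l by (intro mult_mono) auto
    then show ?thesis using t(2) by (simp add: l_def ac_simps)
  qed
  then have "exp (t * \<bar>a\<bar>) \<le> exp (1 / 2)" by simp
  also have "\<dots> \<le> 2" using exp_bound[of "1 / 2"] by (simp add: power2_eq_square)
  finally have C: "exp (t * \<bar>a\<bar>) \<le> 2" .
  have "exp (t * \<bar>a + z\<bar>) \<le> exp (t * (\<bar>a\<bar> + \<bar>z\<bar>))"
    using t by (simp add: mult_left_mono abs_triangle_ineq)
  also have "\<dots> = exp (t * \<bar>a\<bar>) * exp (t * \<bar>z\<bar>)" by (simp add: distrib_left exp_add)
  also have "\<dots> \<le> 2 * exp (t * \<bar>z\<bar>)" using C by (intro mult_right_mono) auto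
  finally have D: "exp (t * \<bar>a + z\<bar>) \<le> 2 * exp (t * \<bar>z\<bar>)" .
  have "0 \<le> (a - z)\<^sup>2" by simp
  then have E: "(a + z)\<^sup>2 \<le> 2 * a\<^sup>2 + 2 * z\<^sup>2" by (simp add: power2_eq_square algebra_simps)
  have "(a + z)\<^sup>2 * exp (t * \<bar>a + z\<bar>) \<le> (2 * a\<^sup>2 + 2 * z\<^sup>2) * (2 * exp (t * \<bar>z\<bar>))"
    using D E by (intro mult_mono) auto
  also have "\<dots> = 4 * a\<^sup>2 * exp (t * \<bar>z\<bar>) + 4 * (z\<^sup>2 * exp (t * \<bar>z\<bar>))" by (simp add: algebra_simps)
  also have "\<dots> \<le> 4 * a\<^sup>2 * exp y + 4 * (5 / 2 * z\<^sup>2 + 1 / 4 * (\<sigma>\<^sup>2 * exp y))"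
    using A B by (intro add_mono mult_left_mono) auto
  also have "\<dots> = (4 * a\<^sup>2 + \<sigma>\<^sup>2) * exp y + 10 * z\<^sup>2" by (simp add: algebra_simps)
  finally show ?thesis by (simp add: y_def)
qed

text \<open>Integrating the pointwise bound gives 2 (4 a^2 + \<sigma>^2) + 10 \<sigma>^2 = 8 a^2 +
  12 \<sigma>^2, rounded up to the factor 13. The case \<sigma> = 0 is separate because the scale 2
  k \<sigma> degenerates; there Z vanishes almost surely and only a bounded exponent
  remains.\<close>

lemma (in prob_space) subexp_weighted_second_moment:
  fixes Z :: "'a \<Rightarrow> real"
  assumes Z [measurable]: "Z \<in> borel_measurable M" and Z2: "integrable M (\<lambda>z. (Z z)\<^sup>2)"
    and \<sigma>: "0 \<le> \<sigma>" "expectation (\<lambda>z. (Z z)\<^sup>2) = \<sigma>\<^sup>2"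
    and k: "36 / 25 \<le> k"
    and subexp: "0 < \<sigma> \<Longrightarrow> (\<integral>\<^sup>+z. ennreal (exp (\<bar>Z z\<bar> / (2 * k * \<sigma>))) \<partial>M) \<le> 2"
    and t: "0 \<le> t" "100 * (k * ln k) * sqrt (a\<^sup>2 + \<sigma>\<^sup>2) * t \<le> 1"
  shows "integrable M (\<lambda>z. (a + Z z)\<^sup>2 * exp (t * \<bar>a + Z z\<bar>))" (is "integrable M ?f")
    and "expectation (\<lambda>z. (a + Z z)\<^sup>2 * exp (t * \<bar>a + Z z\<bar>)) \<le> 13 * (a\<^sup>2 + \<sigma>\<^sup>2)"
proof -
  have nn: "(\<integral>\<^sup>+z. ennreal (?f z) \<partial>M) \<le> ennreal (13 * (a\<^sup>2 + \<sigma>\<^sup>2))"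
  proof (cases "\<sigma> = 0")
    case True
    then have "AE z in M. (Z z)\<^sup>2 = 0"
      using \<sigma> Z2 integral_nonneg_eq_0_iff_AE[OF Z2] by simp
    then have "AE z in M. ?f z = a\<^sup>2 * exp (t * \<bar>a\<bar>)" by eventually_elim simp
    then have "(\<integral>\<^sup>+z. ennreal (?f z) \<partial>M) = (\<integral>\<^sup>+z. ennreal (a\<^sup>2 * exp (t * \<bar>a\<bar>)) \<partial>M)"
      by (intro nn_integral_cong_AE) auto
    also have "\<dots> = ennreal (a\<^sup>2 * exp (t * \<bar>a\<bar>))" by (simp add: emeasure_space_1)
    also have "\<dots> \<le> ennreal (13 * (a\<^sup>2 + \<sigma>\<^sup>2))"
    proof (rule ennreal_leI)
      have l: "1 / 3 \<le> ln k" using ln_ge_third[OF k] .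
      have "36 / 25 * (1 / 3) \<le> k * ln k" using k l by (intro mult_mono) auto
      then have "36 / 25 * (1 / 3) * (\<bar>a\<bar> * t) \<le> k * ln k * (\<bar>a\<bar> * t)"
        using t(1) by (intro mult_right_mono) auto
      then have "t * \<bar>a\<bar> \<le> 1 / 2" using t(2) True by (simp add: ac_simps)
      then have "exp (t * \<bar>a\<bar>) \<le> exp (1 / 2)" by simp
      also have "\<dots> \<le> 2" using exp_bound[of "1 / 2"] by (simp add: power2_eq_square)
      finally have "a\<^sup>2 * exp (t * \<bar>a\<bar>) \<le> a\<^sup>2 * 2" by (intro mult_left_mono) auto
      also have "\<dots> \<le> 13 * (a\<^sup>2 + \<sigma>\<^sup>2)" by simp
      finally show "a\<^sup>2 * exp (t * \<bar>a\<bar>) \<le> 13 * (a\<^sup>2 + \<sigma>\<^sup>2)" .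
    qed
    finally show ?thesis .
  next
    case False
    then have \<sigma>0: "0 < \<sigma>" using \<sigma> by simp
    have "\<bar>a\<bar> \<le> sqrt (a\<^sup>2 + \<sigma>\<^sup>2)" "\<sigma> \<le> sqrt (a\<^sup>2 + \<sigma>\<^sup>2)" by (auto intro: real_le_rsqrt)
    then have "(\<integral>\<^sup>+z. ennreal (?f z) \<partial>M)
      \<le> (\<integral>\<^sup>+z. ennreal ((4 * a\<^sup>2 + \<sigma>\<^sup>2) * exp (\<bar>Z z\<bar> / (2 * k * \<sigma>)) + 10 * (Z z)\<^sup>2) \<partial>M)"
      using k \<sigma>0 t by (intro nn_integral_mono ennreal_leI subexp_weighted_second_moment_pointwise)
    also have "\<dots> = (\<integral>\<^sup>+z. ennreal (4 * a\<^sup>2 + \<sigma>\<^sup>2) * ennreal (exp (\<bar>Z z\<bar> / (2 * k * \<sigma>))) + ennreal 10 * ennreal ((Z z)\<^sup>2) \<partial>M)"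
      by (intro nn_integral_cong) (simp add: ennreal_plus ennreal_mult del: ennreal_numeral)
    also have "\<dots> = ennreal (4 * a\<^sup>2 + \<sigma>\<^sup>2) * (\<integral>\<^sup>+z. ennreal (exp (\<bar>Z z\<bar> / (2 * k * \<sigma>))) \<partial>M)
        + ennreal 10 * (\<integral>\<^sup>+z. ennreal ((Z z)\<^sup>2) \<partial>M)"
      by (subst nn_integral_add) (auto simp: nn_integral_cmult)
    also have "(\<integral>\<^sup>+z. ennreal ((Z z)\<^sup>2) \<partial>M) = ennreal (\<sigma>\<^sup>2)"
      using Z2 \<sigma> by (subst nn_integral_eq_integral) auto
    also have "ennreal (4 * a\<^sup>2 + \<sigma>\<^sup>2) * (\<integral>\<^sup>+z. ennreal (exp (\<bar>Z z\<bar> / (2 * k * \<sigma>))) \<partial>M) + ennreal 10 * ennreal (\<sigma>\<^sup>2)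
        \<le> ennreal (4 * a\<^sup>2 + \<sigma>\<^sup>2) * ennreal 2 + ennreal 10 * ennreal (\<sigma>\<^sup>2)"
      using subexp[OF \<sigma>0] by (intro add_mono mult_left_mono) auto
    also have "\<dots> = ennreal ((4 * a\<^sup>2 + \<sigma>\<^sup>2) * 2 + 10 * \<sigma>\<^sup>2)"
      by (simp del: ennreal_numeral flip: ennreal_plus ennreal_mult)
    also have "\<dots> \<le> ennreal (13 * (a\<^sup>2 + \<sigma>\<^sup>2))" by (intro ennreal_leI) simp
    finally show ?thesis .
  qed
  show int: "integrable M ?f"
    using nn by (intro integrableI_nonneg) (auto simp: order.strict_trans1 top.not_eq_extremum)
  show "expectation ?f \<le> 13 * (a\<^sup>2 + \<sigma>\<^sup>2)"
  proof -
    have "(\<integral>\<^sup>+z. ennreal (?f z) \<partial>M) = ennreal (expectation ?f)"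
      by (rule nn_integral_eq_integral[OF int]) simp
    with nn have "ennreal (expectation ?f) \<le> ennreal (13 * (a\<^sup>2 + \<sigma>\<^sup>2))" by metis
    then show ?thesis by (rule ennreal_le_iff[THEN iffD1, rotated]) simp
  qed
qed

text \<open>26 is twice the factor 13 of the weighted moment bound: the exponential correction then
  removes at most half of the second moment.\<close>

lemma exp_minus_4: "26 * exp (- 4 :: real) \<le> 1"
proof -
  have "(5 / 2) ^ 4 \<le> exp (1::real) ^ 4"
    using exp_lower_Taylor_quadratic[of "1::real"] by (intro power_mono) auto
  also have "exp (1::real) ^ 4 = exp 4" by (simp flip: exp_of_nat_mult)
  finally have "26 \<le> exp (4::real)" by (simp add: eval_nat_numeral)
  then show ?thesis by (simp add: exp_minus field_simps)
qed

text \<open>The term with exp (-4) makes the left-hand side nonpositive when |u| > A.\<close>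

lemma huber_ge_truncated_square:
  assumes "0 < c" "0 < A"
  shows "min 1 (c / A) / 2 * (u\<^sup>2 - exp (- 4) * (u\<^sup>2 * exp (4 * \<bar>u\<bar> / A))) \<le> huber c u"
proof (cases "\<bar>u\<bar> \<le> A")
  case True
  have "min 1 (c / A) / 2 * u\<^sup>2 \<le> huber c u"
  proof (cases "c \<le> A")
    case True
    then have "min 1 (c / A) / 2 * u\<^sup>2 = c * u\<^sup>2 / (2 * A)" using assms by (simp add: min_def field_simps)
    then show ?thesis using huber_ge_square[OF assms(1) True \<open>\<bar>u\<bar> \<le> A\<close>] by simp
  next
    case False
    then show ?thesis using True assms by (simp add: huber_def min_def)
  qed
  moreover have "min 1 (c / A) / 2 * (u\<^sup>2 - exp (- 4) * (u\<^sup>2 * exp (4 * \<bar>u\<bar> / A))) \<le> min 1 (c / A) / 2 * u\<^sup>2"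
    using assms by (intro mult_left_mono) auto
  ultimately show ?thesis by linarith
next
  case False
  then have "1 \<le> \<bar>u\<bar> / A" using assms by simp
  then have "exp 4 \<le> exp (4 * \<bar>u\<bar> / A)" by simp
  then have "u\<^sup>2 * (exp (- 4) * exp 4) \<le> u\<^sup>2 * (exp (- 4) * exp (4 * \<bar>u\<bar> / A))"
    by (intro mult_left_mono) auto
  then have "u\<^sup>2 - exp (- 4) * (u\<^sup>2 * exp (4 * \<bar>u\<bar> / A)) \<le> 0"
    by (simp add: exp_minus mult.left_commute)
  then have "min 1 (c / A) / 2 * (u\<^sup>2 - exp (- 4) * (u\<^sup>2 * exp (4 * \<bar>u\<bar> / A))) \<le> 0"
    using assms by (intro mult_nonneg_nonpos) auto
  then show ?thesis using huber_nonneg[OF assms(1), of u] by linarith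
qed

text \<open>A loss of linear growth controls the second moment only if that moment does not sit in
  the tail. The weighted moment excludes this: what lies beyond the level A accounts for at most
  half of E g^2, and the rest is seen by the parabola of \<open>huber_ge_square\<close>.\<close>

lemma (in prob_space) huber_risk_ge_second_moment:
  assumes c: "0 < c" and A: "0 < A"
    and g2: "integrable M (\<lambda>z. (g z)\<^sup>2)"
    and H: "integrable M (\<lambda>z. huber c (g z))"
    and w: "integrable M (\<lambda>z. (g z)\<^sup>2 * exp (4 / A * \<bar>g z\<bar>))"
       "expectation (\<lambda>z. (g z)\<^sup>2 * exp (4 / A * \<bar>g z\<bar>)) \<le> 13 * expectation (\<lambda>z. (g z)\<^sup>2)"
  shows "min 1 (c / A) / 4 * expectation (\<lambda>z. (g z)\<^sup>2) \<le> expectation (\<lambda>z. huber c (g z))"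
proof -
  define S where "S = expectation (\<lambda>z. (g z)\<^sup>2)"
  have S: "0 \<le> S" unfolding S_def by (intro Bochner_Integration.integral_nonneg) auto
  have "exp (- 4) * expectation (\<lambda>z. (g z)\<^sup>2 * exp (4 / A * \<bar>g z\<bar>)) \<le> exp (- 4) * (13 * S)"
    using w by (intro mult_left_mono) (auto simp: S_def)
  also have "\<dots> \<le> S / 2" using mult_right_mono[OF exp_minus_4 S] by simp
  finally have "S / 2 \<le> S - exp (- 4) * expectation (\<lambda>z. (g z)\<^sup>2 * exp (4 / A * \<bar>g z\<bar>))" by simp
  then have "min 1 (c / A) / 2 * (S / 2)
     \<le> min 1 (c / A) / 2 * (S - exp (- 4) * expectation (\<lambda>z. (g z)\<^sup>2 * exp (4 / A * \<bar>g z\<bar>)))"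
    using c A by (intro mult_left_mono) auto
  also have "\<dots> = expectation (\<lambda>z. min 1 (c / A) / 2 * ((g z)\<^sup>2 - exp (- 4) * ((g z)\<^sup>2 * exp (4 / A * \<bar>g z\<bar>))))"
    using g2 w(1) by (simp add: S_def)
  also have "\<dots> \<le> expectation (\<lambda>z. huber c (g z))"
    using g2 w(1) H huber_ge_truncated_square[OF c A] by (intro integral_mono) auto
  finally show ?thesis by (simp add: S_def)
qed

section \<open>A deviation inequality\<close>

text \<open>Second-order expansion of exp (-\<beta> f), then 1 + u \<le> exp u, whose linear part
  cancels the factor exp (\<beta> E f). Keeping the uncentered weighted moment lets a pointwise
  bound on f enter directly.\<close>

lemma (in prob_space) exp_moment_le:
  fixes f :: "'a \<Rightarrow> real"
  assumes f: "integrable M f" and w: "integrable M (\<lambda>z. (f z)\<^sup>2 * exp (\<beta> * \<bar>f z\<bar>))" and \<beta>: "0 \<le> \<beta>"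
  shows "(\<integral>\<^sup>+z. ennreal (exp (\<beta> * (expectation f - f z))) \<partial>M)
     \<le> ennreal (exp (\<beta>\<^sup>2 / 2 * expectation (\<lambda>z. (f z)\<^sup>2 * exp (\<beta> * \<bar>f z\<bar>))))"
proof -
  define m where "m = expectation f"
  define W where "W = expectation (\<lambda>z. (f z)\<^sup>2 * exp (\<beta> * \<bar>f z\<bar>))"
  define h where "h = (\<lambda>z. exp (\<beta> * m) * (1 - \<beta> * f z + \<beta>\<^sup>2 / 2 * ((f z)\<^sup>2 * exp (\<beta> * \<bar>f z\<bar>))))"
  have h: "exp (\<beta> * (m - f z)) \<le> h z" for z
  proof -
    have "exp (- \<beta> * f z) \<le> 1 - \<beta> * f z + \<beta>\<^sup>2 / 2 * ((f z)\<^sup>2 * exp (\<beta> * \<bar>f z\<bar>))"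
      using exp_le_quadratic[of "- \<beta> * f z"] \<beta> by (simp add: power_mult_distrib abs_mult)
    then have "exp (\<beta> * m) * exp (- \<beta> * f z) \<le> h z" unfolding h_def by (intro mult_left_mono) auto
    then show ?thesis by (simp add: exp_add[symmetric] right_diff_distrib)
  qed
  have int: "integrable M h" using f w by (simp add: h_def)
  have "(\<integral>\<^sup>+z. ennreal (exp (\<beta> * (m - f z))) \<partial>M) \<le> (\<integral>\<^sup>+z. ennreal (h z) \<partial>M)"
    using h by (intro nn_integral_mono ennreal_leI)
  also have "\<dots> = ennreal (expectation h)"
    using int h by (intro nn_integral_eq_integral AE_I2) (auto intro: order_trans[OF exp_ge_zero])
  also have "expectation h = exp (\<beta> * m) * (1 - \<beta> * m + \<beta>\<^sup>2 / 2 * W)"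
    using f w by (simp add: h_def m_def W_def prob_space)
  also have "\<dots> \<le> exp (\<beta> * m) * exp (- \<beta> * m + \<beta>\<^sup>2 / 2 * W)"
  proof (rule mult_left_mono)
    show "1 - \<beta> * m + \<beta>\<^sup>2 / 2 * W \<le> exp (- \<beta> * m + \<beta>\<^sup>2 / 2 * W)"
      using exp_ge_add_one_self[of "- \<beta> * m + \<beta>\<^sup>2 / 2 * W"] by linarith
  qed simp
  also have "\<dots> = exp (\<beta>\<^sup>2 / 2 * W)" by (simp add: exp_add[symmetric])
  finally show ?thesis by (simp add: m_def W_def ennreal_leI)
qed

text \<open>Chernoff bound, with x the exponent gained per observation. The event ranges over all
  functions, so in general it is not a set of the product sigma-algebra and \<open>emeasure\<close>
  would default to 0; the integral of its indicator sees only the trace on the space.\<close>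

lemma (in prob_space) empirical_mean_deviation:
  fixes f :: "'a \<Rightarrow> real"
  assumes f: "integrable M f" and w: "integrable M (\<lambda>z. (f z)\<^sup>2 * exp (\<beta> * \<bar>f z\<bar>))" and \<beta>: "0 \<le> \<beta>"
    and J: "finite J" "J \<noteq> {}"
    and W: "x \<le> \<beta> * r - \<beta>\<^sup>2 / 2 * expectation (\<lambda>z. (f z)\<^sup>2 * exp (\<beta> * \<bar>f z\<bar>))"
  shows "(\<integral>\<^sup>+y. indicator {y. (1 / card J) * (\<Sum>i\<in>J. f (y i)) < expectation f - r} y \<partial>(\<Pi>\<^sub>M i\<in>J. M))
    \<le> ennreal (exp (- real (card J) * x))"
proof -
  interpret product_sigma_finite "\<lambda>_. M" ..
  have [measurable]: "f \<in> borel_measurable M" using f by auto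
  define m where "m = expectation f"
  define N where "N = real (card J)"
  have N: "0 < N" using J by (simp add: N_def card_gt_0_iff)
  define W where "W = expectation (\<lambda>z. (f z)\<^sup>2 * exp (\<beta> * \<bar>f z\<bar>))"
  have "(\<integral>\<^sup>+y. indicator {y. (1 / card J) * (\<Sum>i\<in>J. f (y i)) < m - r} y \<partial>(\<Pi>\<^sub>M i\<in>J. M))
     \<le> (\<integral>\<^sup>+y. (\<Prod>i\<in>J. ennreal (exp (- \<beta> * r)) * ennreal (exp (\<beta> * (m - f (y i))))) \<partial>(\<Pi>\<^sub>M i\<in>J. M))"
  proof (rule nn_integral_mono)
    fix y
    show "indicator {y. (1 / card J) * (\<Sum>i\<in>J. f (y i)) < m - r} y
      \<le> (\<Prod>i\<in>J. ennreal (exp (- \<beta> * r)) * ennreal (exp (\<beta> * (m - f (y i)))))"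
    proof (cases "(1 / card J) * (\<Sum>i\<in>J. f (y i)) < m - r")
      case True
      then have "(\<Sum>i\<in>J. f (y i)) < N * (m - r)" using N by (simp add: N_def field_simps)
      then have "0 \<le> N * (m - r) - (\<Sum>i\<in>J. f (y i))" by simp
      then have "0 \<le> \<beta> * (N * (m - r) - (\<Sum>i\<in>J. f (y i)))" using \<beta> by (intro mult_nonneg_nonneg)
      also have "\<dots> = (\<Sum>i\<in>J. - \<beta> * r + \<beta> * (m - f (y i)))"
        by (simp add: N_def sum.distrib sum_subtractf sum_distrib_left algebra_simps)
      finally have "1 \<le> exp (\<Sum>i\<in>J. - \<beta> * r + \<beta> * (m - f (y i)))" by simp
      also have "\<dots> = (\<Prod>i\<in>J. exp (- \<beta> * r) * exp (\<beta> * (m - f (y i))))"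
        using J by (simp add: exp_sum exp_add[symmetric])
      finally show ?thesis using True by (simp add: prod_ennreal flip: ennreal_mult)
    qed simp
  qed
  also have "\<dots> = (\<Prod>i\<in>J. \<integral>\<^sup>+z. ennreal (exp (- \<beta> * r)) * ennreal (exp (\<beta> * (m - f z))) \<partial>M)"
    using J by (intro product_nn_integral_prod) auto
  also have "\<dots> = (\<Prod>i\<in>J. ennreal (exp (- \<beta> * r)) * (\<integral>\<^sup>+z. ennreal (exp (\<beta> * (m - f z))) \<partial>M))"
    by (simp add: nn_integral_cmult)
  also have "\<dots> \<le> (\<Prod>i\<in>J. ennreal (exp (- \<beta> * r)) * ennreal (exp (\<beta>\<^sup>2 / 2 * W)))"
    using exp_moment_le[OF f w \<beta>] by (intro prod_mono_ennreal mult_left_mono) (auto simp: m_def W_def)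
  also have "\<dots> = ennreal (exp (N * (\<beta>\<^sup>2 / 2 * W - \<beta> * r)))"
  proof -
    define u where "u = \<beta>\<^sup>2 / 2 * W - \<beta> * r"
    have "exp (- \<beta> * r) * exp (\<beta>\<^sup>2 / 2 * W) = exp u"
      unfolding u_def exp_add[symmetric] by simp
    then have "ennreal (exp (- \<beta> * r)) * ennreal (exp (\<beta>\<^sup>2 / 2 * W)) = ennreal (exp u)"
      by (metis ennreal_mult exp_ge_zero)
    then have "(\<Prod>i\<in>J. ennreal (exp (- \<beta> * r)) * ennreal (exp (\<beta>\<^sup>2 / 2 * W))) = ennreal (exp u ^ card J)"
      by (simp add: ennreal_power)
    also have "exp u ^ card J = exp (N * u)" unfolding N_def by (simp only: exp_of_nat_mult)
    finally show ?thesis unfolding u_def .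
  qed
  also have "\<dots> \<le> ennreal (exp (- N * x))"
  proof (rule ennreal_leI)
    have "N * (\<beta>\<^sup>2 / 2 * W - \<beta> * r) \<le> N * (- x)"
      using W N by (intro mult_left_mono) (auto simp: W_def)
    then show "exp (N * (\<beta>\<^sup>2 / 2 * W - \<beta> * r)) \<le> exp (- N * x)" by simp
  qed
  finally show ?thesis by (simp add: m_def N_def)
qed

section \<open>The excess risk\<close>

lemma ext_integral_nonneg:
  assumes "\<And>z. z \<in> space M \<Longrightarrow> 0 \<le> f z"
  shows "ext_integral M f = enn2ereal (\<integral>\<^sup>+z. e2ennreal (f z) \<partial>M)"
proof -
  have "(\<integral>\<^sup>+z. e2ennreal (- f z) \<partial>M) = (\<integral>\<^sup>+z. 0 \<partial>M)"
    using assms by (intro nn_integral_cong) (simp add: e2ennreal_neg)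
  then show ?thesis by (simp add: ext_integral_def zero_ennreal.rep_eq)
qed

lemma ext_integral_integrable:
  assumes f: "integrable M f"
  shows "ext_integral M (\<lambda>z. ereal (f z)) = ereal (\<integral>z. f z \<partial>M)"
proof -
  define p where "p = (\<integral>\<^sup>+z. ennreal (f z) \<partial>M)"
  define q where "q = (\<integral>\<^sup>+z. ennreal (- f z) \<partial>M)"
  have fin: "p \<noteq> \<infinity>" "q \<noteq> \<infinity>"
    using integrableD[OF f] by (auto simp: p_def q_def)
  have "ext_integral M (\<lambda>z. ereal (f z)) = enn2ereal p - enn2ereal q"
    by (simp add: ext_integral_def p_def q_def)
  also have "\<dots> = ereal (enn2real p) - ereal (enn2real q)"
    using fin by (cases p; cases q) (auto simp: enn2ereal_ennreal)
  also have "\<dots> = ereal (enn2real p - enn2real q)" by simp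
  also have "enn2real p - enn2real q = (\<integral>z. f z \<partial>M)"
    using f by (simp add: p_def q_def real_lebesgue_integral_def)
  finally show ?thesis by simp
qed

section \<open>First-order condition and disintegration\<close>

text \<open>No differentiation under the integral is involved: \<open>huber_rem_le\<close> and
  optimality give h I \<le> h^2 / 2 for every h, and h = I forces I = 0.\<close>

lemma (in prob_space) clip_integral_eq_0:
  assumes c: "0 < c" and [measurable]: "Y \<in> borel_measurable M"
    and opt: "is_arg_min (\<lambda>u. \<integral>y. (huber c (Y y - u) - huber c (Y y)) \<partial>M) (\<lambda>_. True) s"
  shows "(\<integral>y. clip c (Y y - s) \<partial>M) = 0"
proof -
  define I where "I = (\<integral>y. clip c (Y y - s) \<partial>M)"
  have int: "integrable M (\<lambda>y. huber c (Y y - u) - huber c (Y y))" for u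
    by (rule integrable_const_bound[where B = "c * \<bar>u\<bar>"])
      (use huber_lipschitz[OF c, of "Y y - u" "Y y" for y] in \<open>auto simp: abs_mult\<close>)
  have intc: "integrable M (\<lambda>y. clip c (Y y - s))"
    by (rule integrable_const_bound[where B = c]) (use abs_clip_le[OF c] in auto)
  have *: "h * I \<le> h\<^sup>2 / 2" for h
  proof -
    have "(\<integral>y. (huber c (Y y - s) - huber c (Y y)) \<partial>M)
      \<le> (\<integral>y. (huber c (Y y - (s + h)) - huber c (Y y)) \<partial>M)"
      using opt by (auto simp: is_arg_min_linorder)
    also have "\<dots> \<le> (\<integral>y. (huber c (Y y - s) - huber c (Y y)) - h * clip c (Y y - s) + h\<^sup>2 / 2 \<partial>M)"
    proof (intro integral_mono)
      fix y
      have "huber c (Y y - s - h) - huber c (Y y - s) + h * clip c (Y y - s) \<le> h\<^sup>2 / 2"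
        using huber_rem_le[OF c, of "Y y - s" h] by (simp add: huber_rem_def)
      then show "huber c (Y y - (s + h)) - huber c (Y y)
         \<le> huber c (Y y - s) - huber c (Y y) - h * clip c (Y y - s) + h\<^sup>2 / 2"
        by (simp add: diff_diff_eq)
    qed (use int intc in auto)
    also have "\<dots> = (\<integral>y. (huber c (Y y - s) - huber c (Y y)) \<partial>M) - h * I + h\<^sup>2 / 2"
      using int intc by (simp add: I_def prob_space)
    finally show ?thesis by simp
  qed
  have "I\<^sup>2 \<le> I\<^sup>2 / 2" using *[of I] by (simp add: power2_eq_square)
  then have "I\<^sup>2 \<le> 0" by simp
  then show ?thesis by (simp add: I_def)
qed

text \<open>\<open>cond_law\<close> speaks of rectangles only. They form an intersection-stable
  generator, so P is the bind of the marginal law with the kernel sending x to the law of (x, y), y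
  drawn from N x; the iterated integral is then the integral formula for bind.\<close>

lemma cond_law_nn_integral:
  assumes P: "prob_space P" and sets_P: "sets P = sets (Rd d \<Otimes>\<^sub>M borel)" and N: "cond_law d P N"
    and f: "f \<in> borel_measurable (Rd d \<Otimes>\<^sub>M borel)"
  shows "(\<integral>\<^sup>+z. f z \<partial>P) = (\<integral>\<^sup>+x. (\<integral>\<^sup>+y. f (x, y) \<partial>N x) \<partial>distr P (Rd d) fst)"
proof -
  interpret prob_space P by fact
  note sets_P [measurable_cong]
  define PX where "PX = distr P (Rd d) fst"
  have [measurable_cong]: "sets PX = sets (Rd d)" by (simp add: PX_def)
  interpret PX: prob_space PX unfolding PX_def by (rule prob_space_distr) simp
  have N_meas: "N \<in> Rd d \<rightarrow>\<^sub>M subprob_algebra borel"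
    using N by (auto simp: cond_law_def intro: measurable_prob_algebraD)
  define \<kappa> where "\<kappa> = (\<lambda>x. distr (N x) (Rd d \<Otimes>\<^sub>M borel) (Pair x))"
  have \<kappa>_Rd: "\<kappa> \<in> Rd d \<rightarrow>\<^sub>M subprob_algebra (Rd d \<Otimes>\<^sub>M borel)"
    unfolding \<kappa>_def using N_meas by (intro measurable_distr2) auto
  then have \<kappa>: "\<kappa> \<in> PX \<rightarrow>\<^sub>M subprob_algebra (Rd d \<Otimes>\<^sub>M borel)" by simp
  have sets_N: "sets (N x) = sets borel" if "x \<in> space (Rd d)" for x
    using sets_kernel[OF N_meas that] .
  have Pair: "Pair x \<in> N x \<rightarrow>\<^sub>M Rd d \<Otimes>\<^sub>M borel" if "x \<in> space (Rd d)" for x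
    using sets_N[OF that] that by (simp cong: measurable_cong_sets)
  have space_PX: "space PX = space (Rd d)" by (simp add: PX_def)
  have "P = bind PX \<kappa>"
  proof (rule measure_eqI_generator_eq[OF Int_stable_pair_measure_generator[of "Rd d" "borel :: real measure"]])
    let ?E = "{a \<times> b |a b. a \<in> sets (Rd d) \<and> b \<in> sets (borel :: real measure)}"
    let ?\<Omega> = "space (Rd d) \<times> space (borel :: real measure)"
    show "?E \<subseteq> Pow ?\<Omega>"
      using sets.space_closed[of "Rd d"] by auto
    show "sets P = sigma_sets ?\<Omega> ?E" by (simp only: sets_P sets_pair_measure)
    show "sets (bind PX \<kappa>) = sigma_sets ?\<Omega> ?E"
      using sets_bind_measurable[OF \<kappa> PX.not_empty] by (simp only: sets_pair_measure)
    show "range (\<lambda>_::nat. ?\<Omega>) \<subseteq> ?E" by (blast intro: sets.top)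
    show "(\<Union>i::nat. ?\<Omega>) = ?\<Omega>" by auto
    show "emeasure P ?\<Omega> \<noteq> \<infinity>" for i :: nat by simp
    fix X assume "X \<in> ?E"
    then obtain A B where X: "X = A \<times> B" and A: "A \<in> sets (Rd d)" and B: "B \<in> sets (borel :: real measure)"
      by auto
    have "emeasure (bind PX \<kappa>) X = (\<integral>\<^sup>+x. emeasure (\<kappa> x) X \<partial>PX)"
      by (rule emeasure_bind[OF PX.not_empty \<kappa>]) (use A B X in auto)
    also have "\<dots> = (\<integral>\<^sup>+x\<in>A. emeasure (N x) B \<partial>PX)"
    proof (rule nn_integral_cong)
      fix x assume "x \<in> space PX"
      then have x: "x \<in> space (Rd d)" by (simp add: space_PX)
      have "emeasure (\<kappa> x) X = emeasure (N x) (Pair x -` X \<inter> space (N x))"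
        unfolding \<kappa>_def by (rule emeasure_distr[OF Pair[OF x]]) (use A B X in auto)
      also have "Pair x -` X \<inter> space (N x) = (if x \<in> A then B else {})"
        using sets_eq_imp_space_eq[OF sets_N[OF x]] X by auto
      finally show "emeasure (\<kappa> x) X = emeasure (N x) B * indicator A x" by simp
    qed
    also have "\<dots> = emeasure P X"
      using N A B X by (simp add: cond_law_def PX_def)
    finally show "emeasure P X = emeasure (bind PX \<kappa>) X" by simp
  qed
  then have "(\<integral>\<^sup>+z. f z \<partial>P) = (\<integral>\<^sup>+x. \<integral>\<^sup>+z. f z \<partial>\<kappa> x \<partial>PX)"
    using nn_integral_bind[OF f \<kappa>] by simp
  also have "\<dots> = (\<integral>\<^sup>+x. (\<integral>\<^sup>+y. f (x, y) \<partial>N x) \<partial>PX)"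
  proof (rule nn_integral_cong)
    fix x assume "x \<in> space PX"
    then show "(\<integral>\<^sup>+z. f z \<partial>\<kappa> x) = (\<integral>\<^sup>+y. f (x, y) \<partial>N x)"
      unfolding \<kappa>_def by (intro nn_integral_distr Pair) (use f in \<open>auto simp: space_PX\<close>)
  qed
  finally show ?thesis by (simp add: PX_def)
qed

locale huber_regression = prob_space P
  for P :: "sample measure" +
  fixes d :: nat and c :: real and s :: predictor and \<eta> :: real
  assumes c: "0 < c"
    and sets_P [measurable_cong]: "sets P = sets (Rd d \<Otimes>\<^sub>M borel)"
    and opt: "optimal_predictor d c P s"
    and \<eta>: "0 < \<eta>"
    and margin: "AE z in P. \<eta> \<le> real_cond_exp P (sigma_X d P)
                          (indicator {(x, y). \<bar>y - s x\<bar> \<le> c / 2}) z"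
begin

lemma s_measurable [measurable]: "s \<in> borel_measurable (Rd d)"
  using opt by (simp add: optimal_predictor_def)

lemma space_P: "space P = space (Rd d) \<times> UNIV"
  using sets_eq_imp_space_eq[OF sets_P] by (simp add: space_pair_measure)

text \<open>This is the orthogonality E [w(X) clip (Y - s(X))] = 0. Written with positive and
  negative parts it is meaningful for every nonnegative w, bounded or not.\<close>

lemma nn_integral_clip_residual:
  assumes w [measurable]: "w \<in> borel_measurable (Rd d)"
  shows "(\<integral>\<^sup>+z. w (fst z) * ennreal (clip c (snd z - s (fst z))) \<partial>P)
       = (\<integral>\<^sup>+z. w (fst z) * ennreal (- clip c (snd z - s (fst z))) \<partial>P)"
proof -
  obtain N where N: "cond_law d P N"
    and opt: "AE x in distr P (Rd d) fst.
           is_arg_min (\<lambda>u. \<integral>y. (huber c (y - u) - huber c y) \<partial>N x) (\<lambda>_. True) (s x)"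
    using opt by (auto simp: optimal_predictor_def)
  note disint = cond_law_nn_integral[OF prob_space_axioms sets_P N]
  have 1: "(\<integral>\<^sup>+z. w (fst z) * ennreal (clip c (snd z - s (fst z))) \<partial>P)
    = (\<integral>\<^sup>+x. (\<integral>\<^sup>+y. w x * ennreal (clip c (y - s x)) \<partial>N x) \<partial>distr P (Rd d) fst)"
    by (subst disint) auto
  have 2: "(\<integral>\<^sup>+z. w (fst z) * ennreal (- clip c (snd z - s (fst z))) \<partial>P)
    = (\<integral>\<^sup>+x. (\<integral>\<^sup>+y. w x * ennreal (- clip c (y - s x)) \<partial>N x) \<partial>distr P (Rd d) fst)"
    by (subst disint) auto
  have "AE x in distr P (Rd d) fst. x \<in> space (Rd d)"
    using AE_space[of "distr P (Rd d) fst"] by simp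
  with opt have "AE x in distr P (Rd d) fst. 
    (\<integral>\<^sup>+y. w x * ennreal (clip c (y - s x)) \<partial>N x) = (\<integral>\<^sup>+y. w x * ennreal (- clip c (y - s x)) \<partial>N x)"
  proof eventually_elim
    case (elim x)
    have "N x \<in> space (prob_algebra borel)"
      using N elim by (auto simp: cond_law_def dest: measurable_space)
    then have px: "prob_space (N x)" and sx [measurable_cong]: "sets (N x) = sets borel"
      by (auto simp: space_prob_algebra)
    interpret N: prob_space "N x" by (rule px)
    have int: "integrable (N x) (\<lambda>y. clip c (y - s x))"
      by (rule N.integrable_const_bound[where B = c]) (use abs_clip_le[OF c] in auto)
    have "(\<integral>y. clip c (y - s x) \<partial>N x) = 0"
      by (rule N.clip_integral_eq_0[OF c]) (use elim in auto)
    then have "enn2real (\<integral>\<^sup>+y. ennreal (clip c (y - s x)) \<partial>N x)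
      = enn2real (\<integral>\<^sup>+y. ennreal (- clip c (y - s x)) \<partial>N x)"
      using int by (simp add: real_lebesgue_integral_def)
    then have "(\<integral>\<^sup>+y. ennreal (clip c (y - s x)) \<partial>N x) = (\<integral>\<^sup>+y. ennreal (- clip c (y - s x)) \<partial>N x)"
      using integrableD(2,3)[OF int] by (metis ennreal_enn2real_if infinity_ennreal_def)
    then show ?case by (simp add: nn_integral_cmult)
  qed
  then show ?thesis unfolding 1 2 by (rule nn_integral_cong_AE)
qed

abbreviation close :: "sample set" where
  "close \<equiv> {(x, y). \<bar>y - s x\<bar> \<le> c / 2}"

lemma indicator_close: "indicator close = (\<lambda>z. if \<bar>snd z - s (fst z)\<bar> \<le> c / 2 then 1 else 0)"
  by (auto simp: fun_eq_iff indicator_def)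

lemma close_measurable [measurable]: "(indicator close :: sample \<Rightarrow> ennreal) \<in> borel_measurable P"
  unfolding indicator_close by measurable

text \<open>Integrated form of the margin: conditioning on X allows any nonnegative weight
  w(X).\<close>

lemma margin_nn_integral:
  assumes w [measurable]: "w \<in> borel_measurable (Rd d)"
  shows "ennreal \<eta> * (\<integral>\<^sup>+z. w (fst z) \<partial>P) \<le> (\<integral>\<^sup>+z. w (fst z) * indicator close z \<partial>P)"
proof -
  let ?F = "sigma_X d P"
  have fst_F: "fst \<in> ?F \<rightarrow>\<^sub>M Rd d"
    unfolding sigma_X_def by (rule measurable_vimage_algebra1) (auto simp: space_P)
  have sub: "subalgebra P ?F"
    unfolding subalgebra_def sigma_X_def by (intro conjI sets_image_in_sets) auto
  interpret F: finite_measure_subalgebra P ?F by standard (rule sub)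
  have wF: "(\<lambda>z. w (fst z)) \<in> borel_measurable ?F" using fst_F by measurable
  define p where "p = nn_cond_exp P ?F (indicator close)"
  have "AE z in P. ennreal \<eta> \<le> p z"
    using margin
  proof eventually_elim
    case (elim z)
    have "ennreal \<circ> indicator close = (indicator close :: sample \<Rightarrow> ennreal)"
      by (auto simp: fun_eq_iff indicator_def)
    \<comment> \<open>\<open>real_cond_exp\<close> is the conditional expectation of the positive
      part minus that of the negative part; dropping the latter preserves the bound. Where p is
      infinite, \<open>enn2real\<close> gives 0, which is harmless in the comparison with p
      below.\<close>
    then have "\<eta> \<le> enn2real (p z)"
      using elim by (simp add: real_cond_exp_def p_def comp_def) (smt (verit) enn2real_nonneg)
    then have "ennreal \<eta> \<le> ennreal (enn2real (p z))" by (rule ennreal_leI)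
    also have "\<dots> \<le> p z" by (simp add: ennreal_enn2real_if)
    finally show ?case .
  qed
  then have "(\<integral>\<^sup>+z. ennreal \<eta> * w (fst z) \<partial>P) \<le> (\<integral>\<^sup>+z. w (fst z) * p z \<partial>P)"
    by (intro nn_integral_mono_AE, eventually_elim) (metis mult.commute mult_right_mono zero_le)
  also have "\<dots> = (\<integral>\<^sup>+z. w (fst z) * indicator close z \<partial>P)"
    unfolding p_def by (rule F.nn_cond_exp_intg[OF wF]) simp
  finally show ?thesis by (simp add: nn_integral_cmult)
qed

lemma \<eta>_le_1: "\<eta> \<le> 1"
proof -
  have "ennreal \<eta> \<le> (\<integral>\<^sup>+z. indicator close z \<partial>P)"
    using margin_nn_integral[of "\<lambda>_. 1"] by (simp add: emeasure_space_1)
  also have "\<dots> \<le> (\<integral>\<^sup>+z. 1 \<partial>P)" by (intro nn_integral_mono) (auto simp: indicator_def)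
  also have "\<dots> = ennreal 1" by (simp add: emeasure_space_1)
  finally show ?thesis by (subst (asm) ennreal_le_iff) auto
qed

section \<open>Loss differences and lower bounds on the excess risk\<close>

text \<open>The subtraction happens before integration because a single loss may have infinite
  expectation, while the difference is at most c |t - u| whatever Y is.\<close>

definition loss_diff :: "predictor \<Rightarrow> predictor \<Rightarrow> sample \<Rightarrow> real" where
  "loss_diff t u = (\<lambda>z. huber c (snd z - t (fst z)) - huber c (snd z - u (fst z)))"

lemma loss_diff_measurable [measurable]:
  assumes [measurable]: "t \<in> borel_measurable (Rd d)" "u \<in> borel_measurable (Rd d)"
  shows "loss_diff t u \<in> borel_measurable P"
  unfolding loss_diff_def by measurable

lemma abs_loss_diff_le: "\<bar>loss_diff t u z\<bar> \<le> c * \<bar>t (fst z) - u (fst z)\<bar>"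
  using huber_lipschitz[OF c, of "snd z - t (fst z)" "snd z - u (fst z)"]
  by (simp add: loss_diff_def abs_minus_commute)

lemma excess_risk_eq: "excess_risk c P s t = ext_integral P (\<lambda>z. ereal (loss_diff t s z))"
  by (simp add: excess_risk_def loss_diff_def split_beta')

text \<open>The truncation to bounded deviations t - s is needed because s need not be integrable.\<close>

lemma nn_integral_loss_diff_ge:
  assumes [measurable]: "t \<in> borel_measurable (Rd d)"
  shows "(\<integral>\<^sup>+z. ennreal (- loss_diff t s z) \<partial>P)
      + ennreal \<eta> * (\<integral>\<^sup>+z. ennreal (huber (c / 2) (t (fst z) - s (fst z))) \<partial>P)
    \<le> (\<integral>\<^sup>+z. ennreal (loss_diff t s z) \<partial>P)"
proof -
  define h where "h = (\<lambda>x. t x - s x)"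
  have [measurable]: "h \<in> borel_measurable (Rd d)" by (simp add: h_def)
  define \<psi> where "\<psi> = (\<lambda>z. clip c (snd z - s (fst z)))"
  have [measurable]: "\<psi> \<in> borel_measurable P" by (simp add: \<psi>_def)
  define H where "H = (\<lambda>x. ennreal (huber (c / 2) (h x)))"
  have [measurable]: "H \<in> borel_measurable (Rd d)" by (simp add: H_def)
  define f where "f = loss_diff t s"
  have [measurable]: "f \<in> borel_measurable P" by (simp add: f_def)
  define w :: "nat \<Rightarrow> vec \<Rightarrow> ennreal" where "w = (\<lambda>r. indicator {x. \<bar>h x\<bar> \<le> real r})"
  have w [measurable]: "w r \<in> borel_measurable (Rd d)" for r
  proof -
    have "w r = (\<lambda>x. if \<bar>h x\<bar> \<le> real r then 1 else 0)"
      by (auto simp: fun_eq_iff indicator_def w_def)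
    then show ?thesis by simp
  qed
  have trunc: "(\<integral>\<^sup>+z. (ennreal (- f z) + ennreal \<eta> * H (fst z)) * w r (fst z) \<partial>P) \<le> (\<integral>\<^sup>+z. ennreal (f z) \<partial>P)" for r
  proof -
    define wp where "wp = (\<lambda>x. w r x * ennreal (h x))"
    define wm where "wm = (\<lambda>x. w r x * ennreal (- h x))"
    have [measurable]: "wp \<in> borel_measurable (Rd d)" "wm \<in> borel_measurable (Rd d)"
      by (auto simp: wp_def wm_def)
    \<comment> \<open>S consists of the positive contributions to h clip (Y - s(X)) on the
      truncation set. By orthogonality it equals the negative ones, so adding S to both sides
      disposes of the linear Taylor term; S is finite since |h| \<le> r there and |clip| \<le> c,
      hence it can be cancelled at the end.\<close>
    define S where "S = (\<integral>\<^sup>+z. wp (fst z) * ennreal (\<psi> z) \<partial>P) + (\<integral>\<^sup>+z. wm (fst z) * ennreal (- \<psi> z) \<partial>P)"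
    have S: "S = (\<integral>\<^sup>+z. wp (fst z) * ennreal (- \<psi> z) \<partial>P) + (\<integral>\<^sup>+z. wm (fst z) * ennreal (\<psi> z) \<partial>P)"
      by (simp add: S_def \<psi>_def nn_integral_clip_residual)
    have bound: "(\<integral>\<^sup>+z. wq (fst z) * ennreal (g z) \<partial>P) < \<infinity>"
      if "\<And>x. wq x \<le> ennreal r" "\<And>z. g z \<le> c" for wq g
    proof -
      have "(\<integral>\<^sup>+z. wq (fst z) * ennreal (g z) \<partial>P) \<le> (\<integral>\<^sup>+z. ennreal r * ennreal c \<partial>P)"
        using that by (intro nn_integral_mono mult_mono ennreal_leI) auto
      also have "\<dots> < \<infinity>" by (simp add: emeasure_space_1 ennreal_mult_less_top)
      finally show ?thesis .
    qed
    have \<psi>c: "\<psi> z \<le> c" "- \<psi> z \<le> c" for z using abs_clip_le[OF c, of "snd z - s (fst z)"] by (auto simp: \<psi>_def)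
    have wr: "wp x \<le> ennreal r" "wm x \<le> ennreal r" for x
      by (auto simp: wp_def wm_def w_def indicator_def intro!: ennreal_leI simp del: ennreal_of_nat_eq_real_of_nat)
    have "S < \<infinity>" unfolding S_def using bound[of wp \<psi>, OF wr(1) \<psi>c(1)] bound[of wm "\<lambda>z. - \<psi> z", OF wr(2) \<psi>c(2)] by simp
    have "(\<integral>\<^sup>+z. (ennreal (- f z) + ennreal \<eta> * H (fst z)) * w r (fst z) \<partial>P) + S
      = (\<integral>\<^sup>+z. ennreal (- f z) * w r (fst z) \<partial>P) + ennreal \<eta> * (\<integral>\<^sup>+z. H (fst z) * w r (fst z) \<partial>P) + S"
      by (simp add: distrib_right nn_integral_add nn_integral_cmult mult.assoc)
    also have "\<dots> \<le> (\<integral>\<^sup>+z. ennreal (- f z) * w r (fst z) \<partial>P)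
        + (\<integral>\<^sup>+z. (H (fst z) * w r (fst z)) * indicator close z \<partial>P) + S"
      using margin_nn_integral[of "\<lambda>x. H x * w r x"] by (intro add_mono) auto
    also have "\<dots> = (\<integral>\<^sup>+z. ennreal (- f z) * w r (fst z) + (H (fst z) * w r (fst z)) * indicator close z
        + wp (fst z) * ennreal (- \<psi> z) + wm (fst z) * ennreal (\<psi> z) \<partial>P)"
      unfolding S by (simp add: nn_integral_add add.assoc)
    also have "\<dots> \<le> (\<integral>\<^sup>+z. ennreal (f z) + wp (fst z) * ennreal (\<psi> z) + wm (fst z) * ennreal (- \<psi> z) \<partial>P)"
    proof (rule nn_integral_mono)
      fix z
      define i :: real where "i = indicator close z"
      have ind: "indicator close z = ennreal i" by (simp add: i_def indicator_def)
      define hx where "hx = h (fst z)"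
      define p where "p = \<psi> z"
      have f: "f z = huber_rem c (snd z - s (fst z)) hx - hx * p"
        by (simp add: f_def loss_diff_def huber_rem_def hx_def h_def p_def \<psi>_def)
      have "i * huber (c / 2) hx \<le> huber_rem c (snd z - s (fst z)) hx"
        using huber_rem_ge[OF c, of "snd z - s (fst z)" hx] huber_rem_nonneg[OF c, of "snd z - s (fst z)" hx]
        by (cases z) (auto simp: i_def indicator_def)
      then have "i * huber (c / 2) hx - hx * p \<le> f z" using f by linarith
      \<comment> \<open>The terms are distributed so that both sides are sums of nonnegative ones.
        As \<open>ennreal\<close> maps negative numbers to 0, these maxima are what the extended
        integrals contain.\<close>
      then have real: "max 0 (- f z) + i * huber (c / 2) hx + max 0 hx * max 0 (- p) + max 0 (- hx) * max 0 p
         \<le> max 0 (f z) + max 0 hx * max 0 p + max 0 (- hx) * max 0 (- p)"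
        by (auto simp: max_def)
      have H0: "0 \<le> huber (c / 2) hx" using c by (intro huber_nonneg) auto
      have mx: "ennreal u = ennreal (max 0 u)" for u by (simp add: max_def ennreal_neg)
      have "ennreal (- f z) + ennreal (huber (c / 2) hx) * ennreal i + ennreal hx * ennreal (- p) + ennreal (- hx) * ennreal p
         \<le> ennreal (f z) + ennreal hx * ennreal p + ennreal (- hx) * ennreal (- p)"
        unfolding mx[of "- f z"] mx[of hx] mx[of p] mx[of "- hx"] mx[of "- p"] mx[of "f z"]
        using ennreal_leI[OF real] H0
        by (simp add: ennreal_plus ennreal_mult i_def mult.commute)
      then show "ennreal (- f z) * w r (fst z) + (H (fst z) * w r (fst z)) * indicator close z
        + wp (fst z) * ennreal (- \<psi> z) + wm (fst z) * ennreal (\<psi> z)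
        \<le> ennreal (f z) + wp (fst z) * ennreal (\<psi> z) + wm (fst z) * ennreal (- \<psi> z)"
        unfolding ind H_def wp_def wm_def
        by (cases "\<bar>h (fst z)\<bar> \<le> real r") (simp_all add: w_def hx_def p_def)
    qed
    also have "\<dots> = (\<integral>\<^sup>+z. ennreal (f z) \<partial>P) + S"
      unfolding S_def by (simp add: nn_integral_add add.assoc)
    finally show ?thesis using \<open>S < \<infinity>\<close>
      by (auto simp: add.commute[of _ S] ennreal_add_left_cancel_le)
  qed
  have "(\<lambda>r. \<integral>\<^sup>+z. (ennreal (- f z) + ennreal \<eta> * H (fst z)) * w r (fst z) \<partial>P)
     \<longlonglongrightarrow> (\<integral>\<^sup>+z. ennreal (- f z) + ennreal \<eta> * H (fst z) \<partial>P)"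
  proof (rule nn_integral_LIMSEQ)
    show "incseq (\<lambda>r z. (ennreal (- f z) + ennreal \<eta> * H (fst z)) * w r (fst z))"
      by (auto simp: incseq_def le_fun_def w_def indicator_def)
    fix z :: sample
    have "\<forall>\<^sub>F r in sequentially. \<bar>h (fst z)\<bar> \<le> real r"
      using eventually_ge_at_top[of "nat \<lceil>\<bar>h (fst z)\<bar>\<rceil>"] by eventually_elim linarith
    then have "\<forall>\<^sub>F r in sequentially. (ennreal (- f z) + ennreal \<eta> * H (fst z)) * w r (fst z)
       = ennreal (- f z) + ennreal \<eta> * H (fst z)"
      by eventually_elim (simp add: w_def)
    then show "(\<lambda>r. (ennreal (- f z) + ennreal \<eta> * H (fst z)) * w r (fst z))
       \<longlonglongrightarrow> ennreal (- f z) + ennreal \<eta> * H (fst z)"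
      by (rule tendsto_eventually)
  qed measurable
  then have "(\<integral>\<^sup>+z. ennreal (- f z) + ennreal \<eta> * H (fst z) \<partial>P) \<le> (\<integral>\<^sup>+z. ennreal (f z) \<partial>P)"
    using trunc by (intro LIMSEQ_le_const2) auto
  then show ?thesis by (simp add: nn_integral_add nn_integral_cmult f_def H_def h_def)
qed

lemma excess_risk_nonneg:
  assumes t: "t \<in> borel_measurable (Rd d)"
  shows "0 \<le> excess_risk c P s t"
proof -
  define p where "p = (\<integral>\<^sup>+z. ennreal (loss_diff t s z) \<partial>P)"
  define q where "q = (\<integral>\<^sup>+z. ennreal (- loss_diff t s z) \<partial>P)"
  have "q \<le> q + ennreal \<eta> * (\<integral>\<^sup>+z. ennreal (huber (c / 2) (t (fst z) - s (fst z))) \<partial>P)" by simp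
  also have "\<dots> \<le> p" using nn_integral_loss_diff_ge[OF t] by (simp add: p_def q_def)
  finally have "enn2ereal q \<le> enn2ereal p" by (simp add: less_eq_ennreal.rep_eq)
  then show ?thesis unfolding excess_risk_eq ext_integral_def p_def q_def
    by (simp add: ereal_diff_positive)
qed

lemma loss_diff_integrable:
  assumes [measurable]: "t \<in> borel_measurable (Rd d)" "u \<in> borel_measurable (Rd d)"
    and i: "integrable P (\<lambda>z. t (fst z) - u (fst z))"
  shows "integrable P (loss_diff t u)"
proof (rule Bochner_Integration.integrable_bound)
  show "integrable P (\<lambda>z. c * (t (fst z) - u (fst z)))" using i by simp
  show "AE z in P. norm (loss_diff t u z) \<le> norm (c * (t (fst z) - u (fst z)))"
    using abs_loss_diff_le c by (auto simp: abs_mult)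
qed simp

lemma excess_risk_integrable:
  assumes "t \<in> borel_measurable (Rd d)" "integrable P (\<lambda>z. t (fst z) - s (fst z))"
  shows "excess_risk c P s t = ereal (expectation (loss_diff t s))"
  unfolding excess_risk_eq by (rule ext_integral_integrable[OF loss_diff_integrable]) (use assms in auto)

lemma huber_integrable:
  assumes "0 < c'" "integrable P (g :: sample \<Rightarrow> real)"
  shows "integrable P (\<lambda>z. huber c' (g z))"
proof (rule Bochner_Integration.integrable_bound)
  show "integrable P (\<lambda>z. c' * g z)" using assms by simp
  show "(\<lambda>z. huber c' (g z)) \<in> borel_measurable P" using assms(2) by auto
  show "AE z in P. norm (huber c' (g z)) \<le> norm (c' * g z)"
    using huber_lipschitz[OF assms(1), of "g z" 0 for z] assms(1) by (auto simp: abs_mult huber_def)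
qed

lemma expectation_loss_diff_ge:
  assumes t [measurable]: "t \<in> borel_measurable (Rd d)" and i: "integrable P (\<lambda>z. t (fst z) - s (fst z))"
  shows "\<eta> * expectation (\<lambda>z. huber (c / 2) (t (fst z) - s (fst z))) \<le> expectation (loss_diff t s)"
proof -
  define f where "f = loss_diff t s"
  have f: "integrable P f" unfolding f_def by (rule loss_diff_integrable) (use i in auto)
  define H :: "sample \<Rightarrow> real" where "H = (\<lambda>z. huber (c / 2) (t (fst z) - s (fst z)))"
  have H: "integrable P H" unfolding H_def by (rule huber_integrable) (use i c in auto)
  have H0: "0 \<le> H z" for z using c by (simp add: H_def huber_nonneg)
  define p where "p = (\<integral>\<^sup>+z. ennreal (f z) \<partial>P)"
  define q where "q = (\<integral>\<^sup>+z. ennreal (- f z) \<partial>P)"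
  have fin: "p < top" "q < top" using integrableD[OF f] by (auto simp: p_def q_def top.not_eq_extremum)
  have E0: "0 \<le> expectation H" using H0 by (simp add: Bochner_Integration.integral_nonneg)
  have "(\<integral>\<^sup>+z. ennreal (H z) \<partial>P) = ennreal (expectation H)"
    using H H0 by (intro nn_integral_eq_integral) auto
  then have "q + ennreal \<eta> * ennreal (expectation H) \<le> p"
    using nn_integral_loss_diff_ge[OF t] by (simp add: p_def q_def f_def H_def)
  then have "ennreal (enn2real q) + ennreal (\<eta> * expectation H) \<le> ennreal (enn2real p)"
    using fin \<eta> E0 by (simp add: ennreal_mult)
  moreover have "0 \<le> \<eta> * expectation H" using E0 \<eta> by simp
  ultimately have "ennreal (enn2real q + \<eta> * expectation H) \<le> ennreal (enn2real p)" by simp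
  then have "enn2real q + \<eta> * expectation H \<le> enn2real p"
    by (rule ennreal_le_iff[THEN iffD1, rotated]) simp
  moreover have "expectation f = enn2real p - enn2real q"
    using f by (simp add: p_def q_def real_lebesgue_integral_def)
  ultimately show ?thesis by (simp add: f_def H_def)
qed

text \<open>Because the loss grows linearly, |t - s| is at most a multiple of
  \<open>huber (c / 2)\<close> plus a constant. Non-integrability thus makes the positive part of
  the excess risk infinite, and \<infinity> minus anything is \<infinity> by the convention of
  \<open>ext_integral\<close>.\<close>

lemma excess_risk_not_integrable:
  assumes t [measurable]: "t \<in> borel_measurable (Rd d)" and i: "\<not> integrable P (\<lambda>z. t (fst z) - s (fst z))"
  shows "excess_risk c P s t = \<infinity>"
proof -
  define h :: "sample \<Rightarrow> real" where "h = (\<lambda>z. t (fst z) - s (fst z))"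
  have "(\<integral>\<^sup>+z. ennreal \<bar>h z\<bar> \<partial>P) = \<infinity>"
    using i by (auto simp: integrable_iff_bounded h_def not_less top_unique)
  moreover have "(\<integral>\<^sup>+z. ennreal \<bar>h z\<bar> \<partial>P) \<le> ennreal (2 / c) * (\<integral>\<^sup>+z. ennreal (huber (c / 2) (h z)) \<partial>P) + ennreal c"
  proof -
    have "(\<integral>\<^sup>+z. ennreal \<bar>h z\<bar> \<partial>P) \<le> (\<integral>\<^sup>+z. ennreal (2 / c) * ennreal (huber (c / 2) (h z)) + ennreal c \<partial>P)"
    proof (rule nn_integral_mono)
      fix z
      have "2 / c * (c / 2 * \<bar>h z\<bar> - (c / 2)\<^sup>2 / 2) \<le> 2 / c * huber (c / 2) (h z)"
        using c by (intro mult_left_mono huber_ge_linear) auto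
      moreover have "\<bar>h z\<bar> - c / 4 = 2 / c * (c / 2 * \<bar>h z\<bar> - (c / 2)\<^sup>2 / 2)"
        using c by (simp add: power2_eq_square field_simps)
      ultimately have "\<bar>h z\<bar> - c / 4 \<le> 2 / c * huber (c / 2) (h z)" by (rule ord_eq_le_trans[rotated])
      then have "\<bar>h z\<bar> \<le> 2 / c * huber (c / 2) (h z) + c" using c by linarith
      moreover have "0 \<le> huber (c / 2) (h z)" using c by (intro huber_nonneg) auto
      ultimately show "ennreal \<bar>h z\<bar> \<le> ennreal (2 / c) * ennreal (huber (c / 2) (h z)) + ennreal c"
        using c by (simp flip: ennreal_mult ennreal_plus add: ennreal_leI)
    qed
    also have "\<dots> = ennreal (2 / c) * (\<integral>\<^sup>+z. ennreal (huber (c / 2) (h z)) \<partial>P) + ennreal c"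
      by (subst nn_integral_add) (auto simp: nn_integral_cmult emeasure_space_1 h_def)
    finally show ?thesis .
  qed
  ultimately have "(\<integral>\<^sup>+z. ennreal (huber (c / 2) (h z)) \<partial>P) = \<infinity>"
    by (auto simp: ennreal_mult_eq_top_iff top_unique)
  then have "(\<integral>\<^sup>+z. ennreal (loss_diff t s z) \<partial>P) = \<infinity>"
    using nn_integral_loss_diff_ge[OF t] \<eta> by (simp add: h_def ennreal_mult_eq_top_iff top_unique ennreal_mult_top)
  then show ?thesis by (simp add: excess_risk_eq ext_integral_def)
qed

end

section \<open>Sparse linear predictors\<close>

lemma dot_measurable [measurable (raw)]:
  assumes [measurable]: "f \<in> M \<rightarrow>\<^sub>M Rd d" "g \<in> M \<rightarrow>\<^sub>M Rd d"
  shows "(\<lambda>z. dot d (f z) (g z)) \<in> borel_measurable M"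
  unfolding dot_def
proof (intro borel_measurable_sum borel_measurable_times)
  fix j assume "j \<in> {1..d}"
  then have "(\<lambda>x. x j) \<in> borel_measurable (Rd d)" 
    unfolding Rd_def by (rule measurable_component_singleton)
  then show "(\<lambda>z. f z j) \<in> borel_measurable M" "(\<lambda>z. g z j) \<in> borel_measurable M"
    by measurable
qed

lemma linpred_measurable [measurable]:
  "\<theta> \<in> space (Rd d) \<Longrightarrow> linpred d q \<theta> \<in> borel_measurable (Rd d)"
  unfolding linpred_def by measurable

text \<open>The restriction keeps the difference in the space of \<open>Rd d\<close>, whose members
  are undefined outside {1..d}; a pointwise difference would not respect this.\<close>

definition sparse_diff :: "nat \<Rightarrow> vec \<Rightarrow> vec \<Rightarrow> vec" where
  "sparse_diff d \<theta> \<theta>' = (\<lambda>j\<in>{1..d}. \<theta> j - \<theta>' j)"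

lemma sparse_diff_space: "sparse_diff d \<theta> \<theta>' \<in> space (Rd d)"
  by (simp add: sparse_diff_def Rd_def space_PiM)

lemma dot_sparse_diff: "dot d (sparse_diff d \<theta> \<theta>') x = dot d \<theta> x - dot d \<theta>' x"
  by (simp add: dot_def sparse_diff_def sum_subtractf[symmetric] left_diff_distrib)

lemma l0_sparse_diff: "l0 d (sparse_diff d \<theta> \<theta>') \<le> l0 d \<theta> + l0 d \<theta>'"
proof -
  have "l0 d (sparse_diff d \<theta> \<theta>') \<le> card ({j \<in> {1..d}. \<theta> j \<noteq> 0} \<union> {j \<in> {1..d}. \<theta>' j \<noteq> 0})"
    unfolding l0_def by (rule card_mono) (auto simp: sparse_diff_def)
  also have "\<dots> \<le> l0 d \<theta> + l0 d \<theta>'" unfolding l0_def by (rule card_Un_le)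
  finally show ?thesis .
qed

section \<open>The constant kappa and centered linear forms\<close>

lemma kappa_ge:
  assumes "kappa d P K < \<infinity>" shows "36 / 25 \<le> enn2real (kappa d P K)"
proof -
  have "ennreal (1 / ln 2) \<le> kappa d P K" by (simp add: kappa_def Let_def)
  then have "1 / ln 2 \<le> enn2real (kappa d P K)"
    using enn2real_mono[of "ennreal (1 / ln 2)" "kappa d P K"] assms by (simp add: less_top)
  moreover have "36 / 25 \<le> 1 / ln (2 :: real)"
    using ln2_le_25_over_36 by (simp add: field_simps)
  ultimately show ?thesis by linarith
qed

locale huber_linear_regression = huber_regression +
  fixes K :: nat
  assumes square_integrable: "\<And>j. j \<in> {1..d} \<Longrightarrow> integrable P (\<lambda>z. (fst z j)\<^sup>2)"
    and kappa_finite: "kappa d P K < \<infinity>"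
begin

definition \<kappa> :: real where "\<kappa> = enn2real (kappa d P K)"

lemma \<kappa>_ge: "36 / 25 \<le> \<kappa>"
  unfolding \<kappa>_def by (rule kappa_ge[OF kappa_finite])

lemma ln_\<kappa>_ge: "1 / 3 \<le> ln \<kappa>"
  by (rule ln_ge_third[OF \<kappa>_ge])

definition centered :: "vec \<Rightarrow> sample \<Rightarrow> real" where
  "centered \<theta> z = dot d \<theta> (fst z - mean_X d P)"

lemma centered_eq: "centered \<theta> z = dot d \<theta> (fst z) - dot d \<theta> (mean_X d P)"
  by (simp add: centered_def dot_def fun_diff_def sum_subtractf right_diff_distrib)

lemma coordinate_measurable [measurable]:
  assumes "j \<in> {1..d}" shows "(\<lambda>z. fst z j) \<in> borel_measurable P"
proof -
  have "(\<lambda>x. x j) \<in> borel_measurable (Rd d)"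
    unfolding Rd_def using assms by (rule measurable_component_singleton)
  then show ?thesis by measurable
qed

lemma coordinate_integrable: "j \<in> {1..d} \<Longrightarrow> integrable P (\<lambda>z. fst z j)"
  by (rule square_integrable_imp_integrable[OF _ square_integrable]) auto

lemma centered_sum: "centered \<theta> z = (\<Sum>j\<in>{1..d}. \<theta> j * (fst z j - mean_X d P j))"
  by (simp add: centered_def dot_def fun_diff_def)

lemma dot_fst_integrable [simp]: "integrable P (\<lambda>z. dot d \<theta> (fst z))"
  unfolding dot_def using coordinate_integrable by (intro Bochner_Integration.integrable_sum) auto

lemma linpred_integrable [simp]: "integrable P (\<lambda>z. linpred d q \<theta> (fst z))"
  by (simp add: linpred_def)

lemma centered_integrable [simp]: "integrable P (centered \<theta>)"
  unfolding centered_eq[abs_def] by simp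

lemma centered_measurable [measurable]: "centered \<theta> \<in> borel_measurable P"
  using centered_integrable by blast

lemma expectation_centered: "expectation (centered \<theta>) = 0"
  unfolding centered_sum[abs_def]
  using coordinate_integrable by (simp add: mean_X_def prob_space)

lemma centered_square_integrable: "integrable P (\<lambda>z. (centered \<theta> z)\<^sup>2)"
proof (rule Bochner_Integration.integrable_bound)
  show "integrable P (\<lambda>z. real d * (\<Sum>j\<in>{1..d}. (\<theta> j)\<^sup>2 * ((fst z j)\<^sup>2 - 2 * mean_X d P j * fst z j + (mean_X d P j)\<^sup>2)))"
    using coordinate_integrable square_integrable
    by (intro Bochner_Integration.integrable_sum integrable_mult_right Bochner_Integration.integrable_add
        Bochner_Integration.integrable_diff integrable_const)
  show "AE z in P. norm ((centered \<theta> z)\<^sup>2) \<le> norm (real d * (\<Sum>j\<in>{1..d}. (\<theta> j)\<^sup>2 * ((fst z j)\<^sup>2 - 2 * mean_X d P j * fst z j + (mean_X d P j)\<^sup>2)))"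
  proof (rule AE_I2)
    fix z
    have "(centered \<theta> z)\<^sup>2 \<le> (\<Sum>j\<in>{1..d}. (\<theta> j * (fst z j - mean_X d P j))\<^sup>2) * card {1..d}"
      unfolding centered_sum by (rule sum_squared_le_sum_of_squares)
    also have "\<dots> = real d * (\<Sum>j\<in>{1..d}. (\<theta> j)\<^sup>2 * ((fst z j)\<^sup>2 - 2 * mean_X d P j * fst z j + (mean_X d P j)\<^sup>2))"
      by (simp add: power_mult_distrib power2_diff ac_simps add_diff_eq diff_add_eq)
    finally show "norm ((centered \<theta> z)\<^sup>2) \<le> norm (real d * (\<Sum>j\<in>{1..d}. (\<theta> j)\<^sup>2 * ((fst z j)\<^sup>2 - 2 * mean_X d P j * fst z j + (mean_X d P j)\<^sup>2)))"
      by simp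
  qed
qed simp

text \<open>The factor 2 makes \<kappa> \<sigma> < 2 \<kappa> \<sigma> strict, so some admissible u
  of the infimum in \<open>psi1_norm\<close> lies below the scale used here, whether or not the
  infimum is attained. The bound 2 is 1 + E psi_1.\<close>

lemma centered_subexp:
  assumes \<theta>: "\<theta> \<in> space (Rd d)" "l0 d \<theta> \<le> 2 * K"
    and \<sigma>: "0 < \<sigma>" "expectation (\<lambda>z. (centered \<theta> z)\<^sup>2) = \<sigma>\<^sup>2"
  shows "(\<integral>\<^sup>+z. ennreal (exp (\<bar>centered \<theta> z\<bar> / (2 * \<kappa> * \<sigma>))) \<partial>P) \<le> 2"
proof -
  let ?Z = "\<lambda>\<theta> z. dot d \<theta> (fst z - mean_X d P)"
  have Z: "?Z \<theta> = centered \<theta>" by (simp add: centered_def[abs_def])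
  \<comment> \<open>A zero vector would have variance 0; being nonzero, \<theta> takes part in the
    supremum that defines \<open>kappa\<close>.\<close>
  have "\<exists>j\<in>{1..d}. \<theta> j \<noteq> 0"
  proof (rule ccontr)
    assume "\<not> (\<exists>j\<in>{1..d}. \<theta> j \<noteq> 0)"
    then have "centered \<theta> z = 0" for z by (simp add: centered_sum)
    then show False using \<sigma> by simp
  qed
  have L2: "L2_norm P (?Z \<theta>) = ennreal \<sigma>" unfolding Z L2_norm_def using \<sigma> by simp
  have "psi1_norm P (?Z \<theta>) / ennreal \<sigma>
    \<le> (SUP \<theta> \<in> {\<theta> \<in> space (Rd d). (\<exists>j\<in>{1..d}. \<theta> j \<noteq> 0) \<and> l0 d \<theta> \<le> 2 * K \<and>
                        \<not> (psi1_norm P (?Z \<theta>) = 0 \<and> L2_norm P (?Z \<theta>) = 0)}.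
             psi1_norm P (?Z \<theta>) / L2_norm P (?Z \<theta>))"
    unfolding L2[symmetric] using \<theta> \<open>\<exists>j\<in>{1..d}. \<theta> j \<noteq> 0\<close> L2 \<sigma> by (intro SUP_upper) auto
  also have "\<dots> \<le> kappa d P K" by (simp add: kappa_def Let_def)
  also have "\<dots> = ennreal \<kappa>" using kappa_finite by (simp add: \<kappa>_def less_top)
  finally have le: "psi1_norm P (centered \<theta>) / ennreal \<sigma> \<le> ennreal \<kappa>" unfolding Z .
  have "psi1_norm P (centered \<theta>) \<le> ennreal (\<kappa> * \<sigma>)"
  proof (cases "psi1_norm P (centered \<theta>)")
    case (real p)
    have "ennreal (p / \<sigma>) \<le> ennreal \<kappa>" using le \<sigma> real by (simp add: divide_ennreal)
    then have "p / \<sigma> \<le> \<kappa>" using \<kappa>_ge by (subst (asm) ennreal_le_iff) auto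
    then show ?thesis using \<sigma> real by (simp add: field_simps ennreal_leI)
  next
    case top
    then show ?thesis using le by (simp add: ennreal_top_divide top_unique)
  qed
  also have "\<dots> < ennreal (2 * \<kappa> * \<sigma>)" using \<kappa>_ge \<sigma> by (subst ennreal_less_iff) auto
  finally obtain u where u: "0 < u" "(\<integral>\<^sup>+z. ennreal (exp (\<bar>centered \<theta> z\<bar> / u) - 1) \<partial>P) \<le> 1" 
    "ennreal u < ennreal (2 * \<kappa> * \<sigma>)"
    unfolding psi1_norm_def by (auto simp: Inf_less_iff)
  then have u2: "u < 2 * \<kappa> * \<sigma>" by (subst (asm) ennreal_less_iff) auto
  have "(\<integral>\<^sup>+z. ennreal (exp (\<bar>centered \<theta> z\<bar> / (2 * \<kappa> * \<sigma>))) \<partial>P)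
     \<le> (\<integral>\<^sup>+z. ennreal (exp (\<bar>centered \<theta> z\<bar> / u) - 1) + 1 \<partial>P)"
  proof (rule nn_integral_mono)
    fix z
    have "\<bar>centered \<theta> z\<bar> / (2 * \<kappa> * \<sigma>) \<le> \<bar>centered \<theta> z\<bar> / u"
      using u u2 \<kappa>_ge \<sigma> by (intro divide_left_mono mult_pos_pos) auto
    then have "exp (\<bar>centered \<theta> z\<bar> / (2 * \<kappa> * \<sigma>)) \<le> exp (\<bar>centered \<theta> z\<bar> / u) - 1 + 1" by simp
    then have "ennreal (exp (\<bar>centered \<theta> z\<bar> / (2 * \<kappa> * \<sigma>))) \<le> ennreal (exp (\<bar>centered \<theta> z\<bar> / u) - 1 + 1)"
      by (rule ennreal_leI)
    also have "\<dots> = ennreal (exp (\<bar>centered \<theta> z\<bar> / u) - 1) + 1"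
      using u by (subst ennreal_plus) auto
    finally show "ennreal (exp (\<bar>centered \<theta> z\<bar> / (2 * \<kappa> * \<sigma>))) \<le> ennreal (exp (\<bar>centered \<theta> z\<bar> / u) - 1) + 1" .
  qed
  also have "\<dots> = (\<integral>\<^sup>+z. ennreal (exp (\<bar>centered \<theta> z\<bar> / u) - 1) \<partial>P) + 1"
    by (simp add: nn_integral_add emeasure_space_1)
  also have "\<dots> \<le> 1 + 1" using u by (intro add_mono) auto
  finally show ?thesis by simp
qed

section \<open>Deviation of the loss difference of two sparse predictors\<close>

text \<open>Plays the role of a Bernstein condition: two predictors of small excess risk are close
  to each other. The margin inequality is applied to t and to u, and \<open>huber_diff_le\<close>
  eliminates s.\<close>

lemma huber_risk_le_excess:
  assumes t: "t \<in> borel_measurable (Rd d)" "integrable P (\<lambda>z. t (fst z))"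
    and u: "u \<in> borel_measurable (Rd d)" "integrable P (\<lambda>z. u (fst z))"
    and s: "integrable P (\<lambda>z. s (fst z))"
  shows "\<eta> / 2 * expectation (\<lambda>z. huber c (t (fst z) - u (fst z)))
    \<le> expectation (loss_diff t s) + expectation (loss_diff u s)"
proof -
  let ?H = "\<lambda>t z. huber (c / 2) (t (fst z) - s (fst z))"
  have H: "integrable P (?H t)" "integrable P (?H u)" "integrable P (\<lambda>z. huber c (t (fst z) - u (fst z)))"
    using t u s c by (auto intro!: huber_integrable)
  have "expectation (\<lambda>z. huber c (t (fst z) - u (fst z)) / 2) \<le> expectation (\<lambda>z. ?H t z + ?H u z)"
  proof (rule integral_mono)
    fix z
    show "huber c (t (fst z) - u (fst z)) / 2 \<le> ?H t z + ?H u z"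
      using huber_diff_le[OF c, of "t (fst z) - s (fst z)" "u (fst z) - s (fst z)"] by simp
  qed (use H in auto)
  then have "\<eta> * (expectation (\<lambda>z. huber c (t (fst z) - u (fst z))) / 2) \<le> \<eta> * (expectation (?H t) + expectation (?H u))"
    using H \<eta> by (intro mult_left_mono) auto
  also have "\<dots> \<le> expectation (loss_diff t s) + expectation (loss_diff u s)"
    using expectation_loss_diff_ge[of t] expectation_loss_diff_ge[of u] t u s by (simp add: distrib_left)
  finally show ?thesis by simp
qed

text \<open>The first case of the proof is the quadratic regime of the Huber loss; the second one, in
  which the excess risk is only linear in the L2 distance, uses the assumption on kappa. The constant
  20000 is such that 20000^2 is at least 2 * 13 * 32^2 * 100^2.\<close>

lemma exists_deviation_parameter:
  assumes t: "t = linpred d q \<theta>" "\<theta> \<in> space (Rd d)" "l0 d \<theta> \<le> K"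
    and u: "u = linpred d q' \<theta>'" "\<theta>' \<in> space (Rd d)" "l0 d \<theta>' \<le> K"
    and s: "integrable P (\<lambda>z. s (fst z))"
    and \<epsilon>: "0 < \<epsilon>" "\<epsilon> < 1"
    and y: "0 \<le> y" "20000\<^sup>2 * (\<kappa> * ln \<kappa>)\<^sup>2 * y \<le> (\<epsilon> * \<eta>)\<^sup>2"
    and r: "r = \<epsilon> * (expectation (loss_diff t s) + expectation (loss_diff u s)) + 54 * c\<^sup>2 * y / (\<epsilon> * \<eta>)"
  shows "\<exists>\<beta>\<ge>0. integrable P (\<lambda>z. (loss_diff t u z)\<^sup>2 * exp (\<beta> * \<bar>loss_diff t u z\<bar>)) \<and>
     y \<le> \<beta> * r - \<beta>\<^sup>2 / 2 * expectation (\<lambda>z. (loss_diff t u z)\<^sup>2 * exp (\<beta> * \<bar>loss_diff t u z\<bar>))"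
proof -
  define \<theta>d where "\<theta>d = sparse_diff d \<theta> \<theta>'"
  \<comment> \<open>The difference g of the predictors splits into its mean a and a centered sparse
    form Z, so that E g^2 = a^2 + \<sigma>^2 = \<rho>^2.\<close>
  define a where "a = q - q' + dot d \<theta>d (mean_X d P)"
  define Z where "Z = centered \<theta>d"
  define g :: "sample \<Rightarrow> real" where "g = (\<lambda>z. t (fst z) - u (fst z))"
  have g: "g z = a + Z z" for z :: sample
    by (simp add: g_def t u linpred_def a_def Z_def centered_eq \<theta>d_def dot_sparse_diff)
  have tm [measurable]: "t \<in> borel_measurable (Rd d)" "u \<in> borel_measurable (Rd d)" using t u by auto
  have ti: "integrable P (\<lambda>z. t (fst z))" "integrable P (\<lambda>z. u (fst z))" by (auto simp: t u)
  define \<sigma> where "\<sigma> = sqrt (expectation (\<lambda>z. (Z z)\<^sup>2))"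
  have "0 \<le> expectation (\<lambda>z. (Z z)\<^sup>2)" by (rule Bochner_Integration.integral_nonneg) simp
  then have \<sigma>: "0 \<le> \<sigma>" "expectation (\<lambda>z. (Z z)\<^sup>2) = \<sigma>\<^sup>2" by (auto simp: \<sigma>_def)
  define \<rho> where "\<rho> = sqrt (a\<^sup>2 + \<sigma>\<^sup>2)"
  have \<rho>: "0 \<le> \<rho>" "\<rho>\<^sup>2 = a\<^sup>2 + \<sigma>\<^sup>2" by (auto simp: \<rho>_def)
  define b where "b = 100 * (\<kappa> * ln \<kappa>)"
  have "36 / 25 * (1 / 3) \<le> \<kappa> * ln \<kappa>" using \<kappa>_ge ln_\<kappa>_ge by (intro mult_mono) auto
  then have b: "0 < b" by (simp add: b_def)
  have Zsq: "integrable P (\<lambda>z. (Z z)\<^sup>2)" unfolding Z_def by (rule centered_square_integrable)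
  have Zi: "integrable P Z" by (simp add: Z_def)
  have "l0 d \<theta>d \<le> 2 * K" using l0_sparse_diff[of d \<theta> \<theta>'] t u by (simp add: \<theta>d_def)
  then have subexp: "0 < \<sigma> \<Longrightarrow> (\<integral>\<^sup>+z. ennreal (exp (\<bar>Z z\<bar> / (2 * \<kappa> * \<sigma>))) \<partial>P) \<le> 2"
    unfolding Z_def by (intro centered_subexp) (use \<sigma> in \<open>auto simp: Z_def \<theta>d_def sparse_diff_space\<close>)
  have weighted: "integrable P (\<lambda>z. (g z)\<^sup>2 * exp (p * \<bar>g z\<bar>))"
     "expectation (\<lambda>z. (g z)\<^sup>2 * exp (p * \<bar>g z\<bar>)) \<le> 13 * \<rho>\<^sup>2" if "0 \<le> p" "b * \<rho> * p \<le> 1" for p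
    using subexp_weighted_second_moment[of Z \<sigma> \<kappa> p a] Zsq \<sigma> \<kappa>_ge subexp that
    by (auto simp: g b_def \<rho> Z_def \<rho>_def[symmetric])
  have g2: "integrable P (\<lambda>z. (g z)\<^sup>2)" "expectation (\<lambda>z. (g z)\<^sup>2) = \<rho>\<^sup>2"
    unfolding g power2_sum using Zsq Zi \<sigma> expectation_centered[of \<theta>d]
    by (auto simp: \<rho> prob_space Z_def)
  define H where "H = expectation (\<lambda>z. huber c (g z))"
  have Hi: "integrable P (\<lambda>z. huber c (g z))"
    unfolding g_def using ti c by (auto intro!: huber_integrable)
  have H0: "0 \<le> H" unfolding H_def by (intro Bochner_Integration.integral_nonneg huber_nonneg c)
  have rH: "\<epsilon> * (\<eta> / 2 * H) + 54 * c\<^sup>2 * y / (\<epsilon> * \<eta>) \<le> r"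
    unfolding r H_def g_def using huber_risk_le_excess[OF tm(1) ti(1) tm(2) ti(2) s] \<epsilon>
    by (intro add_right_mono mult_left_mono) auto
  \<comment> \<open>The truncation level for which the rate 4/A just saturates the admissible range
    b \<rho> p \<le> 1.\<close>
  define A where "A = 4 * b * \<rho>"
  have Hlow: "min 1 (c / A) / 4 * \<rho>\<^sup>2 \<le> H" if "0 < \<rho>"
    unfolding H_def g2(2)[symmetric]
  proof (rule huber_risk_ge_second_moment[OF c])
    show A: "0 < A" using that b by (simp add: A_def)
    have p: "0 \<le> 4 / A" "b * \<rho> * (4 / A) \<le> 1" using that b by (auto simp: A_def)
    show "integrable P (\<lambda>z. (g z)\<^sup>2 * exp (4 / A * \<bar>g z\<bar>))" by (rule weighted(1)[OF p])
    show "expectation (\<lambda>z. (g z)\<^sup>2 * exp (4 / A * \<bar>g z\<bar>)) \<le> 13 * expectation (\<lambda>z. (g z)\<^sup>2)"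
      unfolding g2(2) by (rule weighted(2)[OF p])
  qed (use g2 Hi in auto)
  define W where "W = (\<lambda>\<beta>. expectation (\<lambda>z. (loss_diff t u z)\<^sup>2 * exp (\<beta> * \<bar>loss_diff t u z\<bar>)))"
  \<comment> \<open>The Lipschitz bound turns the rate \<beta> for the loss difference into the rate
    \<beta> c for g, which is why the constraint on \<beta> carries c.\<close>
  have W: "integrable P (\<lambda>z. (loss_diff t u z)\<^sup>2 * exp (\<beta> * \<bar>loss_diff t u z\<bar>))" "W \<beta> \<le> 13 * c\<^sup>2 * \<rho>\<^sup>2"
    if \<beta>: "0 \<le> \<beta>" "b * \<rho> * (\<beta> * c) \<le> 1" for \<beta>
  proof -
    have p0: "0 \<le> \<beta> * c" using \<beta> c by simp
    have int: "integrable P (\<lambda>z. c\<^sup>2 * ((g z)\<^sup>2 * exp (\<beta> * c * \<bar>g z\<bar>)))"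
      using weighted(1)[OF p0 \<beta>(2)] by simp
    have le: "(loss_diff t u z)\<^sup>2 * exp (\<beta> * \<bar>loss_diff t u z\<bar>) \<le> c\<^sup>2 * ((g z)\<^sup>2 * exp (\<beta> * c * \<bar>g z\<bar>))" for z
    proof -
      have l: "\<bar>loss_diff t u z\<bar> \<le> c * \<bar>g z\<bar>" unfolding g_def by (rule abs_loss_diff_le)
      then have "\<bar>loss_diff t u z\<bar>\<^sup>2 \<le> (c * \<bar>g z\<bar>)\<^sup>2" by (intro power_mono) auto
      then have "(loss_diff t u z)\<^sup>2 \<le> c\<^sup>2 * (g z)\<^sup>2" by (simp add: power_mult_distrib)
      moreover have "\<beta> * \<bar>loss_diff t u z\<bar> \<le> \<beta> * c * \<bar>g z\<bar>"
        using mult_left_mono[OF l \<beta>(1)] by (simp add: mult.assoc)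
      ultimately have "(loss_diff t u z)\<^sup>2 * exp (\<beta> * \<bar>loss_diff t u z\<bar>) \<le> (c\<^sup>2 * (g z)\<^sup>2) * exp (\<beta> * c * \<bar>g z\<bar>)"
        by (intro mult_mono) auto
      then show ?thesis by (simp add: mult.assoc)
    qed
    show 1: "integrable P (\<lambda>z. (loss_diff t u z)\<^sup>2 * exp (\<beta> * \<bar>loss_diff t u z\<bar>))"
      by (rule Bochner_Integration.integrable_bound[OF int])
        (use le in \<open>auto intro!: order_trans[OF le] simp: abs_mult\<close>)
    have "W \<beta> \<le> expectation (\<lambda>z. c\<^sup>2 * ((g z)\<^sup>2 * exp (\<beta> * c * \<bar>g z\<bar>)))"
      unfolding W_def by (rule integral_mono[OF 1 int le])
    also have "\<dots> \<le> c\<^sup>2 * (13 * \<rho>\<^sup>2)" using weighted(2)[OF p0 \<beta>(2)] by (simp add: mult_left_mono)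
    finally show "W \<beta> \<le> 13 * c\<^sup>2 * \<rho>\<^sup>2" by simp
  qed
  have e\<eta>: "0 < \<epsilon> * \<eta>" "\<epsilon> * \<eta> \<le> 1" using \<epsilon> \<eta> \<eta>_le_1 by (auto intro: mult_le_one)
  have "\<exists>\<beta>\<ge>0. b * \<rho> * (\<beta> * c) \<le> 1 \<and> y \<le> \<beta> * r - \<beta>\<^sup>2 / 2 * (13 * c\<^sup>2 * \<rho>\<^sup>2)"
  proof (cases "A \<le> c")
    case True
    \<comment> \<open>52 = 4 * 13 makes the variance term exactly \<beta> times the available
      curvature \<epsilon> \<eta> \<rho>^2 / 8. What remains is \<beta> times the remainder term,
      that is 54/52 y: this is where the constant 54 of the theorem is used.\<close>
    define \<beta> where "\<beta> = \<epsilon> * \<eta> / (52 * c\<^sup>2)"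
    have \<beta>: "0 \<le> \<beta>" using e\<eta> by (simp add: \<beta>_def)
    have "b * \<rho> * (\<beta> * c) = A / c * (\<epsilon> * \<eta>) / 208"
      using c by (simp add: \<beta>_def A_def power2_eq_square)
    also have "\<dots> \<le> 1 * 1 / 208" using True c e\<eta> \<rho> b
      by (intro divide_right_mono mult_mono) (auto simp: A_def)
    finally have 1: "b * \<rho> * (\<beta> * c) \<le> 1" by simp
    have "\<rho>\<^sup>2 / 4 \<le> H"
    proof (cases "\<rho> = 0")
      case False
      then have "0 < A" using \<rho> b by (simp add: A_def)
      then have "1 \<le> c / A" using True by simp
      then show ?thesis using Hlow False \<rho> by simp
    qed (use H0 in auto)
    then have "\<epsilon> * (\<eta> / 2 * (\<rho>\<^sup>2 / 4)) \<le> \<epsilon> * (\<eta> / 2 * H)" using \<epsilon> \<eta> by (intro mult_left_mono) auto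
    then have "\<epsilon> * \<eta> * \<rho>\<^sup>2 / 8 + 54 * c\<^sup>2 * y / (\<epsilon> * \<eta>) \<le> r" using rH by simp
    then have "\<beta> * (\<epsilon> * \<eta> * \<rho>\<^sup>2 / 8 + 54 * c\<^sup>2 * y / (\<epsilon> * \<eta>)) \<le> \<beta> * r" using \<beta> by (rule mult_left_mono)
    moreover have "\<beta> * (\<epsilon> * \<eta> * \<rho>\<^sup>2 / 8 + 54 * c\<^sup>2 * y / (\<epsilon> * \<eta>))
       = \<beta>\<^sup>2 / 2 * (13 * c\<^sup>2 * \<rho>\<^sup>2) + 54 / 52 * y"
      using c \<epsilon> \<eta> by (simp add: \<beta>_def power2_eq_square field_simps)
    ultimately have "y \<le> \<beta> * r - \<beta>\<^sup>2 / 2 * (13 * c\<^sup>2 * \<rho>\<^sup>2)" using y(1) by linarith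
    then show ?thesis using 1 \<beta> by blast
  next
    case False
    then have \<rho>0: "0 < \<rho>" using c \<rho> by (auto simp: A_def intro: le_neq_trans)
    \<comment> \<open>Maximiser of \<omega> \<epsilon> \<eta> / (32 b) - 13/2 \<omega>^2, since 416
      = 32 * 13. The maximum 13/2 \<omega>^2 must exceed y, and this is what the hypothesis with
      20000 provides; the additive remainder is not called upon.\<close>
    define \<omega> where "\<omega> = \<epsilon> * \<eta> / (416 * b)"
    define \<beta> where "\<beta> = \<omega> / (c * \<rho>)"
    have \<omega>: "0 < \<omega>" using e\<eta> b by (simp add: \<omega>_def)
    have \<beta>: "0 < \<beta>" using \<omega> c \<rho>0 by (simp add: \<beta>_def)
    have "b * \<rho> * (\<beta> * c) = \<epsilon> * \<eta> / 416" using c \<rho>0 b by (simp add: \<beta>_def \<omega>_def)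
    then have 1: "b * \<rho> * (\<beta> * c) \<le> 1" using e\<eta> by simp
    have "c / A \<le> 1" using False c by simp
    moreover have "c / A / 4 * \<rho>\<^sup>2 = c * \<rho> / (16 * b)"
      using \<rho>0 b by (simp add: A_def power2_eq_square)
    ultimately have "c * \<rho> / (16 * b) \<le> H" using Hlow[OF \<rho>0] by simp
    then have "\<epsilon> * (\<eta> / 2 * (c * \<rho> / (16 * b))) \<le> \<epsilon> * (\<eta> / 2 * H)" using \<epsilon> \<eta> by (intro mult_left_mono) auto
    moreover have "0 \<le> 54 * c\<^sup>2 * y / (\<epsilon> * \<eta>)" using y e\<eta> by simp
    ultimately have "\<epsilon> * (\<eta> / 2 * (c * \<rho> / (16 * b))) \<le> r" using rH by linarith
    then have "\<beta> * (\<epsilon> * (\<eta> / 2 * (c * \<rho> / (16 * b)))) \<le> \<beta> * r" using \<beta> by (intro mult_left_mono) auto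
    moreover have "\<beta> * (\<epsilon> * (\<eta> / 2 * (c * \<rho> / (16 * b)))) = 13 * \<omega>\<^sup>2"
      using c \<rho>0 b by (simp add: \<beta>_def \<omega>_def power2_eq_square)
    moreover have "\<beta>\<^sup>2 / 2 * (13 * c\<^sup>2 * \<rho>\<^sup>2) = 13 / 2 * \<omega>\<^sup>2"
      using c \<rho>0 by (simp add: \<beta>_def power_divide power_mult_distrib)
    moreover have "y \<le> 13 / 2 * \<omega>\<^sup>2"
    proof -
      have "b\<^sup>2 = 10000 * (\<kappa> * ln \<kappa>)\<^sup>2" by (simp add: b_def power_mult_distrib)
      then have "40000 * (b\<^sup>2 * y) \<le> (\<epsilon> * \<eta>)\<^sup>2" using y(2) by simp
      moreover have "(\<epsilon> * \<eta>)\<^sup>2 = 173056 * (b\<^sup>2 * \<omega>\<^sup>2)"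
        using b by (simp add: \<omega>_def power_divide power_mult_distrib)
      moreover have "0 \<le> b\<^sup>2 * \<omega>\<^sup>2" by simp
      ultimately have "b\<^sup>2 * y \<le> 13 / 2 * (b\<^sup>2 * \<omega>\<^sup>2)" by linarith
      then have "b\<^sup>2 * y \<le> b\<^sup>2 * (13 / 2 * \<omega>\<^sup>2)" by (simp only: mult.left_commute)
      then show ?thesis using b by simp
    qed
    ultimately have "y \<le> \<beta> * r - \<beta>\<^sup>2 / 2 * (13 * c\<^sup>2 * \<rho>\<^sup>2)" by linarith
    then show ?thesis using 1 \<beta> by (intro exI[of _ \<beta>]) auto
  qed
  then obtain \<beta> where \<beta>: "0 \<le> \<beta>" "b * \<rho> * (\<beta> * c) \<le> 1" "y \<le> \<beta> * r - \<beta>\<^sup>2 / 2 * (13 * c\<^sup>2 * \<rho>\<^sup>2)" by blast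
  have "\<beta>\<^sup>2 / 2 * W \<beta> \<le> \<beta>\<^sup>2 / 2 * (13 * c\<^sup>2 * \<rho>\<^sup>2)"
    using W(2)[OF \<beta>(1,2)] by (intro mult_left_mono) auto
  then have "y \<le> \<beta> * r - \<beta>\<^sup>2 / 2 * W \<beta>" using \<beta>(3) by linarith
  then show ?thesis using W(1)[OF \<beta>(1,2)] \<beta>(1) unfolding W_def by blast
qed

end

section \<open>The hold-out for fixed predictors\<close>

context huber_linear_regression
begin

text \<open>A union bound over k handles the dependence of \<open>kh\<close> on the sample: the
  integrand is majorised pointwise by a constant plus the indicators of all K deviation events, and
  only this majorant is integrated.\<close>

lemma holdout_oracle_inequality:
  fixes y :: real and J :: "nat set"
  assumes t: "\<And>k. k \<in> {1..K} \<Longrightarrow> t k = linpred d (q k) (\<theta> k) \<and> \<theta> k \<in> space (Rd d) \<and> l0 d (\<theta> k) \<le> K"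
    and s: "integrable P (\<lambda>z. s (fst z))"
    and \<epsilon>: "0 < \<epsilon>" "\<epsilon> < 1"
    and y: "0 \<le> y" "20000\<^sup>2 * (\<kappa> * ln \<kappa>)\<^sup>2 * y \<le> (\<epsilon> * \<eta>)\<^sup>2"
    and J: "finite J" "J \<noteq> {}"
    and m: "m \<in> {1..K}"
    and kh: "\<And>D. kh D \<in> {1..K}"
      "\<And>D. (\<Sum>i\<in>J. huber c (snd (D i) - t (kh D) (fst (D i)))) \<le> (\<Sum>i\<in>J. huber c (snd (D i) - t m (fst (D i))))"
    and \<Delta>: "\<And>k. k \<in> {1..K} \<Longrightarrow> expectation (\<lambda>z. \<bar>t k (fst z) - t m (fst z)\<bar>) \<le> \<Delta>"
  shows "(\<integral>\<^sup>+D. ennreal ((1 - \<epsilon>) * expectation (loss_diff (t (kh D)) s)) \<partial>(\<Pi>\<^sub>M i\<in>J. P))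
    \<le> ennreal ((1 + \<epsilon>) * expectation (loss_diff (t m) s) + 54 * c\<^sup>2 * y / (\<epsilon> * \<eta>)
        + c * \<Delta> * (real K * exp (- real (card J) * y)))"
proof -
  define l where "l = (\<lambda>k. expectation (loss_diff (t k) s))"
  define R where "R = 54 * c\<^sup>2 * y / (\<epsilon> * \<eta>)"
  have R: "0 \<le> R" using y \<epsilon> \<eta> by (simp add: R_def)
  have tm: "t k \<in> borel_measurable (Rd d)" and ti: "integrable P (\<lambda>z. t k (fst z))" if "k \<in> {1..K}" for k
    using t[OF that] by auto
  have l0: "0 \<le> l k" if "k \<in> {1..K}" for k
  proof -
    have "0 \<le> \<eta> * expectation (\<lambda>z. huber (c / 2) (t k (fst z) - s (fst z)))"
      using c \<eta> by (intro mult_nonneg_nonneg Bochner_Integration.integral_nonneg huber_nonneg) auto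
    then show ?thesis unfolding l_def 
      using expectation_loss_diff_ge[OF tm[OF that]] ti[OF that] s by fastforce
  qed
  define f where "f = (\<lambda>k. loss_diff (t k) (t m))"
  have fi: "integrable P (f k)" if "k \<in> {1..K}" for k
    unfolding f_def using tm ti that m by (intro loss_diff_integrable) auto
  have lf: "l k - l m = expectation (f k)" if k: "k \<in> {1..K}" for k
  proof -
    have "l k - l m = expectation (\<lambda>z. loss_diff (t k) s z - loss_diff (t m) s z)"
      unfolding l_def using tm ti k m s
      by (intro Bochner_Integration.integral_diff[symmetric] loss_diff_integrable) auto
    then show ?thesis by (simp add: f_def loss_diff_def)
  qed
  have lip: "l k \<le> l m + c * \<Delta>" if k: "k \<in> {1..K}" for k
  proof -
    have "expectation (f k) \<le> expectation (\<lambda>z. c * \<bar>t k (fst z) - t m (fst z)\<bar>)"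
      using fi[OF k] ti k m abs_loss_diff_le[of "t k" "t m"]
      by (intro integral_mono) (auto simp: f_def abs_le_iff)
    also have "\<dots> \<le> c * \<Delta>" using \<Delta>[OF k] c by (simp add: mult_left_mono)
    finally show ?thesis using lf[OF k] by simp
  qed
  have "0 \<le> expectation (\<lambda>z. \<bar>t m (fst z) - t m (fst z)\<bar>)" by simp
  then have \<Delta>0: "0 \<le> \<Delta>" using \<Delta>[OF m] by linarith
  define r where "r = (\<lambda>k. \<epsilon> * (l k + l m) + R)"
  \<comment> \<open>The bad event for k: the empirical loss difference falls below its mean by more
    than r k.\<close>
  define B where "B = (\<lambda>k. {D. (1 / card J) * (\<Sum>i\<in>J. f k (D i)) < expectation (f k) - r k})"
  have prob: "(\<integral>\<^sup>+D. indicator (B k) D \<partial>(\<Pi>\<^sub>M i\<in>J. P)) \<le> ennreal (exp (- real (card J) * y))" if k: "k \<in> {1..K}" for k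
  proof -
    have "\<exists>\<beta>\<ge>0. integrable P (\<lambda>z. (f k z)\<^sup>2 * exp (\<beta> * \<bar>f k z\<bar>)) \<and>
       y \<le> \<beta> * r k - \<beta>\<^sup>2 / 2 * expectation (\<lambda>z. (f k z)\<^sup>2 * exp (\<beta> * \<bar>f k z\<bar>))"
      unfolding f_def by (rule exists_deviation_parameter[OF _ _ _ _ _ _ s \<epsilon> y])
        (use t[OF k] t[OF m] in \<open>auto simp: r_def l_def R_def\<close>)
    then obtain \<beta> where "0 \<le> \<beta>" "integrable P (\<lambda>z. (f k z)\<^sup>2 * exp (\<beta> * \<bar>f k z\<bar>))"
       "y \<le> \<beta> * r k - \<beta>\<^sup>2 / 2 * expectation (\<lambda>z. (f k z)\<^sup>2 * exp (\<beta> * \<bar>f k z\<bar>))" by blast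
    then show ?thesis unfolding B_def by (intro empirical_mean_deviation fi k J) auto
  qed
  have Bm [measurable]: "(indicator (B k) :: dataset \<Rightarrow> ennreal) \<in> borel_measurable (\<Pi>\<^sub>M i\<in>J. P)" if k: "k \<in> {1..K}" for k
  proof -
    have [measurable]: "f k \<in> borel_measurable P" using fi[OF k] by auto
    have "indicator (B k) = (\<lambda>D. if (1 / card J) * (\<Sum>i\<in>J. f k (D i)) < expectation (f k) - r k then 1 else 0 :: ennreal)"
      by (auto simp: B_def fun_eq_iff indicator_def)
    then show ?thesis by simp
  qed
  have "(\<integral>\<^sup>+D. ennreal ((1 - \<epsilon>) * l (kh D)) \<partial>(\<Pi>\<^sub>M i\<in>J. P))
     \<le> (\<integral>\<^sup>+D. ennreal ((1 + \<epsilon>) * l m + R) + ennreal (c * \<Delta>) * (\<Sum>k\<in>{1..K}. indicator (B k) D) \<partial>(\<Pi>\<^sub>M i\<in>J. P))"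
  proof (rule nn_integral_mono)
    fix D
    let ?k = "kh D"
    have k: "?k \<in> {1..K}" by (rule kh(1))
    show "ennreal ((1 - \<epsilon>) * l ?k) \<le> ennreal ((1 + \<epsilon>) * l m + R) + ennreal (c * \<Delta>) * (\<Sum>k\<in>{1..K}. indicator (B k) D)"
    proof (cases "D \<in> B ?k")
      case True
      have "(1 - \<epsilon>) * l ?k \<le> (1 + \<epsilon>) * l m + R + c * \<Delta>"
      proof -
        have "(1 - \<epsilon>) * l ?k \<le> 1 * l ?k" using \<epsilon> l0[OF k] by (intro mult_right_mono) auto
        moreover have "1 * l m \<le> (1 + \<epsilon>) * l m" using \<epsilon> l0[OF m] by (intro mult_right_mono) auto
        ultimately show ?thesis using lip[OF k] R by linarith
      qed
      then have "ennreal ((1 - \<epsilon>) * l ?k) \<le> ennreal ((1 + \<epsilon>) * l m + R + c * \<Delta>)" by (rule ennreal_leI)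
      also have "\<dots> = ennreal ((1 + \<epsilon>) * l m + R) + ennreal (c * \<Delta>)"
        using \<epsilon> l0[OF m] R c \<Delta>0 by (intro ennreal_plus) auto
      also have "\<dots> \<le> ennreal ((1 + \<epsilon>) * l m + R) + ennreal (c * \<Delta>) * (\<Sum>k\<in>{1..K}. indicator (B k) D)"
      proof (intro add_left_mono)
        have "(1 :: ennreal) = indicator (B ?k) D" using True by simp
        also have "\<dots> \<le> (\<Sum>k\<in>{1..K}. indicator (B k) D)" by (rule member_le_sum[OF k]) auto
        finally show "ennreal (c * \<Delta>) \<le> ennreal (c * \<Delta>) * (\<Sum>k\<in>{1..K}. indicator (B k) D)"
          using mult_left_mono[of 1 _ "ennreal (c * \<Delta>)"] by simp
      qed
      finally show ?thesis .
    next
      case False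
      \<comment> \<open>The selected index does at least as well as m on the sample, so off the bad
        event l k - l m \<le> \<epsilon> (l k + l m) + R; collecting terms produces the factors 1 -
        \<epsilon> and 1 + \<epsilon>.\<close>
      have "(\<Sum>i\<in>J. f ?k (D i)) \<le> 0"
        using kh(2)[of D] by (simp add: f_def loss_diff_def sum_subtractf)
      then have "(1 / card J) * (\<Sum>i\<in>J. f ?k (D i)) \<le> 0" by (intro mult_nonneg_nonpos) auto
      then have "expectation (f ?k) \<le> r ?k" using False by (simp add: B_def)
      then have "(1 - \<epsilon>) * l ?k \<le> (1 + \<epsilon>) * l m + R"
        using lf[OF k] by (simp add: r_def algebra_simps)
      then have "ennreal ((1 - \<epsilon>) * l ?k) \<le> ennreal ((1 + \<epsilon>) * l m + R)" by (rule ennreal_leI)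
      then show ?thesis by (rule order_trans) simp
    qed
  qed
  also have "\<dots> = ennreal ((1 + \<epsilon>) * l m + R) * emeasure (\<Pi>\<^sub>M i\<in>J. P) (space (\<Pi>\<^sub>M i\<in>J. P))
     + ennreal (c * \<Delta>) * (\<Sum>k\<in>{1..K}. \<integral>\<^sup>+D. indicator (B k) D \<partial>(\<Pi>\<^sub>M i\<in>J. P))"
  proof -
    have "(\<integral>\<^sup>+D. (\<Sum>k\<in>{1..K}. indicator (B k) D) \<partial>(\<Pi>\<^sub>M i\<in>J. P)) = (\<Sum>k\<in>{1..K}. \<integral>\<^sup>+D. indicator (B k) D \<partial>(\<Pi>\<^sub>M i\<in>J. P))"
      by (rule nn_integral_sum[OF Bm])
    moreover have "(\<lambda>D. \<Sum>k\<in>{1..K}. indicator (B k) D :: ennreal) \<in> borel_measurable (\<Pi>\<^sub>M i\<in>J. P)"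
      by (rule borel_measurable_sum[OF Bm])
    ultimately show ?thesis
      by (subst nn_integral_add) (auto simp: nn_integral_cmult simp del: nn_integral_indicator)
  qed
  also have "emeasure (\<Pi>\<^sub>M i\<in>J. P) (space (\<Pi>\<^sub>M i\<in>J. P)) = 1"
    by (rule prob_space.emeasure_space_1[OF prob_space_PiM]) (rule prob_space_axioms)
  also have "ennreal ((1 + \<epsilon>) * l m + R) * 1 + ennreal (c * \<Delta>) * (\<Sum>k\<in>{1..K}. \<integral>\<^sup>+D. indicator (B k) D \<partial>(\<Pi>\<^sub>M i\<in>J. P))
    \<le> ennreal ((1 + \<epsilon>) * l m + R) * 1 + ennreal (c * \<Delta>) * (\<Sum>k\<in>{1..K}. ennreal (exp (- real (card J) * y)))"
    using prob by (intro add_mono mult_left_mono sum_mono) auto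
  also have "(\<Sum>k\<in>{1..K}. ennreal (exp (- real (card J) * y))) = ennreal (real K * exp (- real (card J) * y))"
    by (simp add: ennreal_mult ennreal_of_nat_eq_real_of_nat)
  also have "ennreal ((1 + \<epsilon>) * l m + R) * 1 + ennreal (c * \<Delta>) * ennreal (real K * exp (- real (card J) * y))
     = ennreal ((1 + \<epsilon>) * l m + R + c * \<Delta> * (real K * exp (- real (card J) * y)))"
    using \<epsilon> l0[OF m] R c \<Delta>0 by (subst ennreal_plus) (auto simp: ennreal_mult)
  finally show ?thesis by (simp add: l_def R_def)
qed

lemma holdout_trivial_bound:
  assumes t: "\<And>k. k \<in> {1..K} \<Longrightarrow> t k = linpred d (q k) (\<theta> k) \<and> \<theta> k \<in> space (Rd d)"
    and s: "integrable P (\<lambda>z. s (fst z))"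
    and k: "k \<in> {1..K}" and m: "m \<in> {1..K}"
    and \<Delta>: "expectation (\<lambda>z. \<bar>t k (fst z) - t m (fst z)\<bar>) \<le> \<Delta>"
  shows "expectation (loss_diff (t k) s) \<le> expectation (loss_diff (t m) s) + c * \<Delta>"
proof -
  have tm: "t k \<in> borel_measurable (Rd d)" and ti: "integrable P (\<lambda>z. t k (fst z))" if "k \<in> {1..K}" for k
    using t[OF that] by auto
  have "expectation (loss_diff (t k) s) - expectation (loss_diff (t m) s)
     = expectation (\<lambda>z. loss_diff (t k) s z - loss_diff (t m) s z)"
    using tm ti k m s by (intro Bochner_Integration.integral_diff[symmetric] loss_diff_integrable) auto
  also have "\<dots> = expectation (loss_diff (t k) (t m))" by (simp add: loss_diff_def)
  also have "\<dots> \<le> expectation (\<lambda>z. c * \<bar>t k (fst z) - t m (fst z)\<bar>)"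
    using loss_diff_integrable[of "t k" "t m"] tm ti k m abs_loss_diff_le[of "t k" "t m"]
    by (intro integral_mono) (auto simp: abs_le_iff)
  also have "\<dots> \<le> c * \<Delta>" using \<Delta> c by (simp add: mult_left_mono)
  finally show ?thesis by simp
qed

section \<open>The distance between the predictors\<close>

text \<open>In the variable q + \<mu>, the prediction at the empirical mean, the intercept rule
  selects the minimiser of least absolute value for the responses corrected by the empirically
  centered form. These corrections are at most 2M for each coefficient vector, so the stability
  lemma moves the value by at most 4M. Replacing each empirical mean by the true one costs another
  M, giving 6M; the centered forms contribute 2W.\<close>

lemma L1_distance_linpred_le:
  fixes D :: dataset
  assumes n: "1 \<le> n"
    and q: "is_arg_min (\<lambda>q. \<bar>q + dot d \<theta> (emp_mean_X n D)\<bar>) (is_arg_min (emp_risk d c n D \<theta>) (\<lambda>_. True)) q"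
    and q': "is_arg_min (\<lambda>q. \<bar>q + dot d \<theta>' (emp_mean_X n D)\<bar>) (is_arg_min (emp_risk d c n D \<theta>') (\<lambda>_. True)) q'"
    and m: "\<And>i. i \<in> {1..n} \<Longrightarrow> \<bar>centered \<theta> (D i)\<bar> \<le> M" "\<And>i. i \<in> {1..n} \<Longrightarrow> \<bar>centered \<theta>' (D i)\<bar> \<le> M"
    and w: "expectation (\<lambda>z. \<bar>centered \<theta> z\<bar>) \<le> W" "expectation (\<lambda>z. \<bar>centered \<theta>' z\<bar>) \<le> W"
  shows "expectation (\<lambda>z. \<bar>linpred d q \<theta> (fst z) - linpred d q' \<theta>' (fst z)\<bar>) \<le> 6 * M + 2 * W"
proof -
  define \<mu> where "\<mu> = (\<lambda>\<theta>. dot d \<theta> (emp_mean_X n D))"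
  define \<delta> where "\<delta> = (\<lambda>\<theta> i. dot d \<theta> (fst (D i)) - \<mu> \<theta>)"
  define v where "v = (\<lambda>\<theta> i. snd (D i) - \<delta> \<theta> i)"
  have card: "finite {1..n}" "{1..n} \<noteq> {}" using n by auto
  have mean: "\<mu> \<theta> - dot d \<theta> (mean_X d P) = (1 / real n) * (\<Sum>i\<in>{1..n}. centered \<theta> (D i))" for \<theta>
  proof -
    have "\<mu> \<theta> = (\<Sum>j\<in>{1..d}. (\<Sum>i\<in>{1..n}. (1 / real n) * (\<theta> j * fst (D i) j)))"
      by (simp add: \<mu>_def dot_def emp_mean_X_def sum_distrib_left ac_simps)
    also have "\<dots> = (\<Sum>i\<in>{1..n}. (1 / real n) * dot d \<theta> (fst (D i)))"
      by (subst sum.swap) (simp add: dot_def sum_distrib_left)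
    also have "\<dots> = (1 / real n) * (\<Sum>i\<in>{1..n}. dot d \<theta> (fst (D i)))" by (simp add: sum_distrib_left)
    finally show ?thesis using n by (simp add: centered_eq sum_subtractf field_simps)
  qed
  have mean_le: "\<bar>\<mu> \<theta> - dot d \<theta> (mean_X d P)\<bar> \<le> M" if "\<And>i. i \<in> {1..n} \<Longrightarrow> \<bar>centered \<theta> (D i)\<bar> \<le> M" for \<theta>
  proof -
    have "\<bar>\<Sum>i\<in>{1..n}. centered \<theta> (D i)\<bar> \<le> (\<Sum>i\<in>{1..n}. \<bar>centered \<theta> (D i)\<bar>)" by (rule sum_abs)
    also have "\<dots> \<le> real (card {1..n}) * M" by (rule sum_bounded_above) (rule that)
    finally have "\<bar>\<Sum>i\<in>{1..n}. centered \<theta> (D i)\<bar> \<le> real n * M" by simp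
    then show ?thesis using n unfolding mean by (simp add: abs_mult field_simps)
  qed
  have \<delta>_le: "\<bar>\<delta> \<theta> i\<bar> \<le> 2 * M" if "\<And>i. i \<in> {1..n} \<Longrightarrow> \<bar>centered \<theta> (D i)\<bar> \<le> M" "i \<in> {1..n}" for \<theta> i
  proof -
    have "\<delta> \<theta> i = centered \<theta> (D i) - (\<mu> \<theta> - dot d \<theta> (mean_X d P))" by (simp add: \<delta>_def centered_eq)
    then show ?thesis using mean_le[OF that(1)] that(1)[OF that(2)] by linarith
  qed
  have shift: "is_arg_min abs (is_arg_min (\<lambda>r. \<Sum>i\<in>{1..n}. huber c (v \<theta> i - r)) (\<lambda>_. True)) (q + \<mu> \<theta>)"
    if q: "is_arg_min (\<lambda>q. \<bar>q + dot d \<theta> (emp_mean_X n D)\<bar>) (is_arg_min (emp_risk d c n D \<theta>) (\<lambda>_. True)) q" for \<theta> q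
  proof -
    have e: "emp_risk d c n D \<theta> p = (1 / real n) * (\<Sum>i\<in>{1..n}. huber c (v \<theta> i - (p + \<mu> \<theta>)))" for p
      by (simp add: emp_risk_def v_def \<delta>_def algebra_simps)
    have "emp_risk d c n D \<theta> p \<le> emp_risk d c n D \<theta> p' \<longleftrightarrow>
       (\<Sum>i\<in>{1..n}. huber c (v \<theta> i - (p + \<mu> \<theta>))) \<le> (\<Sum>i\<in>{1..n}. huber c (v \<theta> i - (p' + \<mu> \<theta>)))" for p p'
      unfolding e using n by (simp add: field_simps)
    then have "is_arg_min (emp_risk d c n D \<theta>) (\<lambda>_. True) p \<longleftrightarrow>
       is_arg_min (\<lambda>r. \<Sum>i\<in>{1..n}. huber c (v \<theta> i - r)) (\<lambda>_. True) (p + \<mu> \<theta>)" for p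
      unfolding is_arg_min_linorder by (metis diff_add_cancel)
    then show ?thesis using q unfolding is_arg_min_linorder[of abs] is_arg_min_linorder[of "\<lambda>q. \<bar>q + _\<bar>"] \<mu>_def
      by (metis diff_add_cancel)
  qed
  have v: "\<bar>v \<theta> i - v \<theta>' i\<bar> \<le> 4 * M" "\<bar>v \<theta>' i - v \<theta> i\<bar> \<le> 4 * M" if "i \<in> {1..n}" for i
    using \<delta>_le[OF m(1) that] \<delta>_le[OF m(2) that] by (auto simp: v_def)
  have "q + \<mu> \<theta> \<le> q' + \<mu> \<theta>' + 4 * M" "q' + \<mu> \<theta>' \<le> q + \<mu> \<theta> + 4 * M"
    by (rule least_arg_min_huber_le[OF c card shift[OF q'] shift[OF q] v(2)], assumption)
      (rule least_arg_min_huber_le[OF c card shift[OF q] shift[OF q'] v(1)], assumption)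
  then have qq: "\<bar>(q + \<mu> \<theta>) - (q' + \<mu> \<theta>')\<bar> \<le> 4 * M" by linarith
  have "\<bar>linpred d q \<theta> (fst z) - linpred d q' \<theta>' (fst z)\<bar> \<le> 6 * M + (\<bar>centered \<theta> z\<bar> + \<bar>centered \<theta>' z\<bar>)" for z :: sample
  proof -
    have "linpred d q \<theta> (fst z) - linpred d q' \<theta>' (fst z) = ((q + \<mu> \<theta>) - (q' + \<mu> \<theta>'))
      - (\<mu> \<theta> - dot d \<theta> (mean_X d P)) + (\<mu> \<theta>' - dot d \<theta>' (mean_X d P)) + centered \<theta> z - centered \<theta>' z"
      by (simp add: linpred_def centered_eq)
    then show ?thesis using qq mean_le[of \<theta>, OF m(1)] mean_le[of \<theta>', OF m(2)] by linarith
  qed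
  then have "expectation (\<lambda>z. \<bar>linpred d q \<theta> (fst z) - linpred d q' \<theta>' (fst z)\<bar>)
    \<le> expectation (\<lambda>z. 6 * M + (\<bar>centered \<theta> z\<bar> + \<bar>centered \<theta>' z\<bar>))"
    by (intro integral_mono) auto
  also have "\<dots> = 6 * M + (expectation (\<lambda>z. \<bar>centered \<theta> z\<bar>) + expectation (\<lambda>z. \<bar>centered \<theta>' z\<bar>))"
    by (simp add: prob_space)
  finally show ?thesis using w by linarith
qed

end

section \<open>The hold-out trained on data\<close>

lemma sorted_list_of_set_nth_mem:
  assumes "finite T" "j \<in> {1..card T}" shows "sorted_list_of_set T ! (j - 1) \<in> T"
  using assms nth_mem[of "j - 1" "sorted_list_of_set T"] by auto

lemma subsample_merge:
  assumes "finite T"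
  shows "subsample (merge T J (x, y)) T = subsample x T"
  using sorted_list_of_set_nth_mem[OF assms] by (auto simp: subsample_def restrict_def merge_def fun_eq_iff)

lemma subsample_measurable:
  assumes "finite T" "T \<subseteq> I"
  shows "(\<lambda>D. subsample D T) \<in> (\<Pi>\<^sub>M i\<in>I. M) \<rightarrow>\<^sub>M (\<Pi>\<^sub>M i\<in>{1..card T}. M)"
  unfolding subsample_def
proof (rule measurable_restrict)
  fix j assume "j \<in> {1..card T}"
  then have "sorted_list_of_set T ! (j - 1) \<in> I" using sorted_list_of_set_nth_mem assms by blast
  then show "(\<lambda>D. D (sorted_list_of_set T ! (j - 1))) \<in> (\<Pi>\<^sub>M i\<in>I. M) \<rightarrow>\<^sub>M M" 
    by (rule measurable_component_singleton)
qed

text \<open>Renumbering is an injective reindexing of independent coordinates; hence the training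
  sample has the same law for every T of a given size.\<close>

lemma distr_subsample:
  assumes M: "prob_space M" and T: "finite T"
  shows "distr (\<Pi>\<^sub>M i\<in>T. M) (\<Pi>\<^sub>M i\<in>{1..card T}. M) (\<lambda>D. subsample D T) = (\<Pi>\<^sub>M i\<in>{1..card T}. M)"
  unfolding subsample_def
proof (rule distr_PiM_reindex[of T "\<lambda>_. M" "\<lambda>j. sorted_list_of_set T ! (j - 1)" "{1..card T}"])
  show "inj_on (\<lambda>j. sorted_list_of_set T ! (j - 1)) {1..card T}"
  proof (rule inj_onI)
    fix i j assume *: "i \<in> {1..card T}" "j \<in> {1..card T}"
      "sorted_list_of_set T ! (i - 1) = sorted_list_of_set T ! (j - 1)"
    then have "i - 1 = j - 1" using T by (subst (asm) nth_eq_iff_index_eq) auto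
    then show "i = j" using * by auto
  qed
  show "(\<lambda>j. sorted_list_of_set T ! (j - 1)) \<in> {1..card T} \<rightarrow> T"
    using sorted_list_of_set_nth_mem[OF T] by auto
qed (rule M)

section \<open>Measurability of the selected index\<close>

text \<open>The minimisers form a finite nonempty set, so \<open>Min\<close> is genuine and agrees
  with \<open>LEAST\<close>; the latter form is the one to which \<open>measurable_Least\<close>
  applies.\<close>

lemma holdout_index_least:
  assumes "1 \<le> K"
  shows "holdout_index d c qh th K n D T
      = (LEAST k. is_arg_min (holdout_risk d c qh th n D T) (\<lambda>k. k \<in> {1..K}) k)"
    and "is_arg_min (holdout_risk d c qh th n D T) (\<lambda>k. k \<in> {1..K}) (holdout_index d c qh th K n D T)"
proof -
  let ?P = "is_arg_min (holdout_risk d c qh th n D T) (\<lambda>k. k \<in> {1..K})"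
  have fin: "finite {k. ?P k}" by (rule finite_subset[of _ "{1..K}"]) (auto simp: is_arg_min_linorder)
  have "\<exists>k. ?P k" using ex_is_arg_min_if_finite[of "{1..K}" "holdout_risk d c qh th n D T"] assms by auto
  then show "holdout_index d c qh th K n D T = (LEAST k. ?P k)"
    unfolding holdout_index_def using fin by (intro Least_Min[symmetric])
  have "Min {k. ?P k} \<in> {k. ?P k}" using fin \<open>\<exists>k. ?P k\<close> by (intro Min_in) auto
  then show "?P (holdout_index d c qh th K n D T)" by (simp add: holdout_index_def)
qed

lemma pred_is_arg_min:
  fixes r :: "'a \<Rightarrow> 'i \<Rightarrow> real"
  assumes r: "\<And>k. k \<in> A \<Longrightarrow> (\<lambda>D. r D k) \<in> borel_measurable M" and A: "finite A"
  shows "Measurable.pred M (\<lambda>D. is_arg_min (r D) (\<lambda>k. k \<in> A) k)"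
proof (cases "k \<in> A")
  case True
  have "Measurable.pred M (\<lambda>D. \<forall>j\<in>A. r D k \<le> r D j)"
  proof (rule pred_intros_finite(3)[OF A])
    fix j assume "j \<in> A"
    then show "Measurable.pred M (\<lambda>D. r D k \<le> r D j)"
      unfolding pred_def by (intro borel_measurable_le r True)
  qed
  then show ?thesis using True by (simp add: is_arg_min_linorder Ball_def)
next
  case False
  then show ?thesis by (simp add: is_arg_min_linorder)
qed

locale linear_estimators = huber_linear_regression +
  fixes n nt :: nat and qh :: intercepts and th :: coefficients
  assumes K: "1 \<le> K" and nt: "1 \<le> nt" "nt < n"
    and qh_measurable: "\<And>k. k \<in> {1..K} \<Longrightarrow> qh k nt \<in> (\<Pi>\<^sub>M i\<in>{1..nt}. Rd d \<Otimes>\<^sub>M borel) \<rightarrow>\<^sub>M borel"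
    and th_measurable: "\<And>k. k \<in> {1..K} \<Longrightarrow> th k nt \<in> (\<Pi>\<^sub>M i\<in>{1..nt}. Rd d \<Otimes>\<^sub>M borel) \<rightarrow>\<^sub>M Rd d"
    and sparse: "AE D in (\<Pi>\<^sub>M i\<in>{1..nt}. P). \<forall>k\<in>{1..K}. l0 d (th k nt D) \<le> k"
    and intercept: "AE D in (\<Pi>\<^sub>M i\<in>{1..nt}. P). \<forall>k\<in>{1..K}.
         is_arg_min (\<lambda>q. \<bar>q + dot d (th k nt D) (emp_mean_X nt D)\<bar>)
                    (is_arg_min (emp_risk d c nt D (th k nt D)) (\<lambda>_. True))
                    (qh k nt D)"
begin

definition data :: "nat set \<Rightarrow> dataset measure" where
  "data I = (\<Pi>\<^sub>M i\<in>I. P)"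

lemma prob_space_data: "prob_space (data I)"
  unfolding data_def by (rule prob_space_PiM) (rule prob_space_axioms)

lemma sets_data: "sets (data I) = sets (\<Pi>\<^sub>M i\<in>I. Rd d \<Otimes>\<^sub>M borel)"
  unfolding data_def by (rule sets_PiM_cong) (auto simp: sets_P)

lemma qh_data [measurable]: "k \<in> {1..K} \<Longrightarrow> qh k nt \<in> borel_measurable (data {1..nt})"
  using qh_measurable by (simp cong: measurable_cong_sets add: sets_data)

lemma th_data [measurable]: "k \<in> {1..K} \<Longrightarrow> th k nt \<in> data {1..nt} \<rightarrow>\<^sub>M Rd d"
  using th_measurable by (simp cong: measurable_cong_sets add: sets_data)

lemma component_data: "i \<in> I \<Longrightarrow> (\<lambda>D. D i) \<in> data I \<rightarrow>\<^sub>M P"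
  unfolding data_def by (rule measurable_component_singleton)

lemma fst_data: "i \<in> I \<Longrightarrow> (\<lambda>D. fst (D i)) \<in> data I \<rightarrow>\<^sub>M Rd d"
  using component_data by (rule measurable_compose) measurable

lemma snd_data: "i \<in> I \<Longrightarrow> (\<lambda>D. snd (D i)) \<in> borel_measurable (data I)"
  using component_data by (rule measurable_compose) measurable

lemma K_nonempty: "{1..K} \<noteq> {}" "finite {1..K}"
  using K by auto

lemma nt_nonempty: "{1..nt} \<noteq> {}" "finite {1..nt}"
  using nt by auto

definition est :: "nat \<Rightarrow> dataset \<Rightarrow> predictor" where
  "est k D = linpred d (qh k nt D) (th k nt D)"

definition risk :: "nat \<Rightarrow> dataset \<Rightarrow> real" where
  "risk k D = expectation (loss_diff (est k D) s)"

definition min_risk :: "dataset \<Rightarrow> real" where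
  "min_risk D = (MIN k\<in>{1..K}. risk k D)"

definition max_dev :: "dataset \<Rightarrow> real" where
  "max_dev D = (MAX k\<in>{1..K}. MAX i\<in>{1..nt}. \<bar>centered (th k nt D) (D i)\<bar>)"

definition max_mean_dev :: "dataset \<Rightarrow> real" where
  "max_mean_dev D = (MAX k\<in>{1..K}. expectation (\<lambda>z. \<bar>centered (th k nt D) z\<bar>))"

lemma th_space: "k \<in> {1..K} \<Longrightarrow> D \<in> space (data {1..nt}) \<Longrightarrow> th k nt D \<in> space (Rd d)"
  using th_data by (rule measurable_space)

lemma est_measurable: "k \<in> {1..K} \<Longrightarrow> D \<in> space (data {1..nt}) \<Longrightarrow> est k D \<in> borel_measurable (Rd d)"
  unfolding est_def using th_space by (rule linpred_measurable)

lemma est_integrable: "integrable P (\<lambda>z. est k D (fst z))"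
  by (simp add: est_def)

lemma risk_measurable [measurable]:
  assumes k: "k \<in> {1..K}" shows "risk k \<in> borel_measurable (data {1..nt})"
proof -
  note [measurable] = qh_data[OF k] th_data[OF k]
  have "(\<lambda>D. \<integral>z. huber c (snd z - (qh k nt D + dot d (th k nt D) (fst z))) - huber c (snd z - s (fst z)) \<partial>P)
     \<in> borel_measurable (data {1..nt})" by measurable
  then show ?thesis by (simp add: risk_def[abs_def] loss_diff_def est_def linpred_def)
qed

lemma min_risk_measurable [measurable]: "min_risk \<in> borel_measurable (data {1..nt})"
  unfolding min_risk_def[abs_def] by (intro borel_measurable_Min K_nonempty risk_measurable)

lemma mean_X_space: "mean_X d P \<in> space (Rd d)"
  by (simp add: mean_X_def Rd_def space_PiM)

lemma max_dev_measurable [measurable]: "max_dev \<in> borel_measurable (data {1..nt})"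
  unfolding max_dev_def[abs_def]
proof (intro borel_measurable_Max K_nonempty nt_nonempty)
  fix k i assume k: "k \<in> {1..K}" and i: "i \<in> {1..nt}"
  note [measurable] = th_data[OF k] fst_data[OF i] measurable_const[OF mean_X_space]
  show "(\<lambda>D. \<bar>centered (th k nt D) (D i)\<bar>) \<in> borel_measurable (data {1..nt})"
    unfolding centered_eq by measurable
qed

lemma max_mean_dev_measurable [measurable]: "max_mean_dev \<in> borel_measurable (data {1..nt})"
  unfolding max_mean_dev_def[abs_def]
proof (intro borel_measurable_Max K_nonempty)
  fix k assume k: "k \<in> {1..K}"
  note [measurable] = th_data[OF k] measurable_const[OF mean_X_space]
  show "(\<lambda>D. expectation (\<lambda>z. \<bar>centered (th k nt D) z\<bar>)) \<in> borel_measurable (data {1..nt})"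
    unfolding centered_eq by measurable
qed

lemma max_dev_ge: "k \<in> {1..K} \<Longrightarrow> i \<in> {1..nt} \<Longrightarrow> \<bar>centered (th k nt D) (D i)\<bar> \<le> max_dev D"
proof -
  assume k: "k \<in> {1..K}" and i: "i \<in> {1..nt}"
  have "\<bar>centered (th k nt D) (D i)\<bar> \<le> (MAX i\<in>{1..nt}. \<bar>centered (th k nt D) (D i)\<bar>)"
    using i by (intro Max_ge) auto
  also have "\<dots> \<le> max_dev D" unfolding max_dev_def using k by (intro Max_ge) auto
  finally show ?thesis .
qed

lemma max_mean_dev_ge: "k \<in> {1..K} \<Longrightarrow> expectation (\<lambda>z. \<bar>centered (th k nt D) z\<bar>) \<le> max_mean_dev D"
  unfolding max_mean_dev_def by (intro Max_ge) auto

lemma max_dev_nonneg: "0 \<le> max_dev D"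
  using max_dev_ge[of 1 1 D] K nt by fastforce

lemma max_mean_dev_nonneg: "0 \<le> max_mean_dev D"
proof -
  have "0 \<le> expectation (\<lambda>z. \<bar>centered (th 1 nt D) z\<bar>)" by simp
  also have "\<dots> \<le> max_mean_dev D" using K by (intro max_mean_dev_ge) auto
  finally show ?thesis .
qed

lemma risk_nonneg:
  assumes s: "integrable P (\<lambda>z. s (fst z))" and k: "k \<in> {1..K}" and D: "D \<in> space (data {1..nt})"
  shows "0 \<le> risk k D"
proof -
  have "0 \<le> \<eta> * expectation (\<lambda>z. huber (c / 2) (est k D (fst z) - s (fst z)))"
    using c \<eta> by (intro mult_nonneg_nonneg Bochner_Integration.integral_nonneg huber_nonneg) auto
  also have "\<dots> \<le> risk k D"
    unfolding risk_def using est_measurable[OF k D] s est_integrable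
    by (intro expectation_loss_diff_ge) auto
  finally show ?thesis .
qed

text \<open>E bounds the conditional probability that the hold-out is worse than the oracle inequality
  says; the value 1 means that no concentration is used.\<close>

lemma conditional_holdout_bound:
  fixes y :: real and J :: "nat set"
  assumes s: "integrable P (\<lambda>z. s (fst z))"
    and \<epsilon>: "0 < \<epsilon>" "\<epsilon> < 1"
    and y: "0 \<le> y"
    and E: "E = 1 \<or> 20000\<^sup>2 * (\<kappa> * ln \<kappa>)\<^sup>2 * y \<le> (\<epsilon> * \<eta>)\<^sup>2 \<and> E = real K * exp (- real (card J) * y)"
    and J: "finite J" "J \<noteq> {}"
    and D: "D \<in> space (data {1..nt})" "\<forall>k\<in>{1..K}. l0 d (th k nt D) \<le> k"
      "\<forall>k\<in>{1..K}. is_arg_min (\<lambda>q. \<bar>q + dot d (th k nt D) (emp_mean_X nt D)\<bar>)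
                    (is_arg_min (emp_risk d c nt D (th k nt D)) (\<lambda>_. True)) (qh k nt D)"
    and kh: "\<And>D'. kh D' \<in> {1..K}"
      "\<And>D'. (\<Sum>i\<in>J. huber c (snd (D' i) - est (kh D') D (fst (D' i))))
        \<le> Min ((\<lambda>k. \<Sum>i\<in>J. huber c (snd (D' i) - est k D (fst (D' i)))) ` {1..K})"
  shows "(\<integral>\<^sup>+D'. ennreal ((1 - \<epsilon>) * risk (kh D') D) \<partial>data J)
    \<le> ennreal ((1 + \<epsilon>) * min_risk D + 54 * c\<^sup>2 * y / (\<epsilon> * \<eta>)
        + c * (6 * max_dev D + 2 * max_mean_dev D) * E)"
proof -
  define \<Delta> where "\<Delta> = 6 * max_dev D + 2 * max_mean_dev D"
  have \<Delta>: "expectation (\<lambda>z. \<bar>est k D (fst z) - est m D (fst z)\<bar>) \<le> \<Delta>" if "k \<in> {1..K}" "m \<in> {1..K}" for k m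
    unfolding \<Delta>_def est_def using that D nt
    by (intro L1_distance_linpred_le[of nt _ D] max_dev_ge max_mean_dev_ge) auto
  \<comment> \<open>The oracle m depends on the training data D only; given D it is a fixed index,
    as the oracle inequality for fixed predictors demands.\<close>
  have "Min ((\<lambda>k. risk k D) ` {1..K}) \<in> (\<lambda>k. risk k D) ` {1..K}" using K by (intro Min_in) auto
  then obtain m where m: "m \<in> {1..K}" "min_risk D = risk m D" by (auto simp: min_risk_def)
  have t: "est k D = linpred d (qh k nt D) (th k nt D) \<and> th k nt D \<in> space (Rd d) \<and> l0 d (th k nt D) \<le> K"
    if "k \<in> {1..K}" for k
    using that D(2) th_space[OF that D(1)] by (auto simp: est_def intro: order_trans)
  show ?thesis
  proof (cases "E = 1")
    case False
    then have y2: "20000\<^sup>2 * (\<kappa> * ln \<kappa>)\<^sup>2 * y \<le> (\<epsilon> * \<eta>)\<^sup>2" and E: "E = real K * exp (- real (card J) * y)"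
      using E by auto
    have "(\<integral>\<^sup>+D'. ennreal ((1 - \<epsilon>) * expectation (loss_diff (est (kh D') D) s)) \<partial>(\<Pi>\<^sub>M i\<in>J. P))
      \<le> ennreal ((1 + \<epsilon>) * expectation (loss_diff (est m D) s) + 54 * c\<^sup>2 * y / (\<epsilon> * \<eta>)
          + c * \<Delta> * (real K * exp (- real (card J) * y)))"
    proof (rule holdout_oracle_inequality[of "\<lambda>k. est k D" "\<lambda>k. qh k nt D" "\<lambda>k. th k nt D", OF t s \<epsilon> y y2 J m(1) kh(1)])
      fix D'
      have "Min ((\<lambda>k. \<Sum>i\<in>J. huber c (snd (D' i) - est k D (fst (D' i)))) ` {1..K})
         \<le> (\<Sum>i\<in>J. huber c (snd (D' i) - est m D (fst (D' i))))" using m by (intro Min_le) auto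
      then show "(\<Sum>i\<in>J. huber c (snd (D' i) - est (kh D') D (fst (D' i))))
         \<le> (\<Sum>i\<in>J. huber c (snd (D' i) - est m D (fst (D' i))))" using kh(2)[of D'] by linarith
    qed (use \<Delta> m in auto)
    then show ?thesis by (simp add: E \<Delta>_def data_def risk_def m(2))
  next
    case True
    have "(1 - \<epsilon>) * risk k D \<le> (1 + \<epsilon>) * min_risk D + 54 * c\<^sup>2 * y / (\<epsilon> * \<eta>) + c * \<Delta> * E" if k: "k \<in> {1..K}" for k
    proof -
      have "(1 - \<epsilon>) * risk k D \<le> 1 * risk k D"
        using \<epsilon> risk_nonneg[OF s k D(1)] by (intro mult_right_mono) auto
      also have "1 * risk k D \<le> risk m D + c * \<Delta>"
        unfolding risk_def mult_1
        by (rule holdout_trivial_bound[of "\<lambda>k. est k D" "\<lambda>k. qh k nt D" "\<lambda>k. th k nt D"]) (use t s k m \<Delta> in auto)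
      also have "1 * risk m D \<le> (1 + \<epsilon>) * risk m D"
        using \<epsilon> risk_nonneg[OF s m(1) D(1)] by (intro mult_right_mono) auto
      then have "risk m D + c * \<Delta> \<le> (1 + \<epsilon>) * min_risk D + c * \<Delta>" using m(2) by simp
      also have "\<dots> \<le> (1 + \<epsilon>) * min_risk D + 54 * c\<^sup>2 * y / (\<epsilon> * \<eta>) + c * \<Delta> * E"
        using y \<epsilon> \<eta> True by simp
      finally show ?thesis .
    qed
    then have "(\<integral>\<^sup>+D'. ennreal ((1 - \<epsilon>) * risk (kh D') D) \<partial>data J)
      \<le> (\<integral>\<^sup>+D'. ennreal ((1 + \<epsilon>) * min_risk D + 54 * c\<^sup>2 * y / (\<epsilon> * \<eta>) + c * \<Delta> * E) \<partial>data J)"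
      using kh(1) by (intro nn_integral_mono ennreal_leI) auto
    also have "\<dots> = ennreal ((1 + \<epsilon>) * min_risk D + 54 * c\<^sup>2 * y / (\<epsilon> * \<eta>) + c * \<Delta> * E)"
      using prob_space.emeasure_space_1[OF prob_space_data] by simp
    finally show ?thesis by (simp add: \<Delta>_def)
  qed
qed

section \<open>Integration over a training set T and its complement\<close>

context
  fixes T :: "nat set"
  assumes T: "T \<subseteq> {1..n}" "card T = nt"
begin

abbreviation khat :: "dataset \<Rightarrow> nat" where
  "khat D \<equiv> holdout_index d c qh th K n D T"

lemma finite_T: "finite T"
  using T finite_subset by blast

lemma trained_eq: "trained d qh th D T k = est k (subsample D T)"
  by (simp add: trained_def est_def T)

lemma holdout_eq: "holdout d c qh th K n D T = est (khat D) (subsample D T)"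
  by (simp add: holdout_def trained_eq)

lemma khat_in: "khat D \<in> {1..K}"
  using holdout_index_least(2)[OF K] by (simp add: is_arg_min_linorder)

lemma subsample_data [measurable]: "(\<lambda>D. subsample D T) \<in> data {1..n} \<rightarrow>\<^sub>M data {1..nt}"
  unfolding data_def using subsample_measurable[OF finite_T T(1)] by (simp add: T)

lemma subsample_space: "D \<in> space (data {1..n}) \<Longrightarrow> subsample D T \<in> space (data {1..nt})"
  using subsample_data by (rule measurable_space)

lemma khat_measurable: "khat \<in> data {1..n} \<rightarrow>\<^sub>M count_space {1..K}"
proof -
  have risk_m [measurable]: "(\<lambda>D. holdout_risk d c qh th n D T k) \<in> borel_measurable (data {1..n})" if k: "k \<in> {1..K}" for k
    unfolding holdout_risk_def trained_eq est_def linpred_def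
  proof (intro borel_measurable_times borel_measurable_const borel_measurable_sum)
    fix i assume "i \<in> {1..n} - T"
    then have i: "i \<in> {1..n}" by simp
    note [measurable] = measurable_compose[OF subsample_data qh_data[OF k]]
      measurable_compose[OF subsample_data th_data[OF k]] fst_data[OF i] snd_data[OF i]
    show "(\<lambda>D. huber c (snd (D i) - (qh k nt (subsample D T) + dot d (th k nt (subsample D T)) (fst (D i)))))
      \<in> borel_measurable (data {1..n})" by measurable
  qed
  have "Measurable.pred (data {1..n}) (\<lambda>D. is_arg_min (holdout_risk d c qh th n D T) (\<lambda>k. k \<in> {1..K}) k)" for k
    by (rule pred_is_arg_min[where r = "\<lambda>D. holdout_risk d c qh th n D T", OF risk_m]) simp_all
  then have "khat \<in> data {1..n} \<rightarrow>\<^sub>M count_space UNIV"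
    unfolding holdout_index_least(1)[OF K] by (rule measurable_Least)
  then show ?thesis using khat_in by (auto simp: measurable_def)
qed

lemma holdout_risk_measurable:
  "(\<lambda>D. expectation (loss_diff (holdout d c qh th K n D T) s)) \<in> borel_measurable (data {1..n})"
proof -
  have "(\<lambda>D. risk (khat D) (subsample D T)) \<in> borel_measurable (data {1..n})"
  proof (rule measurable_compose_countable'[where f = "\<lambda>k D. risk k (subsample D T)" and g = khat and I = "{1..K}"])
    fix k assume "k \<in> {1..K}"
    then show "(\<lambda>D. risk k (subsample D T)) \<in> borel_measurable (data {1..n})"
      by (intro measurable_compose[OF subsample_data] risk_measurable)
  qed (rule khat_measurable, simp)
  moreover have "expectation (loss_diff (holdout d c qh th K n D T) s) = risk (khat D) (subsample D T)" for D
    by (subst holdout_eq) (rule risk_def[symmetric])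
  ultimately show ?thesis by (simp only:)
qed

text \<open>Fubini over T and its complement: with the training part frozen the estimators are fixed
  predictors and the conditional bound applies. That bound depends on the training part only through
  its renumbering, whose law is that of a sample of size nt.\<close>

lemma holdout_bound:
  fixes y :: real
  assumes s: "integrable P (\<lambda>z. s (fst z))"
    and \<epsilon>: "0 < \<epsilon>" "\<epsilon> < 1"
    and y: "0 \<le> y"
    and E: "E = 1 \<or> 20000\<^sup>2 * (\<kappa> * ln \<kappa>)\<^sup>2 * y \<le> (\<epsilon> * \<eta>)\<^sup>2 \<and> E = real K * exp (- real (n - nt) * y)"
  shows "(\<integral>\<^sup>+D. ennreal ((1 - \<epsilon>) * expectation (loss_diff (holdout d c qh th K n D T) s)) \<partial>data {1..n})
    \<le> (\<integral>\<^sup>+D. ennreal ((1 + \<epsilon>) * min_risk D + 54 * c\<^sup>2 * y / (\<epsilon> * \<eta>)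
        + c * (6 * max_dev D + 2 * max_mean_dev D) * E) \<partial>data {1..nt})"
proof -
  interpret product_sigma_finite "\<lambda>_. P" ..
  define J where "J = {1..n} - T"
  have J: "finite J" "T \<inter> J = {}" "T \<union> J = {1..n}" using T by (auto simp: J_def)
  have cJ: "card J = n - nt" unfolding J_def using T finite_T by (simp add: card_Diff_subset)
  then have J0: "J \<noteq> {}" using nt by auto
  define F where "F = (\<lambda>D. ennreal ((1 - \<epsilon>) * expectation (loss_diff (holdout d c qh th K n D T) s)))"
  have F: "F \<in> borel_measurable (\<Pi>\<^sub>M i\<in>T \<union> J. P)"
    unfolding F_def J(3) using holdout_risk_measurable unfolding data_def by measurable
  define G where "G = (\<lambda>D. ennreal ((1 + \<epsilon>) * min_risk D + 54 * c\<^sup>2 * y / (\<epsilon> * \<eta>)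
        + c * (6 * max_dev D + 2 * max_mean_dev D) * E))"
  have G [measurable]: "G \<in> borel_measurable (data {1..nt})" unfolding G_def by measurable
  define g where "g = (\<lambda>D. subsample D T)"
  have gm: "g \<in> data T \<rightarrow>\<^sub>M data {1..nt}"
    unfolding g_def data_def using subsample_measurable[OF finite_T order_refl] by (simp add: T)
  have distr: "distr (data T) (data {1..nt}) g = data {1..nt}"
    unfolding g_def data_def using distr_subsample[OF prob_space_axioms finite_T] by (simp add: T)
  have "(\<integral>\<^sup>+D. F D \<partial>data {1..n}) = (\<integral>\<^sup>+D. (\<integral>\<^sup>+D'. F (merge T J (D, D')) \<partial>data J) \<partial>data T)"
    unfolding data_def J(3)[symmetric] by (rule product_nn_integral_fold[OF J(2) finite_T J(1) F])
  also have "\<dots> \<le> (\<integral>\<^sup>+D. G (g D) \<partial>data T)"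
  proof (rule nn_integral_mono_AE)
    have "AE D in data {1..nt}. D \<in> space (data {1..nt}) \<and> (\<forall>k\<in>{1..K}. l0 d (th k nt D) \<le> k) \<and>
      (\<forall>k\<in>{1..K}. is_arg_min (\<lambda>q. \<bar>q + dot d (th k nt D) (emp_mean_X nt D)\<bar>)
                    (is_arg_min (emp_risk d c nt D (th k nt D)) (\<lambda>_. True)) (qh k nt D))"
      using sparse intercept AE_space unfolding data_def by eventually_elim blast
    \<comment> \<open>The almost sure properties are assumed for samples indexed by {1..nt}; they
      are pulled back to T along the renumbering g.\<close>
    then have "AE D in data T. g D \<in> space (data {1..nt}) \<and> (\<forall>k\<in>{1..K}. l0 d (th k nt (g D)) \<le> k) \<and>
      (\<forall>k\<in>{1..K}. is_arg_min (\<lambda>q. \<bar>q + dot d (th k nt (g D)) (emp_mean_X nt (g D))\<bar>)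
                    (is_arg_min (emp_risk d c nt (g D) (th k nt (g D))) (\<lambda>_. True)) (qh k nt (g D)))"
      using AE_distrD[OF gm] unfolding distr by blast
    then show "AE D in data T. (\<integral>\<^sup>+D'. F (merge T J (D, D')) \<partial>data J) \<le> G (g D)"
    proof eventually_elim
      case (elim D)
      define kh where "kh = (\<lambda>D'. khat (merge T J (D, D')))"
      have F: "F (merge T J (D, D')) = ennreal ((1 - \<epsilon>) * risk (kh D') (g D))" for D'
        by (simp add: F_def holdout_eq risk_def kh_def g_def subsample_merge[OF finite_T])
      show ?case
        unfolding F G_def
      proof (rule conditional_holdout_bound[OF s \<epsilon> y _ J(1) J0])
        show "E = 1 \<or> 20000\<^sup>2 * (\<kappa> * ln \<kappa>)\<^sup>2 * y \<le> (\<epsilon> * \<eta>)\<^sup>2 \<and> E = real K * exp (- real (card J) * y)"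
          using E by (simp add: cJ)
        show "kh D' \<in> {1..K}" for D' unfolding kh_def by (rule khat_in)
        show "(\<Sum>i\<in>J. huber c (snd (D' i) - est (kh D') (g D) (fst (D' i))))
          \<le> Min ((\<lambda>k. \<Sum>i\<in>J. huber c (snd (D' i) - est k (g D) (fst (D' i)))) ` {1..K})" for D'
        proof (rule Min.boundedI)
          fix a assume "a \<in> (\<lambda>k. \<Sum>i\<in>J. huber c (snd (D' i) - est k (g D) (fst (D' i)))) ` {1..K}"
          then obtain k where k: "k \<in> {1..K}" and a: "a = (\<Sum>i\<in>J. huber c (snd (D' i) - est k (g D) (fst (D' i))))"
            by auto
          have hr: "holdout_risk d c qh th n (merge T J (D, D')) T k
             = (1 / real (card J)) * (\<Sum>i\<in>J. huber c (snd (D' i) - est k (g D) (fst (D' i))))" for k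
          proof -
            have "merge T J (D, D') i = D' i" if "i \<in> J" for i using that J by (auto simp: merge_def)
            then show ?thesis
              unfolding holdout_risk_def trained_eq subsample_merge[OF finite_T] g_def J_def[symmetric]
              by (intro arg_cong[where f = "\<lambda>a. 1 / real (card J) * a"] sum.cong refl) simp
          qed
          have "holdout_risk d c qh th n (merge T J (D, D')) T (kh D') \<le> holdout_risk d c qh th n (merge T J (D, D')) T k"
            using holdout_index_least(2)[OF K, of d c qh th n "merge T J (D, D')" T] k
            by (auto simp: is_arg_min_linorder kh_def)
          moreover have "0 < real (card J)" using J J0 by (simp add: card_gt_0_iff)
          ultimately show "(\<Sum>i\<in>J. huber c (snd (D' i) - est (kh D') (g D) (fst (D' i)))) \<le> a"
            unfolding hr a by (simp add: divide_le_cancel)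
        qed (use K in auto)
      qed (use elim in auto)
    qed
  qed
  also have "\<dots> = (\<integral>\<^sup>+D. G D \<partial>distr (data T) (data {1..nt}) g)"
    by (rule nn_integral_distr[OF gm, symmetric]) (unfold distr, rule G)
  finally show ?thesis unfolding distr F_def G_def .
qed

end

end

section \<open>Expectation over the data and averaging over the splits\<close>

context linear_estimators
begin

text \<open>Both deviation quantities have expectation at most B, so the weights 6 and 2 add up to
  8. Everything stays in the extended nonnegative reals since the expected oracle risk may be
  infinite.\<close>

lemma expected_holdout_bound:
  fixes y :: real
  assumes s: "integrable P (\<lambda>z. s (fst z))"
    and \<epsilon>: "0 < \<epsilon>" "\<epsilon> < 1"
    and y: "0 \<le> y"
    and E: "E = 1 \<or> 20000\<^sup>2 * (\<kappa> * ln \<kappa>)\<^sup>2 * y \<le> (\<epsilon> * \<eta>)\<^sup>2 \<and> E = real K * exp (- real (n - nt) * y)"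
    and B: "0 \<le> B" "(\<integral>\<^sup>+D. ennreal (max_dev D) \<partial>data {1..nt}) \<le> ennreal B"
      "(\<integral>\<^sup>+D. ennreal (max_mean_dev D) \<partial>data {1..nt}) \<le> ennreal B"
    and T: "T \<subseteq> {1..n}" "card T = nt"
  shows "(\<integral>\<^sup>+D. ennreal ((1 - \<epsilon>) * expectation (loss_diff (holdout d c qh th K n D T) s)) \<partial>data {1..n})
    \<le> ennreal (1 + \<epsilon>) * (\<integral>\<^sup>+D. ennreal (min_risk D) \<partial>data {1..nt})
      + ennreal (54 * c\<^sup>2 * y / (\<epsilon> * \<eta>) + 8 * c * B * E)"
proof -
  define R where "R = 54 * c\<^sup>2 * y / (\<epsilon> * \<eta>)"
  have R: "0 \<le> R" using y \<epsilon> \<eta> by (simp add: R_def)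
  have E0: "0 \<le> E" using E by auto
  have split: "ennreal ((1 + \<epsilon>) * min_risk D + R + c * (6 * max_dev D + 2 * max_mean_dev D) * E)
    = ennreal (1 + \<epsilon>) * ennreal (min_risk D) + ennreal R
      + (ennreal (6 * c * E) * ennreal (max_dev D) + ennreal (2 * c * E) * ennreal (max_mean_dev D))"
    if "D \<in> space (data {1..nt})" for D
  proof -
    have 1: "0 \<le> min_risk D"
      unfolding min_risk_def using risk_nonneg[OF s _ that] K by (intro Min.boundedI) auto
    have "(1 + \<epsilon>) * min_risk D + R + c * (6 * max_dev D + 2 * max_mean_dev D) * E
      = (1 + \<epsilon>) * min_risk D + R + (6 * c * E * max_dev D + 2 * c * E * max_mean_dev D)"
      by (simp add: algebra_simps)
    then show ?thesis
      using 1 \<epsilon> R E0 c max_dev_nonneg[of D] max_mean_dev_nonneg[of D]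
      by (simp add: ennreal_plus ennreal_mult)
  qed
  have "(\<integral>\<^sup>+D. ennreal ((1 - \<epsilon>) * expectation (loss_diff (holdout d c qh th K n D T) s)) \<partial>data {1..n})
    \<le> (\<integral>\<^sup>+D. ennreal ((1 + \<epsilon>) * min_risk D + R + c * (6 * max_dev D + 2 * max_mean_dev D) * E) \<partial>data {1..nt})"
    unfolding R_def by (rule holdout_bound[OF T s \<epsilon> y E])
  also have "\<dots> = (\<integral>\<^sup>+D. ennreal (1 + \<epsilon>) * ennreal (min_risk D) + ennreal R
      + (ennreal (6 * c * E) * ennreal (max_dev D) + ennreal (2 * c * E) * ennreal (max_mean_dev D)) \<partial>data {1..nt})"
    by (intro nn_integral_cong split)
  also have "\<dots> = ennreal (1 + \<epsilon>) * (\<integral>\<^sup>+D. ennreal (min_risk D) \<partial>data {1..nt})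
      + ennreal R * emeasure (data {1..nt}) (space (data {1..nt}))
      + (ennreal (6 * c * E) * (\<integral>\<^sup>+D. ennreal (max_dev D) \<partial>data {1..nt})
        + ennreal (2 * c * E) * (\<integral>\<^sup>+D. ennreal (max_mean_dev D) \<partial>data {1..nt}))"
  proof -
    have "(\<integral>\<^sup>+D. a * f D + b + (p * g D + q * h D) \<partial>M)
      = a * (\<integral>\<^sup>+D. f D \<partial>M) + b * emeasure M (space M) + (p * (\<integral>\<^sup>+D. g D \<partial>M) + q * (\<integral>\<^sup>+D. h D \<partial>M))"
      if "f \<in> borel_measurable M" "g \<in> borel_measurable M" "h \<in> borel_measurable M"
      for a b p q :: ennreal and f g h :: "dataset \<Rightarrow> ennreal" and M
      using that by (simp add: nn_integral_add nn_integral_cmult)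
    then show ?thesis by this measurable
  qed
  also have "\<dots> \<le> ennreal (1 + \<epsilon>) * (\<integral>\<^sup>+D. ennreal (min_risk D) \<partial>data {1..nt})
      + ennreal R * 1 + (ennreal (6 * c * E) * ennreal B + ennreal (2 * c * E) * ennreal B)"
    using B prob_space.emeasure_space_1[OF prob_space_data]
    by (intro add_mono mult_left_mono) auto
  also have "\<dots> = ennreal (1 + \<epsilon>) * (\<integral>\<^sup>+D. ennreal (min_risk D) \<partial>data {1..nt})
      + (ennreal R * 1 + (ennreal (6 * c * E) * ennreal B + ennreal (2 * c * E) * ennreal B))"
    by (simp only: add.assoc)
  also have "ennreal R * 1 + (ennreal (6 * c * E) * ennreal B + ennreal (2 * c * E) * ennreal B)
     = ennreal (R + (6 * c * E * B + 2 * c * E * B))"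
    using R E0 B c by (simp flip: ennreal_mult ennreal_plus)
  also have "R + (6 * c * E * B + 2 * c * E * B) = R + 8 * c * B * E" by simp
  finally show ?thesis by (simp only: R_def)
qed

lemma holdout_predictor:
  assumes T: "T \<subseteq> {1..n}" "card T = nt" and D: "D \<in> space (data {1..n})"
  shows "holdout d c qh th K n D T \<in> borel_measurable (Rd d)"
    and "integrable P (\<lambda>z. holdout d c qh th K n D T (fst z))"
  unfolding holdout_eq[OF T]
  by (rule est_measurable[OF khat_in[OF T] subsample_space[OF T D]]) (rule est_integrable)

lemma agghoo_excess_le:
  assumes s: "integrable P (\<lambda>z. s (fst z))" and V: "1 \<le> V"
    and \<T>: "\<T> \<in> collections n nt V" and D: "D \<in> space (data {1..n})"
  shows "excess_risk c P s (agghoo d c qh th K n D V \<T>)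
    \<le> ereal ((1 / real V) * (\<Sum>i\<in>{1..V}. expectation (loss_diff (holdout d c qh th K n D (\<T> i)) s)))"
proof -
  define h where "h = (\<lambda>i. holdout d c qh th K n D (\<T> i))"
  have T: "\<T> i \<subseteq> {1..n}" "card (\<T> i) = nt" if "i \<in> {1..V}" for i
    using \<T> that by (auto simp: collections_def PiE_iff)
  have hm [measurable]: "h i \<in> borel_measurable (Rd d)" and hi: "integrable P (\<lambda>z. h i (fst z))"
    if "i \<in> {1..V}" for i
    unfolding h_def using holdout_predictor[OF T[OF that] D] by auto
  define a where "a = agghoo d c qh th K n D V \<T>"
  have a: "a = (\<lambda>x. (1 / real V) * (\<Sum>i\<in>{1..V}. h i x))"
    by (simp only: a_def agghoo_def h_def)
  have am: "a \<in> borel_measurable (Rd d)"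
    unfolding a by (intro borel_measurable_times borel_measurable_const borel_measurable_sum hm)
  have ai: "integrable P (\<lambda>z. a (fst z))"
    unfolding a by (intro integrable_mult_right Bochner_Integration.integrable_sum hi)
  have li: "integrable P (loss_diff (h i) s)" if "i \<in> {1..V}" for i
    using hm[OF that] hi[OF that] s by (intro loss_diff_integrable) auto
  have "excess_risk c P s a = ereal (expectation (loss_diff a s))"
    using am ai s by (intro excess_risk_integrable) auto
  also have "expectation (loss_diff a s) \<le> expectation (\<lambda>z. (1 / real V) * (\<Sum>i\<in>{1..V}. loss_diff (h i) s z))"
  proof (rule integral_mono)
    show "integrable P (loss_diff a s)" using am ai s by (intro loss_diff_integrable) auto
    show "integrable P (\<lambda>z. (1 / real V) * (\<Sum>i\<in>{1..V}. loss_diff (h i) s z))"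
      by (intro integrable_mult_right Bochner_Integration.integrable_sum li)
    fix z
    have "snd z - a (fst z) = (1 / real V) * (\<Sum>i\<in>{1..V}. snd z - h i (fst z))"
      using V by (simp add: a sum_subtractf field_simps)
    then have "huber c (snd z - a (fst z)) \<le> (1 / real V) * (\<Sum>i\<in>{1..V}. huber c (snd z - h i (fst z)))"
      using huber_mean_le[OF c, of "{1..V}" "\<lambda>i. snd z - h i (fst z)"] V by simp
    then show "loss_diff a s z \<le> (1 / real V) * (\<Sum>i\<in>{1..V}. loss_diff (h i) s z)"
      using V by (simp add: loss_diff_def sum_subtractf field_simps)
  qed
  also have "expectation (\<lambda>z. (1 / real V) * (\<Sum>i\<in>{1..V}. loss_diff (h i) s z))
     = (1 / real V) * (\<Sum>i\<in>{1..V}. expectation (loss_diff (h i) s))"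
    using li by simp
  finally show ?thesis by (simp add: a_def h_def)
qed

lemma agghoo_measurable:
  assumes \<T>: "\<T> \<in> collections n nt V" and D: "D \<in> space (data {1..n})"
  shows "agghoo d c qh th K n D V \<T> \<in> borel_measurable (Rd d)"
proof -
  have "holdout d c qh th K n D (\<T> i) \<in> borel_measurable (Rd d)" if "i \<in> {1..V}" for i
    using \<T> that by (intro holdout_predictor D) (auto simp: collections_def PiE_iff)
  then show ?thesis unfolding agghoo_def
    by (intro borel_measurable_times borel_measurable_const borel_measurable_sum)
qed

lemma holdout_excess_nonneg:
  assumes s: "integrable P (\<lambda>z. s (fst z))" and T: "T \<subseteq> {1..n}" "card T = nt" and D: "D \<in> space (data {1..n})"
  shows "0 \<le> expectation (loss_diff (holdout d c qh th K n D T) s)"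
  using risk_nonneg[OF s khat_in[OF T] subsample_space[OF T D]]
  unfolding holdout_eq[OF T] risk_def .

text \<open>Independence of the collection and the data is the product measure. The bound C is the
  same for every T, so averaging over i and over the law Q leaves it unchanged. The average h of
  hold-out risks dominates the aggregate and is jointly measurable, as there are only finitely many
  collections.\<close>

lemma agghoo_expected_excess_le:
  assumes s: "integrable P (\<lambda>z. s (fst z))" and V: "1 \<le> V" and \<epsilon>: "0 < \<epsilon>" "\<epsilon> < 1"
    and Q: "prob_space Q" "sets Q = Pow (collections n nt V)"
    and bound: "\<And>T. T \<subseteq> {1..n} \<Longrightarrow> card T = nt \<Longrightarrow>
      (\<integral>\<^sup>+D. ennreal ((1 - \<epsilon>) * expectation (loss_diff (holdout d c qh th K n D T) s)) \<partial>data {1..n}) \<le> C"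
  shows "ennreal (1 - \<epsilon>) * (\<integral>\<^sup>+z. e2ennreal (case z of (\<T>, D) \<Rightarrow> excess_risk c P s (agghoo d c qh th K n D V \<T>))
      \<partial>(Q \<Otimes>\<^sub>M data {1..n})) \<le> C"
proof -
  interpret Q: prob_space Q by fact
  interpret Dn: prob_space "data {1..n}" by (rule prob_space_data)
  have space_Q: "space Q = collections n nt V" using Q(2) sets.sets_into_space sets.top by (metis PowD Pow_top subset_antisym)
  have Tc: "\<T> i \<subseteq> {1..n}" "card (\<T> i) = nt" if "\<T> \<in> collections n nt V" "i \<in> {1..V}" for \<T> i
    using that by (auto simp: collections_def PiE_iff)
  define l where "l = (\<lambda>T D. expectation (loss_diff (holdout d c qh th K n D T) s))"
  define h where "h = (\<lambda>\<T> D. ennreal (1 / real V) * (\<Sum>i\<in>{1..V}. ennreal ((1 - \<epsilon>) * l (\<T> i) D)))"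
  have lm [measurable]: "l T \<in> borel_measurable (data {1..n})" if "T \<subseteq> {1..n}" "card T = nt" for T
    unfolding l_def by (rule holdout_risk_measurable[OF that])
  have m: "(\<lambda>D. ennreal ((1 - \<epsilon>) * l (\<T> i) D)) \<in> borel_measurable (data {1..n})"
    if "\<T> \<in> collections n nt V" "i \<in> {1..V}" for \<T> i
  proof -
    note [measurable] = lm[OF Tc[OF that]]
    show ?thesis by measurable
  qed
  have hm: "h \<T> \<in> borel_measurable (data {1..n})" if "\<T> \<in> collections n nt V" for \<T>
  proof -
    have [measurable]: "(\<lambda>D. \<Sum>i\<in>{1..V}. ennreal ((1 - \<epsilon>) * l (\<T> i) D)) \<in> borel_measurable (data {1..n})"
      by (rule borel_measurable_sum[OF m[OF that]])
    show ?thesis unfolding h_def by measurable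
  qed
  have "case_prod h \<in> borel_measurable (count_space (collections n nt V) \<Otimes>\<^sub>M data {1..n})"
  proof (rule measurable_pair_measure_countable1)
    have "collections n nt V \<subseteq> {1..V} \<rightarrow>\<^sub>E Pow {1..n}" unfolding collections_def by (intro PiE_mono) auto
    then have "finite (collections n nt V)" by (rule finite_subset) (auto intro: finite_PiE)
    then show "countable (collections n nt V)" by (rule countable_finite)
  qed (simp add: hm del: One_nat_def)
  moreover have "sets (Q \<Otimes>\<^sub>M data {1..n}) = sets (count_space (collections n nt V) \<Otimes>\<^sub>M data {1..n})"
    by (intro sets_pair_measure_cong) (simp_all add: Q)
  ultimately have h2: "case_prod h \<in> borel_measurable (Q \<Otimes>\<^sub>M data {1..n})"
    by (simp cong: measurable_cong_sets)
  have le: "ennreal (1 - \<epsilon>) * e2ennreal (excess_risk c P s (agghoo d c qh th K n D V \<T>)) \<le> h \<T> D"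
    if \<T>: "\<T> \<in> collections n nt V" and D: "D \<in> space (data {1..n})" for \<T> D
  proof -
    have l0: "0 \<le> l (\<T> i) D" if "i \<in> {1..V}" for i
      unfolding l_def by (rule holdout_excess_nonneg[OF s Tc[OF \<T> that] D])
    have "ennreal (1 - \<epsilon>) * e2ennreal (excess_risk c P s (agghoo d c qh th K n D V \<T>))
      \<le> ennreal (1 - \<epsilon>) * e2ennreal (ereal ((1 / real V) * (\<Sum>i\<in>{1..V}. l (\<T> i) D)))"
      using agghoo_excess_le[OF s V \<T> D] unfolding l_def
      by (intro mult_left_mono e2ennreal_mono) auto
    also have "\<dots> = ennreal ((1 - \<epsilon>) * ((1 / real V) * (\<Sum>i\<in>{1..V}. l (\<T> i) D)))"
    proof -
      have "0 \<le> (\<Sum>i\<in>{1..V}. l (\<T> i) D)" by (intro sum_nonneg l0)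
      then show ?thesis using \<epsilon> by (subst ennreal_mult) auto
    qed
    also have "(1 - \<epsilon>) * ((1 / real V) * (\<Sum>i\<in>{1..V}. l (\<T> i) D)) = (1 / real V) * (\<Sum>i\<in>{1..V}. (1 - \<epsilon>) * l (\<T> i) D)"
      by (simp add: sum_distrib_left)
    also have "ennreal \<dots> = h \<T> D"
    proof -
      have "ennreal ((1 / real V) * (\<Sum>i\<in>{1..V}. (1 - \<epsilon>) * l (\<T> i) D))
        = ennreal (1 / real V) * ennreal (\<Sum>i\<in>{1..V}. (1 - \<epsilon>) * l (\<T> i) D)"
        using \<epsilon> l0 by (intro ennreal_mult sum_nonneg mult_nonneg_nonneg) auto
      also have "ennreal (\<Sum>i\<in>{1..V}. (1 - \<epsilon>) * l (\<T> i) D) = (\<Sum>i\<in>{1..V}. ennreal ((1 - \<epsilon>) * l (\<T> i) D))"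
        using \<epsilon> l0 by (intro sum_ennreal[symmetric] mult_nonneg_nonneg) auto
      finally show ?thesis by (simp only: h_def)
    qed
    finally show ?thesis .
  qed
  have "ennreal (1 - \<epsilon>) * (\<integral>\<^sup>+z. e2ennreal (case z of (\<T>, D) \<Rightarrow> excess_risk c P s (agghoo d c qh th K n D V \<T>)) \<partial>(Q \<Otimes>\<^sub>M data {1..n}))
    \<le> (\<integral>\<^sup>+z. case_prod h z \<partial>(Q \<Otimes>\<^sub>M data {1..n}))"
  proof -
    define g where "g = (\<lambda>z. e2ennreal (case z of (\<T>, D) \<Rightarrow> excess_risk c P s (agghoo d c qh th K n D V \<T>)))"
    \<comment> \<open>\<open>nn_integral_cmult\<close> asks for measurability, which is known for h.
      So the factor 1 - \<epsilon> is inverted and pulled out of the integral of h, while g is only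
      dominated.\<close>
    have "(\<integral>\<^sup>+z. g z \<partial>(Q \<Otimes>\<^sub>M data {1..n})) \<le> (\<integral>\<^sup>+z. ennreal (1 / (1 - \<epsilon>)) * case_prod h z \<partial>(Q \<Otimes>\<^sub>M data {1..n}))"
    proof (rule nn_integral_mono)
      fix z assume "z \<in> space (Q \<Otimes>\<^sub>M data {1..n})"
      then obtain \<T> D where z: "z = (\<T>, D)" "\<T> \<in> collections n nt V" "D \<in> space (data {1..n})"
        by (auto simp: space_pair_measure space_Q)
      have "ennreal (1 / (1 - \<epsilon>)) * (ennreal (1 - \<epsilon>) * g z) \<le> ennreal (1 / (1 - \<epsilon>)) * case_prod h z"
        using le[OF z(2,3)] by (intro mult_left_mono) (auto simp: z g_def)
      moreover have "ennreal (1 / (1 - \<epsilon>)) * (ennreal (1 - \<epsilon>) * g z) = g z"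
        using \<epsilon> by (simp add: mult.assoc[symmetric] flip: ennreal_mult)
      ultimately show "g z \<le> ennreal (1 / (1 - \<epsilon>)) * case_prod h z" by simp
    qed
    also have "\<dots> = ennreal (1 / (1 - \<epsilon>)) * (\<integral>\<^sup>+z. case_prod h z \<partial>(Q \<Otimes>\<^sub>M data {1..n}))"
      by (rule nn_integral_cmult[OF h2])
    finally have "ennreal (1 - \<epsilon>) * (\<integral>\<^sup>+z. g z \<partial>(Q \<Otimes>\<^sub>M data {1..n}))
      \<le> ennreal (1 - \<epsilon>) * (ennreal (1 / (1 - \<epsilon>)) * (\<integral>\<^sup>+z. case_prod h z \<partial>(Q \<Otimes>\<^sub>M data {1..n})))"
      by (intro mult_left_mono) auto
    also have "\<dots> = (\<integral>\<^sup>+z. case_prod h z \<partial>(Q \<Otimes>\<^sub>M data {1..n}))"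
      using \<epsilon> by (simp add: mult.assoc[symmetric] flip: ennreal_mult)
    finally show ?thesis by (simp only: g_def)
  qed
  also have "\<dots> = (\<integral>\<^sup>+\<T>. (\<integral>\<^sup>+D. h \<T> D \<partial>data {1..n}) \<partial>Q)"
    using Dn.nn_integral_fst[OF h2] by simp
  also have "\<dots> \<le> (\<integral>\<^sup>+\<T>. C \<partial>Q)"
  proof (rule nn_integral_mono)
    fix \<T> assume "\<T> \<in> space Q"
    then have \<T>: "\<T> \<in> collections n nt V" by (simp add: space_Q)
    have "(\<integral>\<^sup>+D. h \<T> D \<partial>data {1..n})
      = ennreal (1 / real V) * (\<Sum>i\<in>{1..V}. \<integral>\<^sup>+D. ennreal ((1 - \<epsilon>) * l (\<T> i) D) \<partial>data {1..n})"
      unfolding h_def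
      by (subst nn_integral_cmult[OF borel_measurable_sum[OF m[OF \<T>]]], assumption)
        (subst nn_integral_sum[OF m[OF \<T>]], auto)
    also have "\<dots> \<le> ennreal (1 / real V) * (\<Sum>i\<in>{1..V}. C)"
      unfolding l_def using Tc[OF \<T>] by (intro mult_left_mono sum_mono bound) auto
    also have "\<dots> = (ennreal (1 / real V) * ennreal (real V)) * C"
      by (simp add: ennreal_of_nat_eq_real_of_nat mult.assoc)
    also have "ennreal (1 / real V) * ennreal (real V) = 1"
      using V by (simp flip: ennreal_mult)
    finally show "(\<integral>\<^sup>+D. h \<T> D \<partial>data {1..n}) \<le> C" by simp
  qed
  also have "\<dots> = C" by (simp add: Q.emeasure_space_1)
  finally show ?thesis .
qed

end

section \<open>The remainder terms\<close>

text \<open>With M = max nt K, the union bound gives K M^(-(\<alpha>+3)) \<le> M^(-(\<alpha>+2)),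
  hence nt^(-2) after multiplication by nt^\<alpha>. Passing from M to nt needs \<alpha> + 2 \<ge>
  0; below -3/2 already nt^\<alpha> \<le> nt^(-3/2). Either way 1 / (nt sqrt nt) is reached, and nv
  \<le> nt concludes.\<close>

lemma bad_event_remainder:
  fixes \<alpha> :: real and nt nv K :: nat
  assumes nt: "1 \<le> nt" and nv: "1 \<le> nv" "nv \<le> nt" and K: "1 \<le> K"
    and E: "E = (if - 3 / 2 \<le> \<alpha> then real K * exp (- ((\<alpha> + 3) * ln (real (max nt K)))) else 1)"
  shows "E * real nt powr \<alpha> \<le> 1 / (real nt * sqrt (real nv))"
proof -
  have sq: "sqrt (real nv) \<le> sqrt (real nt)" using nv by simp
  have "real nt powr (- 3 / 2) = real nt powr (- (1 + 1 / 2))" by simp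
  also have "\<dots> = 1 / (real nt powr 1 * real nt powr (1 / 2))" by (simp only: powr_minus_divide powr_add)
  finally have 32: "real nt powr (- 3 / 2) = 1 / (real nt * sqrt (real nt))"
    using nt by (simp add: powr_half_sqrt)
  have "E * real nt powr \<alpha> \<le> 1 / (real nt * sqrt (real nt))"
  proof (cases "- 3 / 2 \<le> \<alpha>")
    case True
    define M where "M = real (max nt K)"
    have M: "real nt \<le> M" "real K \<le> M" "1 \<le> M" using nt by (auto simp: M_def)
    have "exp (- ((\<alpha> + 3) * ln M)) = M powr (- (\<alpha> + 3))" using M by (simp add: powr_def algebra_simps)
    then have "E = real K * M powr (- (\<alpha> + 3))" using True E by (simp add: M_def)
    also have "\<dots> \<le> M powr 1 * M powr (- (\<alpha> + 3))" using M by (intro mult_right_mono) auto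
    also have "\<dots> = M powr (- (\<alpha> + 2))"
    proof -
      have "1 + - (\<alpha> + 3) = - (\<alpha> + 2)" by simp
      then show ?thesis by (simp only: powr_add[symmetric])
    qed
    also have "\<dots> \<le> real nt powr (- (\<alpha> + 2))" using M nt True by (intro powr_mono2') auto
    finally have "E * real nt powr \<alpha> \<le> real nt powr (- (\<alpha> + 2)) * real nt powr \<alpha>"
      by (intro mult_right_mono) auto
    also have "\<dots> = real nt powr (- 2)" by (simp flip: powr_add)
    also have "\<dots> \<le> real nt powr (- 3 / 2)" using nt by (intro powr_mono) auto
    also note 32
    finally show ?thesis .
  next
    case False
    then have "E * real nt powr \<alpha> = real nt powr \<alpha>" by (simp add: E)
    also have "\<dots> \<le> real nt powr (- 3 / 2)" using nt False by (intro powr_mono) auto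
    also note 32
    finally show ?thesis .
  qed
  also have "\<dots> \<le> 1 / (real nt * sqrt (real nv))"
    using nt nv sq by (intro divide_left_mono mult_left_mono mult_pos_pos) auto
  finally show ?thesis .
qed

text \<open>Since sqrt (v/l) * sqrt ((\<alpha>+3) l/v) = sqrt (\<alpha>+3), the sample size and the
  logarithm cancel and the growth condition on kappa becomes the lower bound on \<theta>.\<close>

lemma kappa_condition:
  fixes k y \<nu>0 \<alpha> \<epsilon> \<eta> v l \<mu> :: real
  assumes k: "0 \<le> k" "k \<le> \<nu>0 * sqrt (v / l)" and v: "0 < v" "0 < l" and \<alpha>: "- 3 \<le> \<alpha>" and \<mu>: "0 \<le> \<mu>"
    and \<eta>: "0 < \<eta>" and \<epsilon>: "sqrt (\<alpha> + 3) * (\<mu> * \<nu>0 / \<eta>) \<le> \<epsilon>"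
  shows "\<mu>\<^sup>2 * k\<^sup>2 * ((\<alpha> + 3) * l / v) \<le> (\<epsilon> * \<eta>)\<^sup>2"
proof -
  define y where "y = (\<alpha> + 3) * l / v"
  have y: "0 \<le> y" using \<alpha> v by (simp add: y_def)
  have "\<mu> * k * sqrt y \<le> \<mu> * (\<nu>0 * sqrt (v / l)) * sqrt y"
    using k \<mu> y by (intro mult_right_mono mult_left_mono) auto
  also have "\<dots> = \<mu> * \<nu>0 * sqrt (v / l * y)"
    by (simp only: mult.assoc real_sqrt_mult)
  also have "v / l * y = \<alpha> + 3" using v by (simp add: y_def)
  also have "\<mu> * \<nu>0 * sqrt (\<alpha> + 3) = sqrt (\<alpha> + 3) * (\<mu> * \<nu>0 / \<eta>) * \<eta>" using \<eta> by simp
  also have "\<dots> \<le> \<epsilon> * \<eta>" using \<epsilon> \<eta> by (intro mult_right_mono) auto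
  finally have "(\<mu> * k * sqrt y)\<^sup>2 \<le> (\<epsilon> * \<eta>)\<^sup>2" using k \<mu> y by (intro power_mono) auto
  then show ?thesis using y by (simp add: power_mult_distrib y_def)
qed

section \<open>The oracle inequality with explicit constants\<close>

lemma agghoo_oracle_inequality:
  fixes d n nt nv V K :: nat and c \<eta> \<nu>0 L \<alpha> \<theta> :: real and P :: "sample measure" and s :: predictor
    and Q :: "(nat \<Rightarrow> nat set) measure" and qh :: intercepts and th :: coefficients
  assumes d: "1 \<le> d"
    and c: "0 < c"
    and P: "prob_space P"
    and sets_P: "sets P = sets (Rd d \<Otimes>\<^sub>M borel)"
    and square: "\<forall>j\<in>{1..d}. integrable P (\<lambda>z. (fst z j)\<^sup>2)"
    and opt: "optimal_predictor d c P s"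
    and \<eta>: "0 < \<eta>"
    and margin: "AE z in P. \<eta> \<le> real_cond_exp P (sigma_X d P)
                          (indicator {(x, y). \<bar>y - s x\<bar> \<le> c / 2}) z"
    and nt: "max 3 (real n / 2) \<le> real nt" "nt < n"
    and nv: "nv = n - nt"
    and V: "1 \<le> V"
    and Q: "prob_space Q" "sets Q = Pow (collections n nt V)"
    and K3: "3 \<le> K" "real K \<le> exp (sqrt (real nv))"
    and meas: "\<forall>m\<ge>1. \<forall>k\<in>{1..K}.
         qh k m \<in> (\<Pi>\<^sub>M i\<in>{1..m}. Rd d \<Otimes>\<^sub>M borel) \<rightarrow>\<^sub>M borel \<and>
         th k m \<in> (\<Pi>\<^sub>M i\<in>{1..m}. Rd d \<Otimes>\<^sub>M borel) \<rightarrow>\<^sub>M Rd d"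
    and sparse: "\<forall>m\<ge>1. AE D in (\<Pi>\<^sub>M i\<in>{1..m}. P). \<forall>k\<in>{1..K}. l0 d (th k m D) \<le> k"
    and intercept: "\<forall>m\<ge>1. AE D in (\<Pi>\<^sub>M i\<in>{1..m}. P). \<forall>k\<in>{1..K}.
         is_arg_min (\<lambda>q. \<bar>q + dot d (th k m D) (emp_mean_X m D)\<bar>)
                    (is_arg_min (emp_risk d c m D (th k m D)) (\<lambda>_. True))
                    (qh k m D)"
    and kappa: "kappa d P K < \<infinity>"
      "enn2real (kappa d P K) * ln (enn2real (kappa d P K))
        \<le> \<nu>0 * sqrt (real nv / ln (real (max nt K)))"
    and \<alpha>: "- 3 \<le> \<alpha>"
    and dev: "ext_integral (\<Pi>\<^sub>M i\<in>{1..nt}. P) (\<lambda>D. ereal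
          (MAX k\<in>{1..K}. MAX i\<in>{1..nt}. \<bar>dot d (th k nt D) (fst (D i) - mean_X d P)\<bar>))
        \<le> ereal (L * real nt powr \<alpha>)"
      "ext_integral (\<Pi>\<^sub>M i\<in>{1..nt}. P) (\<lambda>D. ereal
          (MAX k\<in>{1..K}. \<integral>z. \<bar>dot d (th k nt D) (fst z - mean_X d P)\<bar> \<partial>P))
        \<le> ereal (L * real nt powr \<alpha>)"
    and \<theta>: "0 < \<theta>" "sqrt (\<alpha> + 3) * (20000 * \<nu>0 / \<eta>) \<le> \<theta>" "\<theta> < 1"
  shows "ereal (1 - \<theta>) *
        ext_integral (Q \<Otimes>\<^sub>M (\<Pi>\<^sub>M i\<in>{1..n}. P))
          (\<lambda>(\<T>, D). excess_risk c P s (agghoo d c qh th K n D V \<T>))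
      \<le> ereal (1 + \<theta>) *
          ext_integral (\<Pi>\<^sub>M i\<in>{1..nt}. P)
            (\<lambda>D. MIN k\<in>{1..K}. excess_risk c P s (linpred d (qh k nt D) (th k nt D)))
        + ereal (54 * (\<alpha> + 3) * (c\<^sup>2 * ln (real (max K nt)) / (\<theta> * \<eta> * real nv)))
        + ereal (7 * 2 * L * c * ln (real K) / (\<theta> * real nt * sqrt (real nv)))"
proof -
  have nt1: "1 \<le> nt" and nv1: "1 \<le> nv" and nvnt: "nv \<le> nt" using nt nv by auto
  interpret prob_space P by fact
  interpret linear_estimators P d c s \<eta> K n nt qh th
    by unfold_locales (use c sets_P opt \<eta> margin square kappa K3 nt1 nt meas sparse intercept in auto)
  define M where "M = real (max nt K)"
  have M: "3 \<le> M" using K3 by (auto simp: M_def)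
  have lnM: "0 < ln M" using M by simp
  \<comment> \<open>Exponent per validation point: nv * y = (\<alpha> + 3) ln M, so each deviation
    event has probability at most M^(-(\<alpha>+3)).\<close>
  define y where "y = (\<alpha> + 3) * ln M / real nv"
  have y: "0 \<le> y" using \<alpha> lnM by (simp add: y_def)
  define E where "E = (if - 3 / 2 \<le> \<alpha> then real K * exp (- ((\<alpha> + 3) * ln M)) else 1)"
  define B where "B = L * real nt powr \<alpha>"
  define R where "R = 54 * (\<alpha> + 3) * (c\<^sup>2 * ln (real (max K nt)) / (\<theta> * \<eta> * real nv))"
  define S where "S = 7 * 2 * L * c * ln (real K) / (\<theta> * real nt * sqrt (real nv))"
  show ?thesis
  proof (cases "integrable P (\<lambda>z. s (fst z))")
    case s: True
    have "20000\<^sup>2 * (\<kappa> * ln \<kappa>)\<^sup>2 * y \<le> (\<theta> * \<eta>)\<^sup>2"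
      unfolding y_def
    proof (rule kappa_condition)
      show "\<kappa> * ln \<kappa> \<le> \<nu>0 * sqrt (real nv / ln M)" using kappa(2) by (simp add: \<kappa>_def M_def)
      show "0 \<le> \<kappa> * ln \<kappa>" using \<kappa>_ge ln_\<kappa>_ge by (intro mult_nonneg_nonneg) auto
    qed (use lnM nv1 \<alpha> \<eta> \<theta> in auto)
    moreover have "real (n - nt) * y = (\<alpha> + 3) * ln M" using nv nv1 by (simp add: y_def)
    ultimately have E: "E = 1 \<or> 20000\<^sup>2 * (\<kappa> * ln \<kappa>)\<^sup>2 * y \<le> (\<theta> * \<eta>)\<^sup>2 \<and> E = real K * exp (- real (n - nt) * y)"
      by (simp add: E_def)
    have dev1: "enn2ereal (\<integral>\<^sup>+D. ennreal (max_dev D) \<partial>data {1..nt}) \<le> ereal B"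
      using dev(1) ext_integral_nonneg[of "data {1..nt}" "\<lambda>D. ereal (max_dev D)"] max_dev_nonneg
      by (simp add: data_def max_dev_def centered_def B_def)
    have dev2: "enn2ereal (\<integral>\<^sup>+D. ennreal (max_mean_dev D) \<partial>data {1..nt}) \<le> ereal B"
      using dev(2) ext_integral_nonneg[of "data {1..nt}" "\<lambda>D. ereal (max_mean_dev D)"] max_mean_dev_nonneg
      by (simp add: data_def max_mean_dev_def centered_def B_def)
    \<comment> \<open>The sign of L is not assumed; it follows because B bounds the expectation of a
      nonnegative variable.\<close>
    have "(0 :: ereal) \<le> ereal B" using dev1 enn2ereal_nonneg order_trans by blast
    then have B0: "0 \<le> B" by simp
    have B: "(\<integral>\<^sup>+D. ennreal (max_dev D) \<partial>data {1..nt}) \<le> ennreal B"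
      "(\<integral>\<^sup>+D. ennreal (max_mean_dev D) \<partial>data {1..nt}) \<le> ennreal B"
      using e2ennreal_mono[OF dev1] e2ennreal_mono[OF dev2] by simp_all
    have L: "0 \<le> L" using B0 nt1 by (simp add: B_def zero_le_mult_iff)
    define b where "b = (\<integral>\<^sup>+D. ennreal (min_risk D) \<partial>data {1..nt})"
    define a where "a = (\<integral>\<^sup>+z. e2ennreal (case z of (\<T>, D) \<Rightarrow> excess_risk c P s (agghoo d c qh th K n D V \<T>))
      \<partial>(Q \<Otimes>\<^sub>M data {1..n}))"
    have R0: "0 \<le> R"
      unfolding R_def using \<alpha> lnM \<theta> \<eta> by (simp add: M_def max.commute)
    have S0: "0 \<le> S" unfolding S_def using L c K3 \<theta> by simp
    have rem: "54 * c\<^sup>2 * y / (\<theta> * \<eta>) + 8 * c * B * E \<le> R + S"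
    proof (rule add_mono)
      show "54 * c\<^sup>2 * y / (\<theta> * \<eta>) \<le> R"
        unfolding R_def y_def M_def max.commute[of nt K]
        by (simp only: times_divide_eq_right times_divide_eq_left divide_divide_eq_left ac_simps order_refl)
      have "E * real nt powr \<alpha> \<le> 1 / (real nt * sqrt (real nv))"
        by (rule bad_event_remainder[where K = K, OF nt1 nv1 nvnt]) (use K3 in \<open>auto simp: E_def M_def\<close>)
      then have "8 * c * L * (E * real nt powr \<alpha>) \<le> 8 * c * L * (1 / (real nt * sqrt (real nv)))"
        using c L by (intro mult_left_mono) auto
      also have "\<dots> = 8 * (c * L / (real nt * sqrt (real nv)))" by simp
      \<comment> \<open>14 is 7 times the value 2 chosen for the first constant; K \<ge> 3 > e and
        \<theta> < 1 give 8 \<le> 14 ln K / \<theta>.\<close>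
      also have "\<dots> \<le> (14 * ln (real K) / \<theta>) * (c * L / (real nt * sqrt (real nv)))"
      proof (rule mult_right_mono)
        have "exp 1 \<le> real K" using exp_le K3 by linarith
        then have "1 \<le> ln (real K)" using K3 by (subst ln_ge_iff) auto
        then have "8 * \<theta> \<le> 14 * ln (real K)" using \<theta> by linarith
        then show "8 \<le> 14 * ln (real K) / \<theta>" using \<theta> by (simp add: field_simps)
      qed (use c L in simp)
      also have "\<dots> = S" by (simp add: S_def ac_simps)
      finally show "8 * c * B * E \<le> S" by (simp add: B_def ac_simps)
    qed
    have "ennreal (1 - \<theta>) * a \<le> ennreal (1 + \<theta>) * b + ennreal (54 * c\<^sup>2 * y / (\<theta> * \<eta>) + 8 * c * B * E)"
      unfolding a_def b_def
      by (rule agghoo_expected_excess_le[OF s V \<theta>(1,3) Q])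
        (rule expected_holdout_bound[OF s \<theta>(1,3) y E B0 B])
    also have "\<dots> \<le> ennreal (1 + \<theta>) * b + ennreal (R + S)"
      using rem by (intro add_left_mono ennreal_leI)
    also have "\<dots> = ennreal (1 + \<theta>) * b + ennreal R + ennreal S"
      using R0 S0 by (simp add: add.assoc)
    finally have "enn2ereal (ennreal (1 - \<theta>) * a) \<le> enn2ereal (ennreal (1 + \<theta>) * b + ennreal R + ennreal S)"
      by (simp add: less_eq_ennreal.rep_eq)
    then have main: "ereal (1 - \<theta>) * enn2ereal a \<le> ereal (1 + \<theta>) * enn2ereal b + ereal R + ereal S"
    proof -
      have "enn2ereal (ennreal (1 - \<theta>)) = ereal (1 - \<theta>)" "enn2ereal (ennreal (1 + \<theta>)) = ereal (1 + \<theta>)"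
        "enn2ereal (ennreal R) = ereal R" "enn2ereal (ennreal S) = ereal S"
        using \<theta> R0 S0 by (intro enn2ereal_ennreal; simp)+
      then show ?thesis
        using \<open>enn2ereal (ennreal (1 - \<theta>) * a) \<le> _\<close> by (simp only: times_ennreal.rep_eq plus_ennreal.rep_eq)
    qed
    have space_Q: "space Q = collections n nt V"
      using Q(2) by (metis Pow_top PowD sets.sets_into_space sets.top subset_antisym)
    have "ext_integral (Q \<Otimes>\<^sub>M data {1..n})
          (\<lambda>(\<T>, D). excess_risk c P s (agghoo d c qh th K n D V \<T>)) = enn2ereal a"
      unfolding a_def
      by (rule ext_integral_nonneg)
        (auto simp: space_pair_measure space_Q intro!: excess_risk_nonneg agghoo_measurable)
    moreover have "ext_integral (data {1..nt})
            (\<lambda>D. MIN k\<in>{1..K}. excess_risk c P s (linpred d (qh k nt D) (th k nt D))) = enn2ereal b"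
    proof -
      have min: "(MIN k\<in>{1..K}. excess_risk c P s (linpred d (qh k nt D) (th k nt D))) = ereal (min_risk D)"
        if D: "D \<in> space (data {1..nt})" for D
      proof -
        have "excess_risk c P s (linpred d (qh k nt D) (th k nt D)) = ereal (risk k D)" if k: "k \<in> {1..K}" for k
          using excess_risk_integrable[OF est_measurable[OF k D]] s est_integrable
          by (simp add: risk_def est_def)
        then have "(\<lambda>k. excess_risk c P s (linpred d (qh k nt D) (th k nt D))) ` {1..K}
          = ereal ` ((\<lambda>k. risk k D) ` {1..K})" by (auto simp: image_image)
        also have "Min \<dots> = ereal (Min ((\<lambda>k. risk k D) ` {1..K}))"
          using K3 by (intro mono_Min_commute[symmetric]) (auto simp: mono_def)
        finally show ?thesis by (simp add: min_risk_def)
      qed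
      have "0 \<le> min_risk D" if "D \<in> space (data {1..nt})" for D
        unfolding min_risk_def using risk_nonneg[OF s _ that] K3 by (intro Min.boundedI) auto
      then have "ext_integral (data {1..nt})
            (\<lambda>D. MIN k\<in>{1..K}. excess_risk c P s (linpred d (qh k nt D) (th k nt D)))
         = enn2ereal (\<integral>\<^sup>+D. e2ennreal (MIN k\<in>{1..K}. excess_risk c P s (linpred d (qh k nt D) (th k nt D))) \<partial>data {1..nt})"
        by (intro ext_integral_nonneg) (simp only: min, simp)
      also have "\<dots> = enn2ereal b"
        unfolding b_def by (intro arg_cong[where f = enn2ereal] nn_integral_cong) (simp only: min e2ennreal_ereal)
      finally show ?thesis .
    qed
    ultimately show ?thesis using main by (simp only: data_def R_def S_def)
  next
    case False
    \<comment> \<open>Every linear predictor is integrable, so t - s is not; the right-hand side of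
      the inequality is then \<infinity>.\<close>
    have "excess_risk c P s (linpred d (qh k nt D) (th k nt D)) = \<infinity>"
      if k: "k \<in> {1..K}" and D: "D \<in> space (data {1..nt})" for k D
    proof (rule excess_risk_not_integrable)
      show "linpred d (qh k nt D) (th k nt D) \<in> borel_measurable (Rd d)"
        using est_measurable[OF k D] by (simp only: est_def)
      show "\<not> integrable P (\<lambda>z. linpred d (qh k nt D) (th k nt D) (fst z) - s (fst z))"
      proof
        assume "integrable P (\<lambda>z. linpred d (qh k nt D) (th k nt D) (fst z) - s (fst z))"
        from Bochner_Integration.integrable_diff[OF linpred_integrable[of "qh k nt D" "th k nt D"] this]
        show False using False by simp
      qed
    qed
    then have min: "(MIN k\<in>{1..K}. excess_risk c P s (linpred d (qh k nt D) (th k nt D))) = \<infinity>"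
      if "D \<in> space (data {1..nt})" for D
      using that K3 by (intro Min_eqI) (auto intro!: image_eqI[of _ _ 1])
    then have "ext_integral (data {1..nt})
            (\<lambda>D. MIN k\<in>{1..K}. excess_risk c P s (linpred d (qh k nt D) (th k nt D)))
       = enn2ereal (\<integral>\<^sup>+D. e2ennreal (MIN k\<in>{1..K}. excess_risk c P s (linpred d (qh k nt D) (th k nt D))) \<partial>data {1..nt})"
      by (intro ext_integral_nonneg) (simp only: min, simp)
    also have "\<dots> = enn2ereal (\<integral>\<^sup>+D. \<infinity> \<partial>data {1..nt})"
      by (intro arg_cong[where f = enn2ereal] nn_integral_cong) (simp only: min, simp)
    also have "\<dots> = \<infinity>"
      using prob_space.emeasure_space_1[OF prob_space_data[of "{1..nt}"]] by simp
    finally show ?thesis using \<theta> by (simp add: data_def)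
  qed
qed

theorem theorem3p2:
  shows "\<exists>\<mu>1 \<mu>2 :: real. 0 < \<mu>1 \<and> 1 \<le> \<mu>2 \<and>
    (\<forall>(d::nat) (c::real) (P::sample measure) (s::predictor) (\<eta>::real)
      (n::nat) (nt::nat) (nv::nat) (V::nat) (Q::(nat \<Rightarrow> nat set) measure)
      (K::nat) (qh::intercepts) (th::coefficients) (\<nu>0::real) (L::real) (\<alpha>::real) (\<theta>::real).
      1 \<le> d \<longrightarrow>
      0 < c \<longrightarrow>
      prob_space P \<longrightarrow>
      sets P = sets (Rd d \<Otimes>\<^sub>M borel) \<longrightarrow>
      (\<forall>j\<in>{1..d}. integrable P (\<lambda>z. (fst z j)\<^sup>2)) \<longrightarrow>
      optimal_predictor d c P s \<longrightarrow>
      0 < \<eta> \<longrightarrow>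
      (AE z in P. \<eta> \<le> real_cond_exp P (sigma_X d P)
                          (indicator {(x, y). \<bar>y - s x\<bar> \<le> c / 2}) z) \<longrightarrow>
      max 3 (real n / 2) \<le> real nt \<longrightarrow>
      nt < n \<longrightarrow>
      nv = n - nt \<longrightarrow>
      1 \<le> V \<longrightarrow>
      prob_space Q \<longrightarrow>
      sets Q = Pow (collections n nt V) \<longrightarrow>
      3 \<le> K \<longrightarrow>
      real K \<le> exp (sqrt (real nv)) \<longrightarrow>
      (\<forall>m\<ge>1. \<forall>k\<in>{1..K}.
         qh k m \<in> (\<Pi>\<^sub>M i\<in>{1..m}. Rd d \<Otimes>\<^sub>M borel) \<rightarrow>\<^sub>M borel \<and>
         th k m \<in> (\<Pi>\<^sub>M i\<in>{1..m}. Rd d \<Otimes>\<^sub>M borel) \<rightarrow>\<^sub>M Rd d) \<longrightarrow>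
      (\<forall>m\<ge>1. AE D in (\<Pi>\<^sub>M i\<in>{1..m}. P). \<forall>k\<in>{1..K}. l0 d (th k m D) \<le> k) \<longrightarrow>
      (\<forall>m\<ge>1. AE D in (\<Pi>\<^sub>M i\<in>{1..m}. P). \<forall>k\<in>{1..K}.
         is_arg_min (\<lambda>q. \<bar>q + dot d (th k m D) (emp_mean_X m D)\<bar>)
                    (is_arg_min (emp_risk d c m D (th k m D)) (\<lambda>_. True))
                    (qh k m D)) \<longrightarrow>
      kappa d P K < \<infinity> \<longrightarrow>
      enn2real (kappa d P K) * ln (enn2real (kappa d P K))
        \<le> \<nu>0 * sqrt (real nv / ln (real (max nt K))) \<longrightarrow>
      - 3 \<le> \<alpha> \<longrightarrow>
      ext_integral (\<Pi>\<^sub>M i\<in>{1..nt}. P) (\<lambda>D. ereal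
          (MAX k\<in>{1..K}. MAX i\<in>{1..nt}. \<bar>dot d (th k nt D) (fst (D i) - mean_X d P)\<bar>))
        \<le> ereal (L * real nt powr \<alpha>) \<longrightarrow>
      ext_integral (\<Pi>\<^sub>M i\<in>{1..nt}. P) (\<lambda>D. ereal
          (MAX k\<in>{1..K}. \<integral>z. \<bar>dot d (th k nt D) (fst z - mean_X d P)\<bar> \<partial>P))
        \<le> ereal (L * real nt powr \<alpha>) \<longrightarrow>
      0 < \<theta> \<longrightarrow>
      sqrt (\<alpha> + 3) * (\<mu>2 * \<nu>0 / \<eta>) \<le> \<theta> \<longrightarrow>
      \<theta> < 1 \<longrightarrow>
      ereal (1 - \<theta>) *
        ext_integral (Q \<Otimes>\<^sub>M (\<Pi>\<^sub>M i\<in>{1..n}. P))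
          (\<lambda>(\<T>, D). excess_risk c P s (agghoo d c qh th K n D V \<T>))
      \<le> ereal (1 + \<theta>) *
          ext_integral (\<Pi>\<^sub>M i\<in>{1..nt}. P)
            (\<lambda>D. MIN k\<in>{1..K}. excess_risk c P s (linpred d (qh k nt D) (th k nt D)))
        + ereal (54 * (\<alpha> + 3) * (c\<^sup>2 * ln (real (max K nt)) / (\<theta> * \<eta> * real nv)))
        + ereal (7 * \<mu>1 * L * c * ln (real K) / (\<theta> * real nt * sqrt (real nv))))"
  by (rule exI[of _ 2], rule exI[of _ 20000], intro conjI allI impI, simp, simp,
      rule agghoo_oracle_inequality, assumption+)

end
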